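(* Let $\Lambda$ be an artin algebra, let $M$ be a $\Lambda$-module and let $t\in\mathbb Z^+\cup\{\infty\}$. If $\operatorname{Ext}^1_\Lambda(M,\Lambda)=0$ and $M$ is $t$-torsionfree, then $M\in{}^{\perp_1}\mathcal S_t$.
   Context: $\Lambda$ is an artin algebra over a commutative artin ring $R$. "Module" means finitely generated left $\Lambda$-module; their category is $\Lambda\text{-mod}$. $D$ is the canonical duality between $\Lambda\text{-mod}$ and $\Lambda^{\mathrm{op}}\text{-mod}$. A module $M$ is $t$-torsionfree (respectively, $\infty$-torsionfree) if $\operatorname{Ext}^i_{\Lambda^{\mathrm{op}}}(\operatorname{Tr}M,\Lambda)=0$ for $1\le i\le t$ (respectively, for all $i\ge1$), where $\operatorname{Tr}$ is the Auslander transpose. Let $\cdots\to P_2\xrightarrow{\partial_2}P_1\xrightarrow{\partial_1}P_0\to D(\Lambda_\Lambda)\to 0$ be a minimal projective resolution; put $K_0=D(\Lambda_\Lambda)$ and $K_i=\operatorname{Im}\partial_i$ for $i\ge1$. For $n\in\mathbb N$ let $\mathcal S_n=\{K_0,K_1,\dots,K_n\}$, and let $\mathcal S_\infty=\{K_0,K_1,\dots\}$. For a class $\mathcal X$ of modules, ${}^{\perp_1}\mathcal X=\{Z\in\Lambda\text{-mod}\mid \operatorname{Ext}^1_\Lambda(Z,X)=0\text{ for all }X\in\mathcal X\}$. *)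

theory Defs
  imports "HOL-Library.Extended_Nat" "HOL-Algebra.Elementary_Groups" "HOL-Algebra.Ideal"
    "HOL-Algebra.Module"
begin

section \<open>Modules over a not necessarily commutative ring\<close>

text \<open>
  The locale \<open>module\<close> of HOL-Algebra requires a commutative ring of scalars. We keep its record type
  (where the fields \<open>mult\<close> and \<open>one\<close> of a module carry no meaning)
  and its \<open>submodule\<close>, which does not need commutativity.
\<close>

locale left_module = R?: ring R + M?: abelian_group M
  for R :: "('a, 'c) ring_scheme" (structure) and M :: "('a, 'm) module" (structure) +
  assumes lsmult_closed:
      "\<lbrakk>a \<in> carrier R; x \<in> carrier M\<rbrakk> \<Longrightarrow> a \<odot>\<^bsub>M\<^esub> x \<in> carrier M"
    and lsmult_l_distr:
      "\<lbrakk>a \<in> carrier R; b \<in> carrier R; x \<in> carrier M\<rbrakk> \<Longrightarrow>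
        (a \<oplus> b) \<odot>\<^bsub>M\<^esub> x = a \<odot>\<^bsub>M\<^esub> x \<oplus>\<^bsub>M\<^esub> b \<odot>\<^bsub>M\<^esub> x"
    and lsmult_r_distr:
      "\<lbrakk>a \<in> carrier R; x \<in> carrier M; y \<in> carrier M\<rbrakk> \<Longrightarrow>
        a \<odot>\<^bsub>M\<^esub> (x \<oplus>\<^bsub>M\<^esub> y) = a \<odot>\<^bsub>M\<^esub> x \<oplus>\<^bsub>M\<^esub> a \<odot>\<^bsub>M\<^esub> y"
    and lsmult_assoc:
      "\<lbrakk>a \<in> carrier R; b \<in> carrier R; x \<in> carrier M\<rbrakk> \<Longrightarrow>
        (a \<otimes> b) \<odot>\<^bsub>M\<^esub> x = a \<odot>\<^bsub>M\<^esub> (b \<odot>\<^bsub>M\<^esub> x)"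
    and lsmult_one: "x \<in> carrier M \<Longrightarrow> \<one> \<odot>\<^bsub>M\<^esub> x = x"

definition fin_gen :: "('a, 'c) ring_scheme \<Rightarrow> ('a, 'm) module \<Rightarrow> bool" where
  "fin_gen A M \<longleftrightarrow> (\<exists>S. finite S \<and> S \<subseteq> carrier M \<and>
     (\<forall>N. submodule N A M \<and> S \<subseteq> N \<longrightarrow> N = carrier M))"

text \<open>Right \<open>A\<close>-modules are the left modules over \<open>opposite A\<close>.\<close>

definition opposite :: "('a, 'c) ring_scheme \<Rightarrow> ('a, 'c) ring_scheme" where
  "opposite A = A\<lparr>monoid.mult := (\<lambda>x y. y \<otimes>\<^bsub>A\<^esub> x)\<rparr>"

text \<open>
  \<open>regular A\<close> is \<open>A\<close> as a left module over itself, so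
  \<open>regular (opposite A)\<close> is \<open>A\<close> as a right \<open>A\<close>-module.
\<close>

definition regular :: "('a, 'c) ring_scheme \<Rightarrow> ('a, 'a) module" where
  "regular A = \<lparr>carrier = carrier A, monoid.mult = undefined, one = undefined,
     ring.zero = \<zero>\<^bsub>A\<^esub>, ring.add = (\<oplus>\<^bsub>A\<^esub>), smult = (\<otimes>\<^bsub>A\<^esub>)\<rparr>"

definition quotient_module :: "('a, 'm) module \<Rightarrow> 'm set \<Rightarrow> ('a, 'm set) module" where
  "quotient_module M N = \<lparr>carrier = a_rcosets\<^bsub>M\<^esub> N, monoid.mult = undefined, one = undefined,
     ring.zero = N, ring.add = set_add M, smult = (\<lambda>a C. \<Union>x\<in>C. N +>\<^bsub>M\<^esub> (a \<odot>\<^bsub>M\<^esub> x))\<rparr>"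

text \<open>Homomorphisms are extensional functions, so that equal homomorphisms are equal in HOL.\<close>

definition lmod_hom ::
  "('a, 'c) ring_scheme \<Rightarrow> ('a, 'm) module \<Rightarrow> ('a, 'n) module \<Rightarrow> ('m \<Rightarrow> 'n) set" where
  "lmod_hom A M N = {f \<in> carrier M \<rightarrow>\<^sub>E carrier N.
     (\<forall>x\<in>carrier M. \<forall>y\<in>carrier M. f (x \<oplus>\<^bsub>M\<^esub> y) = f x \<oplus>\<^bsub>N\<^esub> f y) \<and>
     (\<forall>a\<in>carrier A. \<forall>x\<in>carrier M. f (a \<odot>\<^bsub>M\<^esub> x) = a \<odot>\<^bsub>N\<^esub> f x)}"

definition hom_add ::
  "('a, 'm) module \<Rightarrow> ('a, 'n) module \<Rightarrow> ('m \<Rightarrow> 'n) \<Rightarrow> ('m \<Rightarrow> 'n) \<Rightarrow> 'm \<Rightarrow> 'n" where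
  "hom_add M N f g = (\<lambda>x\<in>carrier M. f x \<oplus>\<^bsub>N\<^esub> g x)"

definition hom_zero :: "('a, 'm) module \<Rightarrow> ('a, 'n) module \<Rightarrow> 'm \<Rightarrow> 'n" where
  "hom_zero M N = (\<lambda>x\<in>carrier M. \<zero>\<^bsub>N\<^esub>)"


section \<open>Projective and injective modules\<close>

text \<open>
  HOL cannot quantify over all types inside a definition, so the lifting and extension properties
  are tested on modules whose elements have type \<open>(nat \<Rightarrow> 'a) set\<close>, where \<open>'a\<close> is the type of
  scalars. Every finitely generated module, being a quotient of some \<open>A\<^sup>n\<close>, has an isomorphic
  copy there. Hence \<open>projective\<close> is projectivity for a finitely generated module (test with an
  epimorphism from \<open>A\<^sup>n\<close>), and \<open>injective\<close> is injectivity by Baer's criterion (test with the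
  inclusions of left ideals into \<open>A\<close>).
\<close>

type_synonym 'a univ = "(nat \<Rightarrow> 'a) set"

definition projective :: "('a, 'c) ring_scheme \<Rightarrow> ('a, 'p) module \<Rightarrow> bool" where
  "projective A P \<longleftrightarrow> left_module A P \<and>
     (\<forall>(X :: ('a, 'a univ) module) (Y :: ('a, 'a univ) module) g f.
        left_module A X \<and> left_module A Y \<and>
        g \<in> lmod_hom A X Y \<and> g ` carrier X = carrier Y \<and> f \<in> lmod_hom A P Y \<longrightarrow>
        (\<exists>h \<in> lmod_hom A P X. \<forall>x\<in>carrier P. g (h x) = f x))"

definition injective :: "('a, 'c) ring_scheme \<Rightarrow> ('a, 'j) module \<Rightarrow> bool" where
  "injective A J \<longleftrightarrow> left_module A J \<and>
     (\<forall>(X :: ('a, 'a univ) module) (Y :: ('a, 'a univ) module) g f.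
        left_module A X \<and> left_module A Y \<and>
        g \<in> lmod_hom A X Y \<and> inj_on g (carrier X) \<and> f \<in> lmod_hom A X J \<longrightarrow>
        (\<exists>h \<in> lmod_hom A Y J. \<forall>x\<in>carrier X. h (g x) = f x))"

definition injective_envelope ::
  "('a, 'c) ring_scheme \<Rightarrow> ('a, 'x) module \<Rightarrow> ('a, 'j) module \<Rightarrow> ('x \<Rightarrow> 'j) \<Rightarrow> bool" where
  "injective_envelope A X J i \<longleftrightarrow> left_module A X \<and> injective A J \<and>
     i \<in> lmod_hom A X J \<and> inj_on i (carrier X) \<and>
     (\<forall>N. submodule N A J \<and> N \<inter> i ` carrier X = {\<zero>\<^bsub>J\<^esub>} \<longrightarrow> N = {\<zero>\<^bsub>J\<^esub>})"

definition superfluous :: "('a, 'c) ring_scheme \<Rightarrow> ('a, 'm) module \<Rightarrow> 'm set \<Rightarrow> bool" where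
  "superfluous A M K \<longleftrightarrow> submodule K A M \<and>
     (\<forall>N. submodule N A M \<and> K <+>\<^bsub>M\<^esub> N = carrier M \<longrightarrow> N = carrier M)"

definition projective_cover ::
  "('a, 'c) ring_scheme \<Rightarrow> ('a, 'x) module \<Rightarrow> ('a, 'p) module \<Rightarrow> ('p \<Rightarrow> 'x) \<Rightarrow> bool" where
  "projective_cover A X P f \<longleftrightarrow> fin_gen A P \<and> projective A P \<and>
     f \<in> lmod_hom A P X \<and> f ` carrier P = carrier X \<and> superfluous A P (a_kernel P X f)"


section \<open>Projective resolutions and Ext\<close>

text \<open>
  The differential \<open>d (Suc i)\<close> goes from \<open>P (Suc i)\<close> to \<open>P i\<close>, and \<open>e\<close> is the augmentation
  \<open>P 0 \<rightarrow> X\<close>; the value \<open>d 0\<close> is irrelevant.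
\<close>

definition projective_resolution ::
  "('a, 'c) ring_scheme \<Rightarrow> ('a, 'x) module \<Rightarrow> (nat \<Rightarrow> ('a, 'p) module) \<Rightarrow>
     (nat \<Rightarrow> 'p \<Rightarrow> 'p) \<Rightarrow> ('p \<Rightarrow> 'x) \<Rightarrow> bool" where
  "projective_resolution A X P d e \<longleftrightarrow>
     (\<forall>i. fin_gen A (P i) \<and> projective A (P i)) \<and>
     e \<in> lmod_hom A (P 0) X \<and> (\<forall>i. d (Suc i) \<in> lmod_hom A (P (Suc i)) (P i)) \<and>
     e ` carrier (P 0) = carrier X \<and>
     d 1 ` carrier (P 1) = a_kernel (P 0) X e \<and>
     (\<forall>i. d (Suc (Suc i)) ` carrier (P (Suc (Suc i))) = a_kernel (P (Suc i)) (P i) (d (Suc i)))"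

definition minimal_projective_resolution ::
  "('a, 'c) ring_scheme \<Rightarrow> ('a, 'x) module \<Rightarrow> (nat \<Rightarrow> ('a, 'p) module) \<Rightarrow>
     (nat \<Rightarrow> 'p \<Rightarrow> 'p) \<Rightarrow> ('p \<Rightarrow> 'x) \<Rightarrow> bool" where
  "minimal_projective_resolution A X P d e \<longleftrightarrow> projective_resolution A X P d e \<and>
     superfluous A (P 0) (a_kernel (P 0) X e) \<and>
     (\<forall>i. superfluous A (P (Suc i)) (a_kernel (P (Suc i)) (P i) (d (Suc i))))"

definition cocycles ::
  "('a, 'c) ring_scheme \<Rightarrow> (nat \<Rightarrow> ('a, 'p) module) \<Rightarrow> (nat \<Rightarrow> 'p \<Rightarrow> 'p) \<Rightarrow>
     ('a, 'y) module \<Rightarrow> nat \<Rightarrow> ('p \<Rightarrow> 'y) set" where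
  "cocycles A P d Y i =
     {f \<in> lmod_hom A (P i) Y. compose (carrier (P (Suc i))) f (d (Suc i)) = hom_zero (P (Suc i)) Y}"

fun coboundaries ::
  "('a, 'c) ring_scheme \<Rightarrow> (nat \<Rightarrow> ('a, 'p) module) \<Rightarrow> (nat \<Rightarrow> 'p \<Rightarrow> 'p) \<Rightarrow>
     ('a, 'y) module \<Rightarrow> nat \<Rightarrow> ('p \<Rightarrow> 'y) set" where
  "coboundaries A P d Y 0 = {hom_zero (P 0) Y}"
| "coboundaries A P d Y (Suc i) =
     (\<lambda>f. compose (carrier (P (Suc i))) f (d (Suc i))) ` lmod_hom A (P i) Y"

definition hom_cohomology ::
  "('a, 'c) ring_scheme \<Rightarrow> (nat \<Rightarrow> ('a, 'p) module) \<Rightarrow> (nat \<Rightarrow> 'p \<Rightarrow> 'p) \<Rightarrow>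
     ('a, 'y) module \<Rightarrow> nat \<Rightarrow> ('p \<Rightarrow> 'y) set monoid" where
  "hom_cohomology A P d Y i =
     \<lparr>carrier = cocycles A P d Y i, monoid.mult = hom_add (P i) Y, one = hom_zero (P i) Y\<rparr>
     Mod coboundaries A P d Y i"

text \<open>
  The group \<open>Ext\<^sup>i(X, Y)\<close>, for \<open>X\<close> finitely generated over a left noetherian ring, so that a
  resolution by finitely generated projectives exists, with all terms in the type \<open>'a univ\<close>.
\<close>

definition Ext ::
  "('a, 'c) ring_scheme \<Rightarrow> nat \<Rightarrow> ('a, 'x) module \<Rightarrow> ('a, 'y) module \<Rightarrow>
     ('a univ \<Rightarrow> 'y) set monoid" where
  "Ext A i X Y =
     (let (P, d, e) = (SOME (P :: nat \<Rightarrow> ('a, 'a univ) module, d, e).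
                         projective_resolution A X P d e)
      in hom_cohomology A P d Y i)"

definition perp1 ::
  "('a, 'c) ring_scheme \<Rightarrow> ('a, 'x) module set \<Rightarrow> ('a, 'm) module set" where
  "perp1 A \<X> = {Z. left_module A Z \<and> fin_gen A Z \<and> (\<forall>X\<in>\<X>. trivial_group (Ext A 1 Z X))}"


section \<open>The Auslander transpose and torsionfreeness\<close>

text \<open>\<open>star A P\<close> is \<open>Hom\<^sub>A(P, A)\<close> with the right \<open>A\<close>-module structure \<open>(f a)(x) = f(x) a\<close>.\<close>

definition star :: "('a, 'c) ring_scheme \<Rightarrow> ('a, 'p) module \<Rightarrow> ('a, 'p \<Rightarrow> 'a) module" where
  "star A P = \<lparr>carrier = lmod_hom A P (regular A), monoid.mult = undefined, one = undefined,
     ring.zero = hom_zero P (regular A), ring.add = hom_add P (regular A),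
     smult = (\<lambda>a f. \<lambda>x\<in>carrier P. f x \<otimes>\<^bsub>A\<^esub> a)\<rparr>"

definition minimal_presentation ::
  "('a, 'c) ring_scheme \<Rightarrow> ('a, 'm) module \<Rightarrow> ('a, 'p) module \<Rightarrow> ('a, 'p) module \<Rightarrow>
     ('p \<Rightarrow> 'p) \<Rightarrow> ('p \<Rightarrow> 'm) \<Rightarrow> bool" where
  "minimal_presentation A M P1 P0 d e \<longleftrightarrow> projective_cover A M P0 e \<and>
     projective_cover A (P0\<lparr>carrier := a_kernel P0 M e\<rparr>) P1 d"

definition transpose_module ::
  "('a, 'c) ring_scheme \<Rightarrow> ('a, 'm) module \<Rightarrow> ('a, ('a univ \<Rightarrow> 'a) set) module" where
  "transpose_module A M =
     (let (P1, P0, d, e) = (SOME (P1 :: ('a, 'a univ) module, P0, d, e).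
                              minimal_presentation A M P1 P0 d e)
      in quotient_module (star A P1)
           ((\<lambda>f. compose (carrier P1) f d) ` carrier (star A P0)))"

definition torsionfree :: "('a, 'c) ring_scheme \<Rightarrow> enat \<Rightarrow> ('a, 'm) module \<Rightarrow> bool" where
  "torsionfree A t M \<longleftrightarrow> (\<forall>i. 1 \<le> i \<and> enat i \<le> t \<longrightarrow>
     trivial_group (Ext (opposite A) i (transpose_module A M) (regular (opposite A))))"


section \<open>Artin algebras and their duality\<close>

locale artinian_cring = cring +
  assumes descending_chain:
    "\<lbrakk>\<And>n :: nat. ideal (I n) R; \<And>n. I (Suc n) \<subseteq> I n\<rbrakk> \<Longrightarrow> \<exists>n. \<forall>m\<ge>n. I m = I n"

text \<open>
  The record of \<open>A\<close> holds both its ring structure and its scalar multiplication by \<open>R\<close>.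
  The locale \<open>algebra\<close> of HOL-Algebra is not used since it makes \<open>A\<close> commutative.
\<close>

locale artin_algebra = R: artinian_cring R + A: ring A + module R A
  for R :: "('r, 'c) ring_scheme" and A :: "('r, 'a) module" +
  assumes smult_mult_left: "\<lbrakk>r \<in> carrier R; x \<in> carrier A; y \<in> carrier A\<rbrakk> \<Longrightarrow>
      (r \<odot>\<^bsub>A\<^esub> x) \<otimes>\<^bsub>A\<^esub> y = r \<odot>\<^bsub>A\<^esub> (x \<otimes>\<^bsub>A\<^esub> y)"
    and smult_mult_right: "\<lbrakk>r \<in> carrier R; x \<in> carrier A; y \<in> carrier A\<rbrakk> \<Longrightarrow>
      x \<otimes>\<^bsub>A\<^esub> (r \<odot>\<^bsub>A\<^esub> y) = r \<odot>\<^bsub>A\<^esub> (x \<otimes>\<^bsub>A\<^esub> y)"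
    and finitely_generated: "fin_gen R A"

definition jacobson_radical :: "('r, 'c) ring_scheme \<Rightarrow> 'r set" where
  "jacobson_radical R = carrier R \<inter> \<Inter>{I. maximalideal I R}"

text \<open>The action of \<open>R\<close> on a (left or right) \<open>A\<close>-module, through \<open>r \<mapsto> r 1\<^sub>A\<close>.\<close>

definition restrict_scalars :: "('r, 'a) module \<Rightarrow> ('a, 'x) module \<Rightarrow> ('r, 'x) module" where
  "restrict_scalars A X = \<lparr>carrier = carrier X, monoid.mult = undefined, one = undefined,
     ring.zero = \<zero>\<^bsub>X\<^esub>, ring.add = (\<oplus>\<^bsub>X\<^esub>), smult = (\<lambda>r x. (r \<odot>\<^bsub>A\<^esub> \<one>\<^bsub>A\<^esub>) \<odot>\<^bsub>X\<^esub> x)\<rparr>"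

text \<open>
  \<open>D X = Hom\<^sub>R(X, J)\<close>, where \<open>J\<close> is the injective envelope of \<open>R / rad R\<close>, for a right
  \<open>A\<close>-module \<open>X\<close> (a left module over \<open>opposite A\<close>). The left action is \<open>(a f)(x) = f(x a)\<close>.
\<close>

definition dual_module ::
  "('r, 'c) ring_scheme \<Rightarrow> ('r, 'a) module \<Rightarrow> ('r, 'j) module \<Rightarrow> ('a, 'x) module \<Rightarrow>
     ('a, 'x \<Rightarrow> 'j) module" where
  "dual_module R A J X = \<lparr>carrier = lmod_hom R (restrict_scalars A X) J,
     monoid.mult = undefined, one = undefined,
     ring.zero = hom_zero (restrict_scalars A X) J, ring.add = hom_add (restrict_scalars A X) J,
     smult = (\<lambda>a f. \<lambda>x\<in>carrier X. f (a \<odot>\<^bsub>X\<^esub> x))\<rparr>"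


section \<open>The syzygies of a resolution\<close>

text \<open>
  The modules \<open>K\<^sub>0 = X\<close> and \<open>K\<^sub>i = Im d\<^sub>i \<subseteq> P\<^sub>i\<^sub>-\<^sub>1\<close> have elements of different types.
  To collect them in one set, they are replaced by isomorphic copies in the sum type.
\<close>

definition copy_module :: "('m \<Rightarrow> 'n) \<Rightarrow> ('a, 'm) module \<Rightarrow> ('a, 'n) module" where
  "copy_module h M = \<lparr>carrier = h ` carrier M, monoid.mult = undefined, one = undefined,
     ring.zero = h \<zero>\<^bsub>M\<^esub>,
     ring.add = (\<lambda>x y. h (inv_into (carrier M) h x \<oplus>\<^bsub>M\<^esub> inv_into (carrier M) h y)),
     smult = (\<lambda>a x. h (a \<odot>\<^bsub>M\<^esub> inv_into (carrier M) h x))\<rparr>"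

fun syzygy ::
  "('a, 'x) module \<Rightarrow> (nat \<Rightarrow> ('a, 'p) module) \<Rightarrow> (nat \<Rightarrow> 'p \<Rightarrow> 'p) \<Rightarrow> nat \<Rightarrow>
     ('a, 'x + 'p) module" where
  "syzygy X P d 0 = copy_module Inl X"
| "syzygy X P d (Suc i) =
     copy_module Inr ((P i)\<lparr>carrier := d (Suc i) ` carrier (P (Suc i))\<rparr>)"

definition syzygies ::
  "('a, 'x) module \<Rightarrow> (nat \<Rightarrow> ('a, 'p) module) \<Rightarrow> (nat \<Rightarrow> 'p \<Rightarrow> 'p) \<Rightarrow> enat \<Rightarrow>
     ('a, 'x + 'p) module set" where
  "syzygies X P d t = {syzygy X P d i | i. enat i \<le> t}"

end

theory Submission
  imports Defs
begin

text \<open>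
  The idea is that \<open>Tor\<^sub>i(Tr M, D \<Lambda>)\<close> is dual to \<open>Ext\<^sup>i(Tr M, \<Lambda>)\<close>, so that torsionfreeness makes it
  vanish for \<open>1 \<le> i \<le> t\<close>. Shifting dimension along the resolution of \<open>D \<Lambda>\<close> gives
  \<open>Tor\<^sub>1(Tr M, K\<^sub>j) = 0\<close> for \<open>j < t\<close>. Since this is the group of maps \<open>M \<rightarrow> K\<^sub>j\<close> modulo those
  that factor through a projective module, every such map lifts along \<open>P\<^sub>j \<rightarrow> K\<^sub>j\<close>, and with
  \<open>Ext\<^sup>1(M, P\<^sub>j) = 0\<close> this gives \<open>Ext\<^sup>1(M, K\<^sub>j\<^sub>+\<^sub>1) = 0\<close>. For \<open>K\<^sub>0 = D \<Lambda>\<close> the claim is injectivity.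

  No tensor product is needed: \<open>Q \<otimes> X\<close> is replaced by \<open>Hom(Hom(Q, \<Lambda>), X)\<close> for a finitely generated
  projective right module \<open>Q\<close>, and such a module is handled through a dual basis.
\<close>

section \<open>Left modules and linear maps\<close>

text \<open>\<open>Ext\<close> and \<open>transpose_module\<close> rest on arbitrary choices, and
  such a choice says nothing until an object of the required kind is known to exist. This is why
  chain conditions come into play: from descending chains of ideals of \<open>R\<close> alone one
  has to derive that \<open>\<Lambda>\<close> is noetherian on both sides, so that kernels stay
  finitely generated, and artinian, so that projective covers exist. The choices are moreover
  unrelated. The resolution of M need not begin with the presentation behind
  \<open>transpose_module\<close>, and the resolution of the transpose need not begin with the dual
  of that presentation; comparison maps bridge both gaps. The injectivity that settles K_0 also
  provides the passage from Ext to Tor: a map into D \<Lambda> that kills the kernel of a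
  differential extends along it. As for the bound, K_(j+1) is reached through Tor_1(Tr M, K_j),
  which is Tor_(j+1)(Tr M, D \<Lambda>), and this is controlled by Ext in the same degree
  j+1.\<close>

lemma left_moduleI:
  assumes "ring A"
    and "\<And>x y. x \<in> carrier M \<Longrightarrow> y \<in> carrier M \<Longrightarrow> x \<oplus>\<^bsub>M\<^esub> y \<in> carrier M"
    and "\<zero>\<^bsub>M\<^esub> \<in> carrier M"
    and "\<And>x y z. x \<in> carrier M \<Longrightarrow> y \<in> carrier M \<Longrightarrow> z \<in> carrier M \<Longrightarrow>
      (x \<oplus>\<^bsub>M\<^esub> y) \<oplus>\<^bsub>M\<^esub> z = x \<oplus>\<^bsub>M\<^esub> (y \<oplus>\<^bsub>M\<^esub> z)"
    and "\<And>x y. x \<in> carrier M \<Longrightarrow> y \<in> carrier M \<Longrightarrow> x \<oplus>\<^bsub>M\<^esub> y = y \<oplus>\<^bsub>M\<^esub> x"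
    and "\<And>x. x \<in> carrier M \<Longrightarrow> \<zero>\<^bsub>M\<^esub> \<oplus>\<^bsub>M\<^esub> x = x"
    and "\<And>x. x \<in> carrier M \<Longrightarrow> \<exists>y\<in>carrier M. y \<oplus>\<^bsub>M\<^esub> x = \<zero>\<^bsub>M\<^esub>"
    and "\<And>a x. a \<in> carrier A \<Longrightarrow> x \<in> carrier M \<Longrightarrow> a \<odot>\<^bsub>M\<^esub> x \<in> carrier M"
    and "\<And>a b x. a \<in> carrier A \<Longrightarrow> b \<in> carrier A \<Longrightarrow> x \<in> carrier M \<Longrightarrow>
      (a \<oplus>\<^bsub>A\<^esub> b) \<odot>\<^bsub>M\<^esub> x = a \<odot>\<^bsub>M\<^esub> x \<oplus>\<^bsub>M\<^esub> b \<odot>\<^bsub>M\<^esub> x"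
    and "\<And>a x y. a \<in> carrier A \<Longrightarrow> x \<in> carrier M \<Longrightarrow> y \<in> carrier M \<Longrightarrow>
      a \<odot>\<^bsub>M\<^esub> (x \<oplus>\<^bsub>M\<^esub> y) = a \<odot>\<^bsub>M\<^esub> x \<oplus>\<^bsub>M\<^esub> a \<odot>\<^bsub>M\<^esub> y"
    and "\<And>a b x. a \<in> carrier A \<Longrightarrow> b \<in> carrier A \<Longrightarrow> x \<in> carrier M \<Longrightarrow>
      (a \<otimes>\<^bsub>A\<^esub> b) \<odot>\<^bsub>M\<^esub> x = a \<odot>\<^bsub>M\<^esub> (b \<odot>\<^bsub>M\<^esub> x)"
    and "\<And>x. x \<in> carrier M \<Longrightarrow> \<one>\<^bsub>A\<^esub> \<odot>\<^bsub>M\<^esub> x = x"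
  shows "left_module A M"
  using assms by (auto intro!: left_module.intro left_module_axioms.intro abelian_groupI)

lemma left_module_ring: "left_module A M \<Longrightarrow> ring A"
  by (simp add: left_module_def)

lemma left_module_abelian: "left_module A M \<Longrightarrow> abelian_group M"
  by (simp add: left_module_def)

lemma left_module_zero: "left_module A M \<Longrightarrow> \<zero>\<^bsub>M\<^esub> \<in> carrier M"
  by (meson left_module_abelian abelian_groupE)

lemma left_module_add:
  "left_module A M \<Longrightarrow> x \<in> carrier M \<Longrightarrow> y \<in> carrier M \<Longrightarrow> x \<oplus>\<^bsub>M\<^esub> y \<in> carrier M"
  by (meson left_module_abelian abelian_groupE)

lemma left_module_minus:
  "left_module A M \<Longrightarrow> x \<in> carrier M \<Longrightarrow> y \<in> carrier M \<Longrightarrow> x \<ominus>\<^bsub>M\<^esub> y \<in> carrier M"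
  by (meson left_module_abelian abelian_group.minus_closed)

lemma left_module_smult:
  "left_module A M \<Longrightarrow> a \<in> carrier A \<Longrightarrow> x \<in> carrier M \<Longrightarrow> a \<odot>\<^bsub>M\<^esub> x \<in> carrier M"
  by (meson left_module.lsmult_closed)

lemmas left_module_closed =
  left_module_zero left_module_add left_module_minus left_module_smult

lemma (in abelian_group) minus_eq_zero_iff:
  assumes "x \<in> carrier G" "y \<in> carrier G"
  shows "x \<ominus> y = \<zero> \<longleftrightarrow> x = y"
  using assms
  by (metis a_minus_def add.inv_closed add.inv_unique minus_minus r_neg add.m_comm)

context left_module
begin

lemma lsmult_l_null: "x \<in> carrier M \<Longrightarrow> \<zero> \<odot>\<^bsub>M\<^esub> x = \<zero>\<^bsub>M\<^esub>"
  by (metis R.zero_closed R.l_zero M.add.r_cancel_one lsmult_closed lsmult_l_distr)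

lemma lsmult_r_null: "a \<in> carrier R \<Longrightarrow> a \<odot>\<^bsub>M\<^esub> \<zero>\<^bsub>M\<^esub> = \<zero>\<^bsub>M\<^esub>"
  by (metis M.zero_closed M.l_zero M.add.r_cancel_one lsmult_closed lsmult_r_distr)

lemma lsmult_minus_one:
  assumes "x \<in> carrier M" shows "(\<ominus> \<one>) \<odot>\<^bsub>M\<^esub> x = \<ominus>\<^bsub>M\<^esub> x"
proof (rule M.minus_equality[symmetric])
  have "(\<ominus> \<one>) \<odot>\<^bsub>M\<^esub> x \<oplus>\<^bsub>M\<^esub> \<one> \<odot>\<^bsub>M\<^esub> x = \<zero> \<odot>\<^bsub>M\<^esub> x"
    using assms by (metis R.add.inv_closed R.l_neg R.one_closed lsmult_l_distr)
  then show "(\<ominus> \<one>) \<odot>\<^bsub>M\<^esub> x \<oplus>\<^bsub>M\<^esub> x = \<zero>\<^bsub>M\<^esub>"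
    using assms by (simp add: lsmult_one lsmult_l_null)
qed (use assms lsmult_closed in auto)

text \<open>The negative of x is the multiple of x by \<open>\<ominus> \<one>\<close>, so closure
  under negation follows from closure under scalars and can be left out of the criterion.\<close>

lemma submodule_iff:
  "submodule N R M \<longleftrightarrow> N \<subseteq> carrier M \<and> \<zero>\<^bsub>M\<^esub> \<in> N \<and>
     (\<forall>x\<in>N. \<forall>y\<in>N. x \<oplus>\<^bsub>M\<^esub> y \<in> N) \<and> (\<forall>a\<in>carrier R. \<forall>x\<in>N. a \<odot>\<^bsub>M\<^esub> x \<in> N)"
proof
  assume "submodule N R M"
  then show "N \<subseteq> carrier M \<and> \<zero>\<^bsub>M\<^esub> \<in> N \<and>
     (\<forall>x\<in>N. \<forall>y\<in>N. x \<oplus>\<^bsub>M\<^esub> y \<in> N) \<and> (\<forall>a\<in>carrier R. \<forall>x\<in>N. a \<odot>\<^bsub>M\<^esub> x \<in> N)"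
    unfolding submodule_def submodule_axioms_def subgroup_def by simp
next
  assume N: "N \<subseteq> carrier M \<and> \<zero>\<^bsub>M\<^esub> \<in> N \<and>
     (\<forall>x\<in>N. \<forall>y\<in>N. x \<oplus>\<^bsub>M\<^esub> y \<in> N) \<and> (\<forall>a\<in>carrier R. \<forall>x\<in>N. a \<odot>\<^bsub>M\<^esub> x \<in> N)"
  then have "\<ominus>\<^bsub>M\<^esub> x \<in> N" if "x \<in> N" for x
    using that lsmult_minus_one[of x] by (metis R.add.inv_closed R.one_closed subsetD)
  then show "submodule N R M"
    using N unfolding submodule_def submodule_axioms_def subgroup_def
    by (auto simp flip: a_inv_def)
qed

lemma submodule_carrier: "submodule (carrier M) R M"
  by (auto simp: submodule_iff lsmult_closed)

lemma submodule_zero: "submodule {\<zero>\<^bsub>M\<^esub>} R M"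
  by (auto simp: submodule_iff lsmult_r_null)

lemma submodule_inter: "submodule N R M \<Longrightarrow> submodule N' R M \<Longrightarrow> submodule (N \<inter> N') R M"
  by (auto simp: submodule_iff)

lemma submodule_minus:
  assumes "submodule N R M" "x \<in> N" "y \<in> N"
  shows "x \<ominus>\<^bsub>M\<^esub> y \<in> N"
proof -
  have "(\<ominus> \<one>) \<odot>\<^bsub>M\<^esub> y \<in> N" and "y \<in> carrier M"
    using assms by (auto simp: submodule_iff)
  then have "\<ominus>\<^bsub>M\<^esub> y \<in> N" by (simp add: lsmult_minus_one)
  then show ?thesis
    using assms by (auto simp: submodule_iff a_minus_def)
qed

end

lemma submodule_subset: "submodule N A M \<Longrightarrow> N \<subseteq> carrier M"
  by (simp add: submodule_def subgroup_def)

lemma left_module_submodule: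
  assumes "left_module A M" and "submodule N A M"
  shows "left_module A (M\<lparr>carrier := N\<rparr>)"
proof -
  interpret M: left_module A M by fact
  have N: "N \<subseteq> carrier M" "\<zero>\<^bsub>M\<^esub> \<in> N" "\<And>x y. x \<in> N \<Longrightarrow> y \<in> N \<Longrightarrow> x \<oplus>\<^bsub>M\<^esub> y \<in> N"
    "\<And>a x. a \<in> carrier A \<Longrightarrow> x \<in> N \<Longrightarrow> a \<odot>\<^bsub>M\<^esub> x \<in> N"
    using assms(2) by (auto simp: M.submodule_iff)
  have "\<exists>y\<in>N. y \<oplus>\<^bsub>M\<^esub> x = \<zero>\<^bsub>M\<^esub>" if "x \<in> N" for x
    using that N M.lsmult_minus_one[of x]
    by (metis M.R.add.inv_closed M.R.one_closed M.M.l_neg subsetD)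
  then show ?thesis
    using N
    by (intro left_moduleI)
       (auto simp: subset_iff M.M.a_assoc M.lsmult_l_distr M.lsmult_r_distr M.lsmult_assoc
         M.lsmult_one left_module_ring[OF assms(1)] intro: M.M.a_comm)
qed

lemma submodule_of_submodule:
  assumes "left_module A M" and "submodule N A M"
  shows "submodule N' A (M\<lparr>carrier := N\<rparr>) \<longleftrightarrow> submodule N' A M \<and> N' \<subseteq> N"
  using assms(2)
  by (auto simp: left_module.submodule_iff[OF assms(1)]
     left_module.submodule_iff[OF left_module_submodule[OF assms]])


text \<open>Linearity without the extensionality that \<open>lmod_hom\<close> demands: composites,
  sums and lambda terms are then linear maps as they stand, and \<open>restrict\<close> appears only
  where a definition asks for an element of \<open>lmod_hom\<close>.\<close>

definition lin_map ::
  "('a, 'c) ring_scheme \<Rightarrow> ('a, 'm) module \<Rightarrow> ('a, 'n) module \<Rightarrow> ('m \<Rightarrow> 'n) \<Rightarrow> bool" where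
  "lin_map A M N f \<longleftrightarrow> f \<in> carrier M \<rightarrow> carrier N \<and>
     (\<forall>x\<in>carrier M. \<forall>y\<in>carrier M. f (x \<oplus>\<^bsub>M\<^esub> y) = f x \<oplus>\<^bsub>N\<^esub> f y) \<and>
     (\<forall>a\<in>carrier A. \<forall>x\<in>carrier M. f (a \<odot>\<^bsub>M\<^esub> x) = a \<odot>\<^bsub>N\<^esub> f x)"

lemma lin_mapI:
  assumes "\<And>x. x \<in> carrier M \<Longrightarrow> f x \<in> carrier N"
    and "\<And>x y. x \<in> carrier M \<Longrightarrow> y \<in> carrier M \<Longrightarrow> f (x \<oplus>\<^bsub>M\<^esub> y) = f x \<oplus>\<^bsub>N\<^esub> f y"
    and "\<And>a x. a \<in> carrier A \<Longrightarrow> x \<in> carrier M \<Longrightarrow> f (a \<odot>\<^bsub>M\<^esub> x) = a \<odot>\<^bsub>N\<^esub> f x"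
  shows "lin_map A M N f"
  using assms by (auto simp: lin_map_def)

lemma lin_map_closed: "lin_map A M N f \<Longrightarrow> x \<in> carrier M \<Longrightarrow> f x \<in> carrier N"
  by (auto simp: lin_map_def)

lemma lin_map_add:
  "lin_map A M N f \<Longrightarrow> x \<in> carrier M \<Longrightarrow> y \<in> carrier M \<Longrightarrow> f (x \<oplus>\<^bsub>M\<^esub> y) = f x \<oplus>\<^bsub>N\<^esub> f y"
  by (auto simp: lin_map_def)

lemma lin_map_smult:
  "lin_map A M N f \<Longrightarrow> a \<in> carrier A \<Longrightarrow> x \<in> carrier M \<Longrightarrow> f (a \<odot>\<^bsub>M\<^esub> x) = a \<odot>\<^bsub>N\<^esub> f x"
  by (auto simp: lin_map_def)

lemma lmod_hom_iff: "f \<in> lmod_hom A M N \<longleftrightarrow> lin_map A M N f \<and> f \<in> extensional (carrier M)"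
  by (auto simp: lmod_hom_def lin_map_def PiE_def)

lemma lmod_hom_lin: "f \<in> lmod_hom A M N \<Longrightarrow> lin_map A M N f"
  by (simp add: lmod_hom_iff)

lemma lin_map_cong:
  assumes "left_module A M" "\<And>x. x \<in> carrier M \<Longrightarrow> f x = g x"
  shows "lin_map A M N f \<longleftrightarrow> lin_map A M N g"
  using assms left_module_closed[OF assms(1)] by (auto simp: lin_map_def Pi_def)

lemma lin_map_congI:
  "left_module A M \<Longrightarrow> lin_map A M N f \<Longrightarrow> (\<And>x. x \<in> carrier M \<Longrightarrow> f x = g x) \<Longrightarrow> lin_map A M N g"
  using lin_map_cong by blast

lemma restrict_lmod_hom:
  assumes "left_module A M" "lin_map A M N f"
  shows "restrict f (carrier M) \<in> lmod_hom A M N"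
  using assms lin_map_cong[of A M f "restrict f (carrier M)" N] by (simp add: lmod_hom_iff)

lemma lmod_hom_eqI:
  assumes "f \<in> lmod_hom A M N" "g \<in> lmod_hom A M N" "\<And>x. x \<in> carrier M \<Longrightarrow> f x = g x"
  shows "f = g"
  using assms by (meson extensionalityI lmod_hom_iff)

lemma lin_map_zero:
  assumes "left_module A M" "left_module A N" "lin_map A M N f"
  shows "f \<zero>\<^bsub>M\<^esub> = \<zero>\<^bsub>N\<^esub>"
proof -
  interpret M: left_module A M by fact
  interpret N: left_module A N by fact
  show ?thesis
    using assms(3) lin_map_closed[OF assms(3) M.M.zero_closed]
    by (metis M.R.zero_closed M.M.zero_closed M.lsmult_l_null N.lsmult_l_null lin_map_smult)
qed

lemma lin_map_minus:
  assumes "left_module A M" "left_module A N" "lin_map A M N f" "x \<in> carrier M" "y \<in> carrier M"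
  shows "f (x \<ominus>\<^bsub>M\<^esub> y) = f x \<ominus>\<^bsub>N\<^esub> f y"
proof -
  interpret M: left_module A M by fact
  interpret N: left_module A N by fact
  have "f (\<ominus>\<^bsub>M\<^esub> y) = \<ominus>\<^bsub>N\<^esub> f y"
    using lin_map_smult[OF assms(3), of "\<ominus>\<^bsub>A\<^esub> \<one>\<^bsub>A\<^esub>" y] assms(5) lin_map_closed[OF assms(3,5)]
    by (simp add: M.lsmult_minus_one N.lsmult_minus_one)
  then show ?thesis
    unfolding a_minus_def using assms lin_map_add[OF assms(3)] by simp
qed

lemma lin_map_comp:
  assumes "lin_map A M N f" "lin_map A N L g"
  shows "lin_map A M L (\<lambda>x. g (f x))"
  using assms by (auto simp: lin_map_def Pi_def)

lemma lin_map_id: "lin_map A M M (\<lambda>x. x)"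
  by (auto simp: lin_map_def)

lemma lin_map_const_zero:
  assumes "left_module A N"
  shows "lin_map A M N (\<lambda>x. \<zero>\<^bsub>N\<^esub>)"
proof -
  interpret N: left_module A N by fact
  show ?thesis by (auto simp: lin_map_def N.lsmult_r_null)
qed

lemma lin_map_sum:
  assumes "left_module A M" "left_module A N" "lin_map A M N f" "lin_map A M N g"
  shows "lin_map A M N (\<lambda>x. f x \<oplus>\<^bsub>N\<^esub> g x)"
proof -
  interpret M: left_module A M by fact
  interpret N: left_module A N by fact
  show ?thesis
    using lin_map_closed[OF assms(3)] lin_map_closed[OF assms(4)]
    by (intro lin_mapI)
       (auto simp: N.lsmult_r_distr lin_map_add[OF assms(3)] lin_map_add[OF assms(4)]
         lin_map_smult[OF assms(3)] lin_map_smult[OF assms(4)] N.M.a_ac)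
qed

lemma lin_map_diff:
  assumes "left_module A M" "left_module A N" "lin_map A M N f" "lin_map A M N g"
  shows "lin_map A M N (\<lambda>x. f x \<ominus>\<^bsub>N\<^esub> g x)"
proof -
  interpret M: left_module A M by fact
  interpret N: left_module A N by fact
  have "lin_map A N N (\<lambda>y. \<ominus>\<^bsub>N\<^esub> y)"
    by (intro lin_mapI)
       (auto simp: N.lsmult_r_distr N.lsmult_minus_one[symmetric] N.lsmult_closed
          N.lsmult_assoc[symmetric] M.R.l_minus M.R.r_minus N.M.a_comm)
  from lin_map_sum[OF assms(1-3) lin_map_comp[OF assms(4) this]]
  show ?thesis by (simp add: a_minus_def)
qed

lemma lin_map_subcodomain:
  "lin_map A M N f \<Longrightarrow> (\<And>x. x \<in> carrier M \<Longrightarrow> f x \<in> K) \<Longrightarrow> lin_map A M (N\<lparr>carrier := K\<rparr>) f"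
  by (auto simp: lin_map_def)

lemma lin_map_subdomain:
  "lin_map A M N f \<Longrightarrow> K \<subseteq> carrier M \<Longrightarrow> lin_map A (M\<lparr>carrier := K\<rparr>) N f"
  by (auto simp: lin_map_def subset_iff Pi_def)

lemma lin_map_from_submodule:
  "lin_map A M (N\<lparr>carrier := K\<rparr>) f \<Longrightarrow> K \<subseteq> carrier N \<Longrightarrow> lin_map A M N f"
  by (auto simp: lin_map_def subset_iff Pi_def)

lemma submodule_image:
  assumes "left_module A M" "left_module A N" "lin_map A M N f" "submodule U A M"
  shows "submodule (f ` U) A N"
proof -
  interpret M: left_module A M by fact
  interpret N: left_module A N by fact
  have U: "U \<subseteq> carrier M" "\<zero>\<^bsub>M\<^esub> \<in> U" "\<And>x y. x \<in> U \<Longrightarrow> y \<in> U \<Longrightarrow> x \<oplus>\<^bsub>M\<^esub> y \<in> U"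
    "\<And>a x. a \<in> carrier A \<Longrightarrow> x \<in> U \<Longrightarrow> a \<odot>\<^bsub>M\<^esub> x \<in> U"
    using assms(4) by (auto simp: M.submodule_iff)
  show ?thesis
    unfolding N.submodule_iff
  proof (intro conjI ballI)
    show "f ` U \<subseteq> carrier N" using U lin_map_closed[OF assms(3)] by auto
    show "\<zero>\<^bsub>N\<^esub> \<in> f ` U" using U(2) lin_map_zero[OF assms(1-3)] by force
    show "x \<oplus>\<^bsub>N\<^esub> y \<in> f ` U" if "x \<in> f ` U" "y \<in> f ` U" for x y
      using that U(1,3) lin_map_add[OF assms(3)] by (auto simp: image_iff) (metis subsetD)
    show "a \<odot>\<^bsub>N\<^esub> x \<in> f ` U" if "a \<in> carrier A" "x \<in> f ` U" for a x
      using that U(1,4) lin_map_smult[OF assms(3)] by (auto simp: image_iff) (metis subsetD)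
  qed
qed

lemma submodule_vimage:
  assumes "left_module A M" "left_module A N" "lin_map A M N f" "submodule V A N"
  shows "submodule {x \<in> carrier M. f x \<in> V} A M"
proof -
  interpret M: left_module A M by fact
  interpret N: left_module A N by fact
  show ?thesis
    using assms(4) lin_map_zero[OF assms(1-3)]
    by (auto simp: M.submodule_iff N.submodule_iff M.lsmult_closed
       lin_map_add[OF assms(3)] lin_map_smult[OF assms(3)])
qed

lemma submodule_kernel:
  assumes "left_module A M" "left_module A N" "lin_map A M N f"
  shows "submodule (a_kernel M N f) A M"
  using submodule_vimage[OF assms left_module.submodule_zero[OF assms(2)]]
  by (simp add: a_kernel_def')


section \<open>The regular module and the opposite ring\<close>

lemma left_module_regular:
  assumes "ring A" shows "left_module A (regular A)"
proof -
  interpret ring A by fact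
  have "\<exists>y\<in>carrier A. y \<oplus>\<^bsub>A\<^esub> x = \<zero>\<^bsub>A\<^esub>" if "x \<in> carrier A" for x
    using that l_neg by blast
  then show ?thesis
    by (intro left_moduleI) (simp_all add: regular_def a_ac l_distr r_distr m_assoc assms)
qed

lemma ring_opposite:
  assumes "ring A" shows "ring (opposite A)"
proof -
  interpret ring A by fact
  have "\<exists>y\<in>carrier A. y \<oplus>\<^bsub>A\<^esub> x = \<zero>\<^bsub>A\<^esub>" if "x \<in> carrier A" for x
    using that l_neg by blast
  then show ?thesis
    by (intro ringI abelian_groupI monoidI)
       (simp_all add: opposite_def a_ac l_distr r_distr m_assoc)
qed

lemma opposite_opposite [simp]: "opposite (opposite A) = A"
  by (simp add: opposite_def)

lemma opposite_simps [simp]: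
  "carrier (opposite A) = carrier A" "\<zero>\<^bsub>opposite A\<^esub> = \<zero>\<^bsub>A\<^esub>" "\<one>\<^bsub>opposite A\<^esub> = \<one>\<^bsub>A\<^esub>"
  "x \<oplus>\<^bsub>opposite A\<^esub> y = x \<oplus>\<^bsub>A\<^esub> y" "x \<otimes>\<^bsub>opposite A\<^esub> y = y \<otimes>\<^bsub>A\<^esub> x"
  by (simp_all add: opposite_def)

lemma regular_simps [simp]:
  "carrier (regular A) = carrier A" "\<zero>\<^bsub>regular A\<^esub> = \<zero>\<^bsub>A\<^esub>"
  "x \<oplus>\<^bsub>regular A\<^esub> y = x \<oplus>\<^bsub>A\<^esub> y" "a \<odot>\<^bsub>regular A\<^esub> y = a \<otimes>\<^bsub>A\<^esub> y"
  by (simp_all add: regular_def)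


text \<open>Transport of structure along an injection. \<open>projective\<close> and
  \<open>injective\<close> quantify over modules in \<open>'a univ\<close>, and
  \<open>syzygy\<close> uses a sum type; copies carry modules of other types there.\<close>

lemma copy_module:
  assumes "left_module A M" "inj_on h (carrier M)"
  shows left_module_copy: "left_module A (copy_module h M)"
    and lin_map_copy: "lin_map A M (copy_module h M) h"
    and lin_map_copy_inv: "lin_map A (copy_module h M) M (inv_into (carrier M) h)"
    and carrier_copy: "carrier (copy_module h M) = h ` carrier M"
proof -
  interpret M: left_module A M by fact
  show "carrier (copy_module h M) = h ` carrier M"
    by (simp add: copy_module_def)
  have "\<exists>y\<in>carrier M. h (y \<oplus>\<^bsub>M\<^esub> x) = h \<zero>\<^bsub>M\<^esub>" if "x \<in> carrier M" for x
    using that by (metis M.M.l_neg M.M.a_inv_closed)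
  then show "left_module A (copy_module h M)"
    using assms(2)
    by (intro left_moduleI)
       (auto simp: copy_module_def M.M.a_ac M.lsmult_closed M.lsmult_l_distr M.lsmult_r_distr
         M.lsmult_assoc M.lsmult_one left_module_ring[OF assms(1)])
  show "lin_map A M (copy_module h M) h"
    using assms(2) by (intro lin_mapI) (auto simp: copy_module_def M.lsmult_closed)
  show "lin_map A (copy_module h M) M (inv_into (carrier M) h)"
    using assms(2) by (intro lin_mapI) (auto simp: copy_module_def M.lsmult_closed)
qed

section \<open>Dual bases\<close>

lemma lin_map_finsum:
  assumes "left_module A M" "left_module A N" "lin_map A M N f"
    and "finite S" "g \<in> S \<rightarrow> carrier M"
  shows "f (finsum M g S) = finsum N (\<lambda>k. f (g k)) S"
proof -
  interpret M: left_module A M by fact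
  interpret N: left_module A N by fact
  show ?thesis
    using assms(4,5)
  proof (induction S rule: finite_induct)
    case empty
    then show ?case by (simp add: lin_map_zero[OF assms(1-3)])
  next
    case (insert k S)
    then have "g \<in> S \<rightarrow> carrier M" "g k \<in> carrier M"
      by auto
    then show ?case
      using insert
      by (simp add: lin_map_add[OF assms(3)] lin_map_closed[OF assms(3)] Pi_def)
  qed
qed

lemma submodule_finsum:
  assumes "left_module A M" "submodule N A M" "finite S" "g \<in> S \<rightarrow> N"
  shows "finsum M g S \<in> N"
proof -
  interpret M: left_module A M by fact
  have N: "N \<subseteq> carrier M" "\<zero>\<^bsub>M\<^esub> \<in> N" "\<And>x y. x \<in> N \<Longrightarrow> y \<in> N \<Longrightarrow> x \<oplus>\<^bsub>M\<^esub> y \<in> N"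
    using assms(2) by (auto simp: M.submodule_iff)
  show ?thesis
    using assms(3,4)
  proof (induction S rule: finite_induct)
    case (insert k S)
    then have "g \<in> S \<rightarrow> carrier M" "g k \<in> carrier M"
      using N(1) by auto
    then show ?case using insert N by (simp add: Pi_def)
  qed (use N in simp)
qed

lemma lin_map_finsum_pointwise:
  assumes "left_module A M" "left_module A N" "finite S" "\<And>k. k \<in> S \<Longrightarrow> lin_map A M N (f k)"
  shows "lin_map A M N (\<lambda>x. finsum N (\<lambda>k. f k x) S)"
proof -
  interpret M: left_module A M by fact
  interpret N: left_module A N by fact
  show ?thesis
    using assms(3,4)
  proof (induction S rule: finite_induct)
    case empty
    then show ?case by (simp add: lin_map_const_zero[OF assms(2)])
  next
    case (insert k S)
    have "lin_map A M N (\<lambda>x. f k x \<oplus>\<^bsub>N\<^esub> finsum N (\<lambda>k. f k x) S)"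
      using insert by (intro lin_map_sum[OF assms(1,2)]) auto
    moreover have "f k x \<oplus>\<^bsub>N\<^esub> finsum N (\<lambda>k. f k x) S = finsum N (\<lambda>k. f k x) (insert k S)"
      if "x \<in> carrier M" for x
      using insert that lin_map_closed by (subst N.M.finsum_insert) fastforce+
    ultimately show ?case
      by (rule lin_map_congI[OF assms(1)])
  qed
qed

lemma lin_map_smult_const:
  assumes "left_module A N" "lin_map A M (regular A) q" "y \<in> carrier N"
  shows "lin_map A M N (\<lambda>x. q x \<odot>\<^bsub>N\<^esub> y)"
proof -
  interpret N: left_module A N by fact
  show ?thesis
    using assms(3) lin_map_closed[OF assms(2)] lin_map_add[OF assms(2)] lin_map_smult[OF assms(2)]
    by (intro lin_mapI) (auto simp: N.lsmult_closed N.lsmult_l_distr N.lsmult_assoc)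
qed

text \<open>The shape of the maps built from dual bases: functionals supply the coefficients, chosen
  elements of \<open>N\<close> the vectors.\<close>

lemma lin_map_comb:
  assumes "left_module A M" "left_module A N"
    and "\<And>k. k < n \<Longrightarrow> lin_map A M (regular A) (q k)" "\<And>k. k < n \<Longrightarrow> y k \<in> carrier N"
  shows "lin_map A M N (\<lambda>x. \<Oplus>\<^bsub>N\<^esub>k\<in>{..<n::nat}. q k x \<odot>\<^bsub>N\<^esub> y k)"
  using assms by (intro lin_map_finsum_pointwise lin_map_smult_const) auto


text \<open>The dual basis criterion for finitely generated projectives; the \<open>b k\<close> need
  not be independent. Unlike \<open>projective\<close>, which tests only modules in
  \<open>'a univ\<close>, it gives lifts against modules of every element type.\<close>

definition dual_basis ::
  "('a, 'c) ring_scheme \<Rightarrow> ('a, 'p) module \<Rightarrow> nat \<Rightarrow> (nat \<Rightarrow> 'p) \<Rightarrow> (nat \<Rightarrow> 'p \<Rightarrow> 'a) \<Rightarrow> bool" where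
  "dual_basis A P n b c \<longleftrightarrow> left_module A P \<and>
     (\<forall>k<n. b k \<in> carrier P \<and> lin_map A P (regular A) (c k)) \<and>
     (\<forall>x\<in>carrier P. (\<Oplus>\<^bsub>P\<^esub>k\<in>{..<n}. c k x \<odot>\<^bsub>P\<^esub> b k) = x)"

lemma dual_basisD:
  assumes "dual_basis A P n b c"
  shows "left_module A P" "k < n \<Longrightarrow> b k \<in> carrier P" "k < n \<Longrightarrow> lin_map A P (regular A) (c k)"
    "k < n \<Longrightarrow> x \<in> carrier P \<Longrightarrow> c k x \<in> carrier A"
    "x \<in> carrier P \<Longrightarrow> (\<Oplus>\<^bsub>P\<^esub>k\<in>{..<n}. c k x \<odot>\<^bsub>P\<^esub> b k) = x"
  using assms lin_map_closed[of A P "regular A" "c k" x] by (auto simp: dual_basis_def)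

lemma dual_basis_lin_map:
  assumes "dual_basis A P n b c" "left_module A Y" "lin_map A P Y f" "x \<in> carrier P"
  shows "f x = (\<Oplus>\<^bsub>Y\<^esub>k\<in>{..<n}. c k x \<odot>\<^bsub>Y\<^esub> f (b k))"
proof -
  note db = dual_basisD[OF assms(1)]
  interpret P: left_module A P by (rule db)
  interpret Y: left_module A Y by fact
  have "f x = f (\<Oplus>\<^bsub>P\<^esub>k\<in>{..<n}. c k x \<odot>\<^bsub>P\<^esub> b k)"
    by (simp only: db(5)[OF assms(4)])
  also have "\<dots> = (\<Oplus>\<^bsub>Y\<^esub>k\<in>{..<n}. f (c k x \<odot>\<^bsub>P\<^esub> b k))"
    using db assms by (intro lin_map_finsum) (auto intro: P.lsmult_closed)
  also have "\<dots> = (\<Oplus>\<^bsub>Y\<^esub>k\<in>{..<n}. c k x \<odot>\<^bsub>Y\<^esub> f (b k))"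
    using db assms lin_map_smult[OF assms(3)] lin_map_closed[OF assms(3)]
    by (intro Y.M.finsum_cong') (auto intro!: Y.lsmult_closed)
  finally show ?thesis .
qed

text \<open>The lift is x \<mapsto> sum of c_k(x) y_k with y_k a preimage of f(b_k). Since
  \<open>f\<close> only has to take values in the image of \<open>g\<close>, the lemma applies
  directly to inclusions of kernels and to differentials.\<close>

lemma dual_basis_lift:
  assumes "dual_basis A P n b c" "left_module A X" "left_module A Y"
    and "lin_map A X Y g" "lin_map A P Y f" "\<And>x. x \<in> carrier P \<Longrightarrow> f x \<in> g ` carrier X"
  obtains h where "lin_map A P X h" "\<And>x. x \<in> carrier P \<Longrightarrow> g (h x) = f x"
proof -
  note db = dual_basisD[OF assms(1)]
  interpret X: left_module A X by fact
  interpret Y: left_module A Y by fact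
  have "\<exists>y. y \<in> carrier X \<and> g y = f (b k)" if "k < n" for k
    using assms(6)[OF db(2)[OF that]] by auto
  then have "\<exists>y. \<forall>k<n. y k \<in> carrier X \<and> g (y k) = f (b k)"
    by (intro choice) blast
  then obtain y where y: "\<And>k. k < n \<Longrightarrow> y k \<in> carrier X" "\<And>k. k < n \<Longrightarrow> g (y k) = f (b k)"
    by blast
  define h where "h = (\<lambda>x. \<Oplus>\<^bsub>X\<^esub>k\<in>{..<n}. c k x \<odot>\<^bsub>X\<^esub> y k)"
  have "lin_map A P X h"
    unfolding h_def using db y assms by (intro lin_map_comb) auto
  moreover have "g (h x) = f x" if x: "x \<in> carrier P" for x
  proof -
    have "g (h x) = (\<Oplus>\<^bsub>Y\<^esub>k\<in>{..<n}. g (c k x \<odot>\<^bsub>X\<^esub> y k))"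
      unfolding h_def using db y assms x by (intro lin_map_finsum) (auto intro: X.lsmult_closed)
    also have "\<dots> = (\<Oplus>\<^bsub>Y\<^esub>k\<in>{..<n}. c k x \<odot>\<^bsub>Y\<^esub> f (b k))"
      using db y x lin_map_smult[OF assms(4)] lin_map_closed[OF assms(5)]
      by (intro Y.M.finsum_cong') (auto intro!: Y.lsmult_closed)
    also have "\<dots> = f x"
      by (rule dual_basis_lin_map[OF assms(1,3,5) x, symmetric])
    finally show ?thesis .
  qed
  ultimately show thesis using that by blast
qed

lemma dual_basis_projective:
  assumes "dual_basis A P n b c" shows "projective A P"
  unfolding projective_def
proof (intro conjI allI impI, goal_cases)
  case 1 then show ?case by (rule dual_basisD[OF assms])
next
  case (2 X Y g f)
  then have X: "left_module A X" and Y: "left_module A Y"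
    and g: "lin_map A X Y g" and f: "lin_map A P Y f"
    and gf: "\<And>x. x \<in> carrier P \<Longrightarrow> f x \<in> g ` carrier X"
    by (auto simp: lmod_hom_iff lin_map_closed)
  obtain h where h: "lin_map A P X h" "\<And>x. x \<in> carrier P \<Longrightarrow> g (h x) = f x"
    using dual_basis_lift[OF assms X Y g f gf] by blast
  then show ?case
    using restrict_lmod_hom[OF dual_basisD(1)[OF assms]]
    by (intro bexI[of _ "restrict h (carrier P)"]) auto
qed

lemma dual_basis_fin_gen:
  assumes "dual_basis A P n b c" shows "fin_gen A P"
  unfolding fin_gen_def
proof (intro exI[of _ "b ` {..<n}"] conjI allI impI)
  note db = dual_basisD[OF assms]
  show "finite (b ` {..<n})" "b ` {..<n} \<subseteq> carrier P"
    using db by auto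
  fix N assume N: "submodule N A P \<and> b ` {..<n} \<subseteq> N"
  have "x \<in> N" if "x \<in> carrier P" for x
  proof -
    have "(\<Oplus>\<^bsub>P\<^esub>k\<in>{..<n}. c k x \<odot>\<^bsub>P\<^esub> b k) \<in> N"
      using N db that left_module.submodule_iff[OF db(1)]
      by (intro submodule_finsum[OF db(1)]) auto
    then show ?thesis using db that by simp
  qed
  then show "N = carrier P" using N submodule_subset[of N A P] by blast
qed

text \<open>Push the vectors forward along \<pi> and pull the coordinates back along \<sigma>. This
  covers direct summands of free modules as well as isomorphic copies.\<close>

lemma dual_basis_retract:
  assumes "dual_basis A F n b c" "left_module A P" "lin_map A F P \<pi>" "lin_map A P F \<sigma>"
    and "\<And>x. x \<in> carrier P \<Longrightarrow> \<pi> (\<sigma> x) = x"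
  shows "dual_basis A P n (\<lambda>k. \<pi> (b k)) (\<lambda>k x. c k (\<sigma> x))"
proof -
  note db = dual_basisD[OF assms(1)]
  have "(\<Oplus>\<^bsub>P\<^esub>k\<in>{..<n}. c k (\<sigma> x) \<odot>\<^bsub>P\<^esub> \<pi> (b k)) = x" if "x \<in> carrier P" for x
    using dual_basis_lin_map[OF assms(1,2,3) lin_map_closed[OF assms(4) that]] assms(5)[OF that]
    by simp
  then show ?thesis
    unfolding dual_basis_def
    by (intro conjI allI impI ballI assms(2) lin_map_closed[OF assms(3)] db(2)
        lin_map_comp[OF assms(4) db(3)])
qed


text \<open>The element type \<open>nat \<Rightarrow> 'a\<close> matches \<open>'a univ\<close>: the
  singletons \<open>{v}\<close> form a copy of the free module there.\<close>

definition free_module :: "('a, 'c) ring_scheme \<Rightarrow> nat \<Rightarrow> ('a, nat \<Rightarrow> 'a) module" where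
  "free_module A n = \<lparr>carrier = {..<n} \<rightarrow>\<^sub>E carrier A, monoid.mult = undefined, one = undefined,
     ring.zero = (\<lambda>k\<in>{..<n}. \<zero>\<^bsub>A\<^esub>), ring.add = (\<lambda>v w. \<lambda>k\<in>{..<n}. v k \<oplus>\<^bsub>A\<^esub> w k),
     smult = (\<lambda>a v. \<lambda>k\<in>{..<n}. a \<otimes>\<^bsub>A\<^esub> v k)\<rparr>"

definition unit_vector :: "('a, 'c) ring_scheme \<Rightarrow> nat \<Rightarrow> nat \<Rightarrow> nat \<Rightarrow> 'a" where
  "unit_vector A n j = (\<lambda>k\<in>{..<n}. if k = j then \<one>\<^bsub>A\<^esub> else \<zero>\<^bsub>A\<^esub>)"

lemma left_module_free:
  assumes "ring A" shows "left_module A (free_module A n)"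
proof -
  interpret ring A by fact
  let ?F = "free_module A n"
  have mem: "v \<in> carrier ?F \<longleftrightarrow> (\<forall>k<n. v k \<in> carrier A) \<and> v \<in> extensional {..<n}" for v
    by (auto simp: free_module_def PiE_def Pi_def)
  have eqI: "v = w" if "v \<in> carrier ?F" "w \<in> carrier ?F" "\<And>k. k < n \<Longrightarrow> v k = w k" for v w
    using that by (auto simp: mem intro: extensionalityI)
  have add: "v \<oplus>\<^bsub>?F\<^esub> w = (\<lambda>k\<in>{..<n}. v k \<oplus>\<^bsub>A\<^esub> w k)"
    and zero: "\<zero>\<^bsub>?F\<^esub> = (\<lambda>k\<in>{..<n}. \<zero>\<^bsub>A\<^esub>)"
    and smult: "a \<odot>\<^bsub>?F\<^esub> v = (\<lambda>k\<in>{..<n}. a \<otimes>\<^bsub>A\<^esub> v k)" for v w a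
    by (simp_all add: free_module_def)
  have addc: "v \<oplus>\<^bsub>?F\<^esub> w \<in> carrier ?F" if "v \<in> carrier ?F" "w \<in> carrier ?F" for v w
    using that by (simp add: mem add)
  have zeroc: "\<zero>\<^bsub>?F\<^esub> \<in> carrier ?F"
    by (simp add: mem zero)
  have smultc: "a \<odot>\<^bsub>?F\<^esub> v \<in> carrier ?F" if "a \<in> carrier A" "v \<in> carrier ?F" for a v
    using that by (simp add: mem smult)
  have "\<exists>w\<in>carrier ?F. w \<oplus>\<^bsub>?F\<^esub> v = \<zero>\<^bsub>?F\<^esub>" if v: "v \<in> carrier ?F" for v
  proof
    show w: "(\<lambda>k\<in>{..<n}. \<ominus>\<^bsub>A\<^esub> v k) \<in> carrier ?F"
      using v by (simp add: mem)
    show "(\<lambda>k\<in>{..<n}. \<ominus>\<^bsub>A\<^esub> v k) \<oplus>\<^bsub>?F\<^esub> v = \<zero>\<^bsub>?F\<^esub>"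
      using v by (intro eqI addc w zeroc) (simp_all add: add zero mem l_neg)
  qed
  note inv = this
  have "v k \<in> carrier A" if "v \<in> carrier ?F" "k < n" for v k
    using that by (simp add: mem)
  note simps = add zero smult this a_assoc l_distr r_distr m_assoc
  show ?thesis
  proof (rule left_moduleI, goal_cases)
    case 1 show ?case by fact
  next
    case (2 x y) then show ?case by (rule addc)
  next
    case 3 show ?case by (rule zeroc)
  next
    case (4 x y z) then show ?case by (intro eqI addc) (simp_all add: simps)
  next
    case (5 x y) then show ?case by (intro eqI addc) (simp_all add: simps a_comm)
  next
    case (6 x) then show ?case by (intro eqI addc zeroc) (simp_all add: simps)
  next
    case (7 x) then show ?case by (rule inv)
  next
    case (8 a x) then show ?case by (rule smultc)
  next
    case (9 a b x) then show ?case by (intro eqI addc smultc a_closed) (simp_all add: simps)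
  next
    case (10 a x y) then show ?case by (intro eqI addc smultc) (simp_all add: simps)
  next
    case (11 a b x) then show ?case by (intro eqI smultc m_closed) (simp_all add: simps)
  next
    case (12 x) then show ?case by (intro eqI smultc one_closed) (simp_all add: simps)
  qed
qed

lemma lin_map_coordinate:
  assumes "ring A" "k < n" shows "lin_map A (free_module A n) (regular A) (\<lambda>v. v k)"
  using assms by (intro lin_mapI) (auto simp: free_module_def PiE_def Pi_def)

lemma dual_basis_free:
  assumes "ring A"
  shows "dual_basis A (free_module A n) n (unit_vector A n) (\<lambda>k v. v k)"
proof -
  interpret ring A by fact
  interpret F: left_module A "free_module A n" by (rule left_module_free) fact
  interpret reg: left_module A "regular A" by (rule left_module_regular) fact
  have e: "unit_vector A n k \<in> carrier (free_module A n)" for k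
    by (auto simp: unit_vector_def free_module_def)
  have "(\<Oplus>\<^bsub>free_module A n\<^esub>k\<in>{..<n}. v k \<odot>\<^bsub>free_module A n\<^esub> unit_vector A n k) = v" (is "?w = v")
    if v: "v \<in> carrier (free_module A n)" for v
  proof (rule PiE_ext)
    have vk: "v k \<in> carrier A" if "k < n" for k
      using v that by (auto simp: free_module_def)
    then have cl: "(\<lambda>k. v k \<odot>\<^bsub>free_module A n\<^esub> unit_vector A n k) \<in> {..<n} \<rightarrow> carrier (free_module A n)"
      using e by (auto intro: F.lsmult_closed)
    show "?w \<in> {..<n} \<rightarrow>\<^sub>E carrier A"
      using F.M.finsum_closed[OF cl] by (simp add: free_module_def)
    show "v \<in> {..<n} \<rightarrow>\<^sub>E carrier A"
      using v by (simp add: free_module_def)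
    fix j assume j: "j \<in> {..<n}"
    have "?w j = (\<Oplus>\<^bsub>regular A\<^esub>k\<in>{..<n}. (v k \<odot>\<^bsub>free_module A n\<^esub> unit_vector A n k) j)"
      using lin_map_finsum[OF F.left_module_axioms reg.left_module_axioms lin_map_coordinate _ cl]
        j assms by simp
    also have "\<dots> = (\<Oplus>\<^bsub>regular A\<^esub>k\<in>{..<n}. if j = k then v k else \<zero>\<^bsub>regular A\<^esub>)"
      using j vk by (intro reg.M.finsum_cong') (auto simp: free_module_def unit_vector_def)
    also have "\<dots> = v j"
      using j vk by (intro reg.M.finsum_singleton) auto
    finally show "?w j = v j" .
  qed
  then show ?thesis
    using e lin_map_coordinate[OF assms] by (auto simp: dual_basis_def F.left_module_axioms)
qed

text \<open>Enumerate the generators and send the unit vectors to them; the image is a submodule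
  containing all generators.\<close>

lemma fin_gen_free_cover:
  assumes "left_module A M" "fin_gen A M"
  obtains n \<pi> where "lin_map A (free_module A n) M \<pi>" "\<pi> ` carrier (free_module A n) = carrier M"
proof -
  interpret M: left_module A M by fact
  have A: "ring A" using assms(1) by (rule left_module_ring)
  obtain S where S: "finite S" "S \<subseteq> carrier M"
      "\<And>N. submodule N A M \<Longrightarrow> S \<subseteq> N \<Longrightarrow> N = carrier M"
    using assms(2) by (auto simp: fin_gen_def)
  obtain n and s :: "nat \<Rightarrow> _" where s: "S = s ` {..<n}"
    using S(1) by (auto simp: finite_conv_nat_seg_image lessThan_def)
  define \<pi> where "\<pi> = (\<lambda>v. \<Oplus>\<^bsub>M\<^esub>k\<in>{..<n}. v k \<odot>\<^bsub>M\<^esub> s k)"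
  have F: "left_module A (free_module A n)" by (rule left_module_free[OF A])
  have \<pi>: "lin_map A (free_module A n) M \<pi>"
    unfolding \<pi>_def using S(2) s by (intro lin_map_comb lin_map_coordinate F assms A) auto
  have "S \<subseteq> \<pi> ` carrier (free_module A n)"
  proof
    fix x assume "x \<in> S"
    then obtain j where j: "j < n" "x = s j" using s by auto
    have sc: "\<And>k. k < n \<Longrightarrow> s k \<in> carrier M" using S(2) s by auto
    have "\<pi> (unit_vector A n j) = (\<Oplus>\<^bsub>M\<^esub>k\<in>{..<n}. if j = k then s k else \<zero>\<^bsub>M\<^esub>)"
      unfolding \<pi>_def using sc
      by (intro M.M.finsum_cong') (auto simp: unit_vector_def M.lsmult_one M.lsmult_l_null)
    also have "\<dots> = s j"
      using j sc by (intro M.M.finsum_singleton) auto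
    finally show "x \<in> \<pi> ` carrier (free_module A n)"
      using j dual_basisD(2)[OF dual_basis_free[OF A], of j n] by force
  qed
  then have "\<pi> ` carrier (free_module A n) = carrier M"
    by (intro S submodule_image[OF F assms(1) \<pi> left_module.submodule_carrier[OF F]])
  then show thesis using that \<pi> by blast
qed

lemma fin_gen_image:
  assumes "left_module A M" "left_module A N" "lin_map A M N f" "f ` carrier M = carrier N"
    and "fin_gen A M"
  shows "fin_gen A N"
proof -
  obtain S where S: "finite S" "S \<subseteq> carrier M"
      "\<And>N. submodule N A M \<Longrightarrow> S \<subseteq> N \<Longrightarrow> N = carrier M"
    using assms(5) by (auto simp: fin_gen_def)
  have "V = carrier N" if V: "submodule V A N" "f ` S \<subseteq> V" for V
  proof -
    have "{x \<in> carrier M. f x \<in> V} = carrier M"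
      using S V by (intro S(3) submodule_vimage[OF assms(1-3)]) auto
    then have "f ` carrier M \<subseteq> V" by auto
    then show ?thesis using assms(4) submodule_subset[OF V(1)] by simp
  qed
  then show ?thesis
    unfolding fin_gen_def using S lin_map_closed[OF assms(3)]
    by (intro exI[of _ "f ` S"]) auto
qed

text \<open>An element is sent to its fibre under a cover by a free module. Fibres are nonempty, so
  different elements have different ones.\<close>

lemma univ_embedding:
  assumes "left_module A M" "fin_gen A M"
  obtains h :: "'m \<Rightarrow> 'a univ" where "inj_on h (carrier (M :: ('a, 'm) module))"
proof -
  obtain n \<pi> where "\<pi> ` carrier (free_module A n) = carrier M"
    using fin_gen_free_cover[OF assms] by metis
  then have "inj_on (\<lambda>x. {v \<in> carrier (free_module A n). \<pi> v = x}) (carrier M)"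
    by (intro inj_onI) (auto simp: set_eq_iff, metis imageE)
  then show thesis using that by blast
qed

text \<open>The cover of \<open>P\<close> by a free module is copied into \<open>'a univ\<close>,
  where projectivity can be applied to it. Lifting the copying map \<open>h\<close>, which stands
  for the identity of \<open>P\<close>, splits the cover, and \<open>P\<close> becomes a retract of
  a free module.\<close>

lemma projective_dual_basis:
  fixes P :: "('a, 'p) module"
  assumes "fin_gen A P" "projective A P"
  obtains n b c where "dual_basis A P n b c"
proof -
  have P: "left_module A P" using assms(2) by (simp add: projective_def)
  have A: "ring A" by (rule left_module_ring[OF P])
  obtain n \<pi> where \<pi>: "lin_map A (free_module A n) P \<pi>" "\<pi> ` carrier (free_module A n) = carrier P"
    using fin_gen_free_cover[OF P assms(1)] by metis
  obtain h :: "'p \<Rightarrow> 'a univ" where h: "inj_on h (carrier P)"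
    using univ_embedding[OF P assms(1)] by blast
  let ?F = "free_module A n"
  let ?s = "\<lambda>v::nat \<Rightarrow> 'a. {v}"
  let ?i = "inv_into (carrier ?F) ?s"
  have F: "left_module A ?F" by (rule left_module_free[OF A])
  have s: "inj_on ?s (carrier ?F)" by simp
  have i: "?i {v} = v" if "v \<in> carrier ?F" for v
    using inv_into_f_f[OF s that] .
  note cF = copy_module[OF F s] and cP = copy_module[OF P h]
  let ?g = "restrict (\<lambda>x. h (\<pi> (?i x))) (carrier (copy_module ?s ?F))"
  have "?g \<in> lmod_hom A (copy_module ?s ?F) (copy_module h P)"
    by (intro restrict_lmod_hom cF lin_map_comp[OF lin_map_comp[OF cF(3) \<pi>(1)] cP(2)])
  moreover have "?g ` carrier (copy_module ?s ?F) = carrier (copy_module h P)"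
    by (simp add: cF(4) cP(4) image_image \<pi>(2)[symmetric] i cong: image_cong_simp)
  moreover have "restrict h (carrier P) \<in> lmod_hom A P (copy_module h P)"
    by (intro restrict_lmod_hom P cP)
  ultimately have "\<exists>k\<in>lmod_hom A P (copy_module ?s ?F). \<forall>x\<in>carrier P.
      ?g (k x) = restrict h (carrier P) x"
    using assms(2)[unfolded projective_def, THEN conjunct2, rule_format,
      of "copy_module ?s ?F" "copy_module h P"] cF(1) cP(1) by blast
  then obtain k where k: "k \<in> lmod_hom A P (copy_module ?s ?F)"
      "\<And>x. x \<in> carrier P \<Longrightarrow> ?g (k x) = restrict h (carrier P) x"
    by blast
  let ?\<sigma> = "\<lambda>x. ?i (k x)"
  have \<sigma>: "lin_map A P ?F ?\<sigma>"
    by (intro lin_map_comp[OF lmod_hom_lin[OF k(1)] cF(3)])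
  have "\<pi> (?\<sigma> x) = x" if x: "x \<in> carrier P" for x
  proof -
    have "h (\<pi> (?\<sigma> x)) = h x"
      using k(2)[OF x] x lin_map_closed[OF lmod_hom_lin[OF k(1)] x] by simp
    then show ?thesis
      using h x lin_map_closed[OF \<pi>(1) lin_map_closed[OF \<sigma> x]] by (auto dest: inj_onD)
  qed
  then have "dual_basis A P n (\<lambda>k. \<pi> (unit_vector A n k)) (\<lambda>k x. ?\<sigma> x k)"
    by (intro dual_basis_retract[OF dual_basis_free[OF A] P \<pi>(1) \<sigma>])
  then show thesis using that by blast
qed

lemma fin_gen_projective_iff:
  "fin_gen A P \<and> projective A P \<longleftrightarrow> (\<exists>n b c. dual_basis A P n b c)"
  using dual_basis_fin_gen dual_basis_projective projective_dual_basis by metis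

section \<open>Chain conditions\<close>

text \<open>Submodules are kept as subsets of one ambient module instead of records with a changed
  carrier. Arguments that enlarge or intersect submodules then change a set only;
  \<open>fin_gen_submodule_iff\<close> translates back.\<close>

definition fg_sub :: "('a, 'c) ring_scheme \<Rightarrow> ('a, 'm) module \<Rightarrow> 'm set \<Rightarrow> bool" where
  "fg_sub A M N \<longleftrightarrow> (\<exists>S. finite S \<and> S \<subseteq> N \<and> (\<forall>W. submodule W A M \<and> S \<subseteq> W \<longrightarrow> N \<subseteq> W))"

definition noetherian_sub :: "('a, 'c) ring_scheme \<Rightarrow> ('a, 'm) module \<Rightarrow> 'm set \<Rightarrow> bool" where
  "noetherian_sub A M N \<longleftrightarrow> (\<forall>U. submodule U A M \<and> U \<subseteq> N \<longrightarrow> fg_sub A M U)"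

definition artinian_sub :: "('a, 'c) ring_scheme \<Rightarrow> ('a, 'm) module \<Rightarrow> 'm set \<Rightarrow> bool" where
  "artinian_sub A M N \<longleftrightarrow> (\<forall>U :: nat \<Rightarrow> 'm set.
     (\<forall>i. submodule (U i) A M \<and> U i \<subseteq> N \<and> U (Suc i) \<subseteq> U i) \<longrightarrow> (\<exists>i. \<forall>j\<ge>i. U j = U i))"

lemma fg_subI:
  assumes "finite S" "S \<subseteq> N" "\<And>W. submodule W A M \<Longrightarrow> S \<subseteq> W \<Longrightarrow> N \<subseteq> W"
  shows "fg_sub A M N"
  unfolding fg_sub_def using assms by (intro exI[of _ S]) simp

lemma fg_subE:
  assumes "fg_sub A M N"
  obtains S where "finite S" "S \<subseteq> N" "\<And>W. submodule W A M \<Longrightarrow> S \<subseteq> W \<Longrightarrow> N \<subseteq> W"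
proof -
  obtain S where "finite S \<and> S \<subseteq> N \<and> (\<forall>W. submodule W A M \<and> S \<subseteq> W \<longrightarrow> N \<subseteq> W)"
    using assms unfolding fg_sub_def by (elim exE)
  then show thesis by (intro that[of S]) simp_all
qed

lemma fin_gen_submodule_iff:
  assumes "left_module A M" "submodule N A M"
  shows "fin_gen A (M\<lparr>carrier := N\<rparr>) \<longleftrightarrow> fg_sub A M N"
proof
  assume "fin_gen A (M\<lparr>carrier := N\<rparr>)"
  then obtain S where S: "finite S" "S \<subseteq> N"
      "\<And>V. submodule V A M \<Longrightarrow> V \<subseteq> N \<Longrightarrow> S \<subseteq> V \<Longrightarrow> V = N"
    by (auto simp: fin_gen_def submodule_of_submodule[OF assms])
  have "N \<subseteq> W" if "submodule W A M" "S \<subseteq> W" for W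
    using S(3)[of "W \<inter> N"] S(2) that left_module.submodule_inter[OF assms(1) _ assms(2)] by auto
  then show "fg_sub A M N"
    using S by (intro fg_subI[of S])
next
  assume "fg_sub A M N"
  then obtain S where S: "finite S" "S \<subseteq> N" "\<And>W. submodule W A M \<Longrightarrow> S \<subseteq> W \<Longrightarrow> N \<subseteq> W"
    by (rule fg_subE) iprover
  then show "fin_gen A (M\<lparr>carrier := N\<rparr>)"
    unfolding fin_gen_def submodule_of_submodule[OF assms] by (intro exI[of _ S]) auto
qed

text \<open>Generators of the image are lifted to \<open>U\<close> and joined to generators of the
  kernel part. A submodule \<open>W\<close> containing them has, over every f(x), an element w in
  common with \<open>U\<close>, and x - w lies in the kernel part, hence in
  \<open>W\<close>.\<close>

lemma fg_sub_extension:
  assumes "left_module A M" "left_module A N" "lin_map A M N f" "submodule U A M"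
    and "fg_sub A N (f ` U)" "fg_sub A M (U \<inter> a_kernel M N f)"
  shows "fg_sub A M U"
proof -
  interpret M: left_module A M by fact
  interpret N: left_module A N by fact
  obtain S1 where S1: "finite S1" "S1 \<subseteq> f ` U"
      "\<And>W. submodule W A N \<Longrightarrow> S1 \<subseteq> W \<Longrightarrow> f ` U \<subseteq> W"
    by (rule fg_subE[OF assms(5)]) iprover
  obtain S2 where S2: "finite S2" "S2 \<subseteq> U \<inter> a_kernel M N f"
      "\<And>W. submodule W A M \<Longrightarrow> S2 \<subseteq> W \<Longrightarrow> U \<inter> a_kernel M N f \<subseteq> W"
    by (rule fg_subE[OF assms(6)]) iprover
  obtain T where T: "T \<subseteq> U" "finite T" "S1 = f ` T"
    using finite_subset_image[OF S1(1,2)] by blast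
  have "U \<subseteq> W" if W: "submodule W A M" "T \<union> S2 \<subseteq> W" for W
  proof
    fix x assume x: "x \<in> U"
    have WU: "submodule (W \<inter> U) A M"
      by (intro M.submodule_inter W assms)
    have fU: "f ` U \<subseteq> f ` (W \<inter> U)"
      using W T by (intro S1 submodule_image[OF assms(1-3)] WU) auto
    obtain w where w: "w \<in> W" "w \<in> U" "f w = f x"
      using subsetD[OF fU imageI[OF x]] by auto
    have U: "U \<subseteq> carrier M" using assms(4) by (rule submodule_subset)
    have "x \<ominus>\<^bsub>M\<^esub> w \<in> U \<inter> a_kernel M N f"
      using w x U lin_map_closed[OF assms(3), of x]
      by (auto simp: a_kernel_def' lin_map_minus[OF assms(1-3)] N.M.minus_eq_zero_iff subset_iff
         intro: M.submodule_minus[OF assms(4)])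
    then have "x \<ominus>\<^bsub>M\<^esub> w \<in> W"
      using S2(3)[OF W(1)] W(2) by blast
    then have "(x \<ominus>\<^bsub>M\<^esub> w) \<oplus>\<^bsub>M\<^esub> w \<in> W"
      using W w by (auto simp: M.submodule_iff)
    moreover have "(x \<ominus>\<^bsub>M\<^esub> w) \<oplus>\<^bsub>M\<^esub> w = x"
      using x w U by (auto simp: a_minus_def M.M.a_assoc M.M.l_neg subset_iff)
    ultimately show "x \<in> W" by simp
  qed
  then show ?thesis
    using T S2 by (intro fg_subI[of "T \<union> S2"]) auto
qed

lemma submodule_Union_chain:
  assumes "left_module A M" "C \<noteq> {}" "\<And>U. U \<in> C \<Longrightarrow> submodule U A M"
    and "\<And>U V. U \<in> C \<Longrightarrow> V \<in> C \<Longrightarrow> U \<subseteq> V \<or> V \<subseteq> U"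
  shows "submodule (\<Union>C) A M"
proof -
  interpret M: left_module A M by fact
  have C: "\<And>U. U \<in> C \<Longrightarrow> U \<subseteq> carrier M" "\<And>U. U \<in> C \<Longrightarrow> \<zero>\<^bsub>M\<^esub> \<in> U"
    "\<And>U x y. U \<in> C \<Longrightarrow> x \<in> U \<Longrightarrow> y \<in> U \<Longrightarrow> x \<oplus>\<^bsub>M\<^esub> y \<in> U"
    "\<And>U a x. U \<in> C \<Longrightarrow> a \<in> carrier A \<Longrightarrow> x \<in> U \<Longrightarrow> a \<odot>\<^bsub>M\<^esub> x \<in> U"
    using assms(3) by (auto simp: M.submodule_iff)
  have "x \<oplus>\<^bsub>M\<^esub> y \<in> \<Union>C" if xy: "x \<in> \<Union>C" "y \<in> \<Union>C" for x y
  proof -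
    obtain U V where UV: "U \<in> C" "V \<in> C" "x \<in> U" "y \<in> V" using xy by blast
    then have "U \<subseteq> V \<or> V \<subseteq> U" by (intro assms(4))
    then show ?thesis using UV C(3) by blast
  qed
  moreover have "\<Union>C \<subseteq> carrier M" "\<zero>\<^bsub>M\<^esub> \<in> \<Union>C"
    using C(1,2) assms(2) by auto
  moreover have "a \<odot>\<^bsub>M\<^esub> x \<in> \<Union>C" if "a \<in> carrier A" "x \<in> \<Union>C" for a x
    using that C(4) by blast
  ultimately show ?thesis
    unfolding M.submodule_iff by simp
qed

text \<open>A finite generating set of the union lies in one member of the chain, where the chain
  then stops.\<close>

lemma fg_sub_of_Union_chain:
  fixes U :: "nat \<Rightarrow> 'm set"
  assumes "left_module A M" "\<And>i. submodule (U i) A M" "\<And>i. U i \<subseteq> U (Suc i)"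
    and "fg_sub A M (\<Union>i. U i)"
  obtains i where "\<And>j. U j \<subseteq> U i"
proof -
  obtain S where S: "finite S" "S \<subseteq> (\<Union>i. U i)"
      "\<And>W. submodule W A M \<Longrightarrow> S \<subseteq> W \<Longrightarrow> (\<Union>i. U i) \<subseteq> W"
    by (rule fg_subE[OF assms(4)]) iprover
  have mono: "U i \<subseteq> U j" if "i \<le> j" for i j
    using lift_Suc_mono_le[of U, OF assms(3) that] .
  have "\<exists>i. S \<subseteq> U i"
    using S(1,2)
  proof (induction S rule: finite_induct)
    case (insert x S)
    then obtain i j where "S \<subseteq> U i" "x \<in> U j" by blast
    then have "insert x S \<subseteq> U (max i j)"
      using mono[of i "max i j"] mono[of j "max i j"] by auto
    then show ?case by blast
  qed simp
  then obtain i where "S \<subseteq> U i" ..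
  then have "(\<Union>i. U i) \<subseteq> U i" by (rule S(3)[OF assms(2)])
  then show thesis by (intro that[of i]) auto
qed

text \<open>Without a minimal element, dependent choice produces a strictly descending chain. The
  property \<open>Q\<close> is left open: it serves for ideals that are not finitely generated and
  for summands that still cover a module.\<close>

lemma artinian_sub_minimal:
  fixes M :: "('a, 'm) module"
  assumes "artinian_sub A M N" "submodule U0 A M" "U0 \<subseteq> N" "Q U0"
  obtains U where "submodule U A M" "U \<subseteq> N" "Q U"
    "\<And>V. submodule V A M \<Longrightarrow> V \<subset> U \<Longrightarrow> \<not> Q V"
proof (rule ccontr)
  assume contra: "\<not> thesis"
  let ?ok = "\<lambda>U. submodule U A M \<and> U \<subseteq> N \<and> Q U"
  have "\<exists>f. \<forall>i::nat. ?ok (f i) \<and> f (Suc i) \<subset> f i"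
  proof (rule dependent_nat_choice)
    show "\<exists>U. ?ok U" using assms by blast
    fix U :: "'m set" and i :: nat
    assume "?ok U"
    then show "\<exists>V. ?ok V \<and> V \<subset> U"
      using contra that by blast
  qed
  then obtain f :: "nat \<Rightarrow> 'm set" where f: "\<forall>i. ?ok (f i) \<and> f (Suc i) \<subset> f i" ..
  then have "\<forall>i. submodule (f i) A M \<and> f i \<subseteq> N \<and> f (Suc i) \<subseteq> f i" by auto
  then obtain i where i: "\<And>j. j \<ge> i \<Longrightarrow> f j = f i"
    using assms(1) unfolding artinian_sub_def by blast
  have "f (Suc i) = f i" by (rule i) simp
  moreover have "f (Suc i) \<subset> f i" using f by blast
  ultimately show False by simp
qed


section \<open>Adjoining one generator to a submodule\<close>

definition adjoin ::
  "('a, 'c) ring_scheme \<Rightarrow> ('a, 'm) module \<Rightarrow> 'm set \<Rightarrow> 'm \<Rightarrow> 'm set" where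
  "adjoin A M N x = {n \<oplus>\<^bsub>M\<^esub> a \<odot>\<^bsub>M\<^esub> x | n a. n \<in> N \<and> a \<in> carrier A}"

lemma adjoin:
  assumes "left_module A M" "submodule N A M" "x \<in> carrier M"
  shows submodule_adjoin: "submodule (adjoin A M N x) A M"
    and subset_adjoin: "N \<subseteq> adjoin A M N x"
    and mem_adjoin: "x \<in> adjoin A M N x"
proof -
  interpret M: left_module A M by fact
  have N: "\<And>x. x \<in> N \<Longrightarrow> x \<in> carrier M" "\<zero>\<^bsub>M\<^esub> \<in> N" "\<And>x y. x \<in> N \<Longrightarrow> y \<in> N \<Longrightarrow> x \<oplus>\<^bsub>M\<^esub> y \<in> N"
    "\<And>a x. a \<in> carrier A \<Longrightarrow> x \<in> N \<Longrightarrow> a \<odot>\<^bsub>M\<^esub> x \<in> N"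
    using assms(2) by (auto simp: M.submodule_iff)
  have mem: "n \<oplus>\<^bsub>M\<^esub> a \<odot>\<^bsub>M\<^esub> x \<in> adjoin A M N x" if "n \<in> N" "a \<in> carrier A" for n a
    using that by (auto simp: adjoin_def)
  show sub: "N \<subseteq> adjoin A M N x"
  proof
    fix n assume "n \<in> N"
    then show "n \<in> adjoin A M N x"
      using mem[of n "\<zero>\<^bsub>A\<^esub>"] N assms by (simp add: M.lsmult_l_null)
  qed
  show "x \<in> adjoin A M N x"
    using mem[of "\<zero>\<^bsub>M\<^esub>" "\<one>\<^bsub>A\<^esub>"] N assms by (simp add: M.lsmult_one)
  have "y \<oplus>\<^bsub>M\<^esub> z \<in> adjoin A M N x" if yz: "y \<in> adjoin A M N x" "z \<in> adjoin A M N x" for y z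
  proof -
    obtain n a m b where y: "y = n \<oplus>\<^bsub>M\<^esub> a \<odot>\<^bsub>M\<^esub> x" "z = m \<oplus>\<^bsub>M\<^esub> b \<odot>\<^bsub>M\<^esub> x"
      "n \<in> N" "m \<in> N" "a \<in> carrier A" "b \<in> carrier A"
      using yz unfolding adjoin_def by blast
    then have "y \<oplus>\<^bsub>M\<^esub> z = (n \<oplus>\<^bsub>M\<^esub> m) \<oplus>\<^bsub>M\<^esub> (a \<oplus>\<^bsub>A\<^esub> b) \<odot>\<^bsub>M\<^esub> x"
      using assms N by (simp add: M.lsmult_l_distr M.M.a_ac M.lsmult_closed)
    then show ?thesis using mem y N by simp
  qed
  moreover have "b \<odot>\<^bsub>M\<^esub> y \<in> adjoin A M N x" if yb: "y \<in> adjoin A M N x" "b \<in> carrier A" for y b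
  proof -
    obtain n a where y: "y = n \<oplus>\<^bsub>M\<^esub> a \<odot>\<^bsub>M\<^esub> x" "n \<in> N" "a \<in> carrier A"
      using yb unfolding adjoin_def by blast
    then have "b \<odot>\<^bsub>M\<^esub> y = (b \<odot>\<^bsub>M\<^esub> n) \<oplus>\<^bsub>M\<^esub> (b \<otimes>\<^bsub>A\<^esub> a) \<odot>\<^bsub>M\<^esub> x"
      using assms N yb by (simp add: M.lsmult_r_distr M.lsmult_closed M.lsmult_assoc)
    then show ?thesis using mem y N yb by simp
  qed
  moreover have "adjoin A M N x \<subseteq> carrier M"
    using N assms by (auto simp: adjoin_def intro: M.lsmult_closed)
  ultimately show "submodule (adjoin A M N x) A M"
    using N(2) sub unfolding M.submodule_iff by blast
qed

text \<open>For submodules \<open>N\<close> and \<open>U\<close>, the left ideal of those a with a x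
  in U + N, that is, the preimage under a \<mapsto> a x + N of the image of \<open>U\<close> in M/N.
  It replaces the quotient module in the inductions.\<close>

definition adjoin_coeffs ::
  "('a, 'c) ring_scheme \<Rightarrow> ('a, 'm) module \<Rightarrow> 'm set \<Rightarrow> 'm \<Rightarrow> 'm set \<Rightarrow> 'a set" where
  "adjoin_coeffs A M N x U = {a \<in> carrier A. \<exists>n\<in>N. n \<oplus>\<^bsub>M\<^esub> a \<odot>\<^bsub>M\<^esub> x \<in> U}"

lemma submodule_adjoin_coeffs:
  assumes "left_module A M" "submodule N A M" "x \<in> carrier M" "submodule U A M"
  shows "submodule (adjoin_coeffs A M N x U) A (regular A)"
proof -
  interpret M: left_module A M by fact
  interpret reg: left_module A "regular A" by (rule left_module_regular[OF left_module_ring]) fact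
  have N: "\<And>x. x \<in> N \<Longrightarrow> x \<in> carrier M" "\<zero>\<^bsub>M\<^esub> \<in> N" "\<And>x y. x \<in> N \<Longrightarrow> y \<in> N \<Longrightarrow> x \<oplus>\<^bsub>M\<^esub> y \<in> N"
    "\<And>a x. a \<in> carrier A \<Longrightarrow> x \<in> N \<Longrightarrow> a \<odot>\<^bsub>M\<^esub> x \<in> N"
    using assms(2) by (auto simp: M.submodule_iff)
  have U: "\<And>x. x \<in> U \<Longrightarrow> x \<in> carrier M" "\<zero>\<^bsub>M\<^esub> \<in> U" "\<And>x y. x \<in> U \<Longrightarrow> y \<in> U \<Longrightarrow> x \<oplus>\<^bsub>M\<^esub> y \<in> U"
    "\<And>a x. a \<in> carrier A \<Longrightarrow> x \<in> U \<Longrightarrow> a \<odot>\<^bsub>M\<^esub> x \<in> U"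
    using assms(4) by (auto simp: M.submodule_iff)
  show ?thesis
    unfolding reg.submodule_iff
  proof (intro conjI ballI)
    show "adjoin_coeffs A M N x U \<subseteq> carrier (regular A)"
      by (auto simp: adjoin_coeffs_def)
    show "\<zero>\<^bsub>regular A\<^esub> \<in> adjoin_coeffs A M N x U"
      using N(2) U(2) assms(3)
      by (auto simp: adjoin_coeffs_def M.lsmult_l_null intro!: bexI[of _ "\<zero>\<^bsub>M\<^esub>"])
    fix a assume "a \<in> adjoin_coeffs A M N x U"
    then obtain n where a: "a \<in> carrier A" "n \<in> N" "n \<oplus>\<^bsub>M\<^esub> a \<odot>\<^bsub>M\<^esub> x \<in> U"
      by (auto simp: adjoin_coeffs_def)
    {
      fix b assume "b \<in> adjoin_coeffs A M N x U"
      then obtain m where b: "b \<in> carrier A" "m \<in> N" "m \<oplus>\<^bsub>M\<^esub> b \<odot>\<^bsub>M\<^esub> x \<in> U"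
        by (auto simp: adjoin_coeffs_def)
      have "(n \<oplus>\<^bsub>M\<^esub> a \<odot>\<^bsub>M\<^esub> x) \<oplus>\<^bsub>M\<^esub> (m \<oplus>\<^bsub>M\<^esub> b \<odot>\<^bsub>M\<^esub> x)
          = (n \<oplus>\<^bsub>M\<^esub> m) \<oplus>\<^bsub>M\<^esub> (a \<oplus>\<^bsub>A\<^esub> b) \<odot>\<^bsub>M\<^esub> x"
        using assms N a b by (simp add: M.lsmult_l_distr M.M.a_ac M.lsmult_closed)
      then show "a \<oplus>\<^bsub>regular A\<^esub> b \<in> adjoin_coeffs A M N x U"
        using U(3)[OF a(3) b(3)] N(3)[OF a(2) b(2)] a b by (auto simp: adjoin_coeffs_def)
    }
    {
      fix b assume b: "b \<in> carrier A"
      have "b \<odot>\<^bsub>M\<^esub> (n \<oplus>\<^bsub>M\<^esub> a \<odot>\<^bsub>M\<^esub> x) = (b \<odot>\<^bsub>M\<^esub> n) \<oplus>\<^bsub>M\<^esub> (b \<otimes>\<^bsub>A\<^esub> a) \<odot>\<^bsub>M\<^esub> x"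
        using assms N a b by (simp add: M.lsmult_r_distr M.lsmult_closed M.lsmult_assoc)
      then show "b \<odot>\<^bsub>regular A\<^esub> a \<in> adjoin_coeffs A M N x U"
        using U(4)[OF b a(3)] N(4)[OF b a(2)] a b by (auto simp: adjoin_coeffs_def)
    }
  qed
qed

text \<open>A submodule of N + A x is controlled by two pieces, its part in \<open>N\<close> and its
  coefficients: an element n + a x of \<open>U\<close> differs from some m + a x in \<open>W\<close>
  by n - m, which lies in \<open>U\<close> and in \<open>N\<close>, hence in
  \<open>W\<close>.\<close>

lemma adjoin_coeffs_subset:
  assumes "left_module A M" "submodule N A M" "x \<in> carrier M"
    and "submodule U A M" "submodule W A M" "U \<subseteq> adjoin A M N x" "W \<subseteq> U" "U \<inter> N \<subseteq> W"
    and "adjoin_coeffs A M N x U \<subseteq> adjoin_coeffs A M N x W"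
  shows "U \<subseteq> W"
proof
  interpret M: left_module A M by fact
  note sub = submodule_subset[OF assms(2)] submodule_subset[OF assms(4)]
  fix u assume u: "u \<in> U"
  then obtain n a where na: "u = n \<oplus>\<^bsub>M\<^esub> a \<odot>\<^bsub>M\<^esub> x" "n \<in> N" "a \<in> carrier A"
    using assms(6) by (auto simp: adjoin_def)
  then have "a \<in> adjoin_coeffs A M N x W"
    using u assms(9) by (auto simp: adjoin_coeffs_def)
  then obtain m where m: "m \<in> N" "m \<oplus>\<^bsub>M\<^esub> a \<odot>\<^bsub>M\<^esub> x \<in> W"
    by (auto simp: adjoin_coeffs_def)
  let ?w = "m \<oplus>\<^bsub>M\<^esub> a \<odot>\<^bsub>M\<^esub> x"
  have c: "n \<in> carrier M" "m \<in> carrier M" "a \<odot>\<^bsub>M\<^esub> x \<in> carrier M"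
    using na m sub assms(3) by (auto intro: M.lsmult_closed)
  then have eq: "n \<ominus>\<^bsub>M\<^esub> m = u \<ominus>\<^bsub>M\<^esub> ?w"
    unfolding na a_minus_def by (simp add: M.M.minus_add M.M.a_ac M.M.r_neg M.M.r_neg1 M.M.r_neg2)
  have "u \<ominus>\<^bsub>M\<^esub> ?w \<in> U"
    using u m assms(7) by (intro M.submodule_minus[OF assms(4)]) auto
  moreover have "n \<ominus>\<^bsub>M\<^esub> m \<in> N"
    using na m by (intro M.submodule_minus[OF assms(2)]) auto
  ultimately have "n \<ominus>\<^bsub>M\<^esub> m \<in> W" using eq assms(8) by auto
  then have "(n \<ominus>\<^bsub>M\<^esub> m) \<oplus>\<^bsub>M\<^esub> ?w \<in> W"
    using m assms(5) by (auto simp: M.submodule_iff)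
  moreover have "(n \<ominus>\<^bsub>M\<^esub> m) \<oplus>\<^bsub>M\<^esub> ?w = u"
    using c unfolding na a_minus_def by (simp add: M.M.a_assoc M.M.r_neg1 M.M.r_neg2)
  ultimately show "u \<in> W" by simp
qed

text \<open>The two pieces of \<open>U\<close> are finitely generated separately, and each generator
  a of the coefficient ideal is lifted to an element m a + a x of \<open>U\<close>.\<close>

lemma noetherian_sub_adjoin:
  assumes "left_module A M" "submodule N A M" "x \<in> carrier M"
    and "noetherian_sub A (regular A) (carrier A)" "noetherian_sub A M N"
  shows "noetherian_sub A M (adjoin A M N x)"
  unfolding noetherian_sub_def
proof (intro allI impI, elim conjE)
  interpret M: left_module A M by fact
  fix U assume U: "submodule U A M" "U \<subseteq> adjoin A M N x"
  let ?I = "adjoin_coeffs A M N x"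
  have "fg_sub A (regular A) (?I U)"
    using assms(4) submodule_adjoin_coeffs[OF assms(1-3) U(1)]
    by (auto simp: noetherian_sub_def adjoin_coeffs_def)
  then obtain S1 where S1: "finite S1" "S1 \<subseteq> ?I U"
      "\<And>W. submodule W A (regular A) \<Longrightarrow> S1 \<subseteq> W \<Longrightarrow> ?I U \<subseteq> W"
    by (rule fg_subE) iprover
  have "fg_sub A M (U \<inter> N)"
    using assms(5) M.submodule_inter[OF U(1) assms(2)] unfolding noetherian_sub_def by blast
  then obtain S2 where S2: "finite S2" "S2 \<subseteq> U \<inter> N"
      "\<And>W. submodule W A M \<Longrightarrow> S2 \<subseteq> W \<Longrightarrow> U \<inter> N \<subseteq> W"
    by (rule fg_subE) iprover
  have "\<forall>a\<in>S1. \<exists>n. n \<in> N \<and> n \<oplus>\<^bsub>M\<^esub> a \<odot>\<^bsub>M\<^esub> x \<in> U"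
    using S1(2) by (auto simp: adjoin_coeffs_def)
  then obtain m where m: "\<And>a. a \<in> S1 \<Longrightarrow> m a \<in> N" "\<And>a. a \<in> S1 \<Longrightarrow> m a \<oplus>\<^bsub>M\<^esub> a \<odot>\<^bsub>M\<^esub> x \<in> U"
    by (auto dest!: bchoice)
  let ?S = "(\<lambda>a. m a \<oplus>\<^bsub>M\<^esub> a \<odot>\<^bsub>M\<^esub> x) ` S1 \<union> S2"
  have "U \<subseteq> W" if W: "submodule W A M" "?S \<subseteq> W" for W
  proof -
    have WU: "submodule (W \<inter> U) A M"
      by (intro M.submodule_inter W U)
    have "S1 \<subseteq> ?I (W \<inter> U)"
      using m W(2) S1(2) unfolding adjoin_coeffs_def by blast
    then have "?I U \<subseteq> ?I (W \<inter> U)"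
      by (intro S1(3) submodule_adjoin_coeffs assms WU)
    moreover have "U \<inter> N \<subseteq> W \<inter> U"
      using S2(3)[OF W(1)] W(2) by blast
    ultimately have "U \<subseteq> W \<inter> U"
      by (rule adjoin_coeffs_subset[OF assms(1-3) U(1) WU U(2) Int_lower2, rotated])
    then show ?thesis by blast
  qed
  moreover have "finite ?S" "?S \<subseteq> U" using S1 S2 m by auto
  ultimately show "fg_sub A M U"
    by (intro fg_subI[of ?S])
qed

text \<open>Both pieces of the chain become stationary, and from the larger of the two indices on so
  does the chain itself.\<close>

lemma artinian_sub_adjoin:
  fixes M :: "('a, 'm) module"
  assumes "left_module A M" "submodule N A M" "x \<in> carrier M"
    and "artinian_sub A (regular A) (carrier A)" "artinian_sub A M N"
  shows "artinian_sub A M (adjoin A M N x)"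
  unfolding artinian_sub_def
proof (intro allI impI)
  interpret M: left_module A M by fact
  fix U :: "nat \<Rightarrow> 'm set"
  assume U: "\<forall>i. submodule (U i) A M \<and> U i \<subseteq> adjoin A M N x \<and> U (Suc i) \<subseteq> U i"
  let ?I = "\<lambda>i. adjoin_coeffs A M N x (U i)"
  have "\<forall>i. submodule (?I i) A (regular A) \<and> ?I i \<subseteq> carrier A \<and> ?I (Suc i) \<subseteq> ?I i"
    using U submodule_adjoin_coeffs[OF assms(1-3)] unfolding adjoin_coeffs_def by blast
  then obtain i1 where i1: "\<And>j. j \<ge> i1 \<Longrightarrow> ?I j = ?I i1"
    using assms(4)[unfolded artinian_sub_def, rule_format, of ?I] by blast
  have "\<forall>i. submodule (U i \<inter> N) A M \<and> U i \<inter> N \<subseteq> N \<and> U (Suc i) \<inter> N \<subseteq> U i \<inter> N"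
    using U M.submodule_inter[OF _ assms(2)] by blast
  then obtain i2 where i2: "\<And>j. j \<ge> i2 \<Longrightarrow> U j \<inter> N = U i2 \<inter> N"
    using assms(5)[unfolded artinian_sub_def, rule_format, of "\<lambda>i. U i \<inter> N"] by blast
  let ?i = "max i1 i2"
  have "U j = U ?i" if "j \<ge> ?i" for j
  proof
    show le: "U j \<subseteq> U ?i" using U that by (intro lift_Suc_antimono_le[of U "?i" j]) simp_all
    have "?I ?i = ?I j" "U ?i \<inter> N = U j \<inter> N"
      using that i1[of ?i] i1[of j] i2[of ?i] i2[of j] by auto
    then show "U ?i \<subseteq> U j"
      using U le by (intro adjoin_coeffs_subset[OF assms(1-3) _ _ _ le]) simp_all
  qed
  then show "\<exists>i. \<forall>j\<ge>i. U j = U i" by blast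
qed

text \<open>The generators are adjoined one at a time, starting from the zero submodule.\<close>

lemma fin_gen_finite_length:
  assumes "left_module A M" "fin_gen A M"
    and "noetherian_sub A (regular A) (carrier A)" "artinian_sub A (regular A) (carrier A)"
  shows "noetherian_sub A M (carrier M)" "artinian_sub A M (carrier M)"
proof -
  interpret M: left_module A M by fact
  obtain S where S: "finite S" "S \<subseteq> carrier M"
      "\<And>N. submodule N A M \<Longrightarrow> S \<subseteq> N \<Longrightarrow> N = carrier M"
    using assms(2) by (auto simp: fin_gen_def)
  have "\<exists>N. submodule N A M \<and> S \<subseteq> N \<and> noetherian_sub A M N \<and> artinian_sub A M N"
    using S(1,2)
  proof (induction S rule: finite_induct)
    case empty
    have z: "U = {\<zero>\<^bsub>M\<^esub>}" if "submodule U A M" "U \<subseteq> {\<zero>\<^bsub>M\<^esub>}" for U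
      using that by (auto simp: M.submodule_iff)
    have "fg_sub A M {\<zero>\<^bsub>M\<^esub>}"
      by (intro fg_subI[of "{\<zero>\<^bsub>M\<^esub>}"]) auto
    then have "noetherian_sub A M {\<zero>\<^bsub>M\<^esub>}"
      using z by (auto simp: noetherian_sub_def)
    moreover have "artinian_sub A M {\<zero>\<^bsub>M\<^esub>}"
      unfolding artinian_sub_def using z by blast
    ultimately show ?case using M.submodule_zero by blast
  next
    case (insert x S)
    then obtain N where N: "submodule N A M" "S \<subseteq> N" "noetherian_sub A M N" "artinian_sub A M N"
      by blast
    have x: "x \<in> carrier M" using insert by blast
    show ?case
      using noetherian_sub_adjoin[OF assms(1) N(1) x assms(3) N(3)]
        artinian_sub_adjoin[OF assms(1) N(1) x assms(4) N(4)] adjoin[OF assms(1) N(1) x] N(2)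
      by blast
  qed
  then show "noetherian_sub A M (carrier M)" "artinian_sub A M (carrier M)"
    using S(3) by blast+
qed

section \<open>Artin algebras have finite length\<close>

lemma (in cring) submodule_regular_iff: "submodule I R (regular R) \<longleftrightarrow> ideal I R"
proof -
  interpret reg: left_module R "regular R" by (rule left_module_regular) (rule ring_axioms)
  show ?thesis
  proof
    assume "submodule I R (regular R)"
    then have I: "I \<subseteq> carrier R \<and> \<zero> \<in> I \<and> (\<forall>x\<in>I. \<forall>y\<in>I. x \<oplus> y \<in> I) \<and> (\<forall>a\<in>carrier R. \<forall>x\<in>I. a \<otimes> x \<in> I)"
      unfolding reg.submodule_iff by simp
    then have "\<ominus> x \<in> I" if "x \<in> I" for x
      using that l_minus[of \<one> x] by (metis a_inv_closed l_one one_closed subsetD)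
    moreover have "x \<otimes> a \<in> I" if "x \<in> I" "a \<in> carrier R" for x a
      using that I m_comm[of x a] by auto
    ultimately show "ideal I R"
      by (intro idealI ring_axioms subgroup.intro) (use I in \<open>auto simp flip: a_inv_def\<close>)
  next
    assume "ideal I R"
    then show "submodule I R (regular R)"
      unfolding reg.submodule_iff
      by (auto simp: ideal.Icarr additive_subgroup.zero_closed additive_subgroup.a_closed
         ideal.axioms(1) ideal.I_l_closed)
  qed
qed

lemma (in artinian_cring) artinian_sub_regular: "artinian_sub R (regular R) (carrier R)"
  unfolding artinian_sub_def submodule_regular_iff using descending_chain by metis

text \<open>
  A minimal ideal \<open>I\<close> among those that are not finitely generated satisfies \<open>a I = I\<close> or \<open>a I = 0\<close>
  for every scalar \<open>a\<close>; hence it is a vector space over a field, and removing one dimension from it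
  gives a smaller ideal that is not finitely generated either.
\<close>

lemma (in artinian_cring) noetherian_sub_regular: "noetherian_sub R (regular R) (carrier R)"
proof (rule ccontr)
  assume "\<not> noetherian_sub R (regular R) (carrier R)"
  then obtain I0 where I0: "submodule I0 R (regular R)" "I0 \<subseteq> carrier R" "\<not> fg_sub R (regular R) I0"
    by (auto simp: noetherian_sub_def)
  obtain I where I: "submodule I R (regular R)" "I \<subseteq> carrier R" "\<not> fg_sub R (regular R) I"
    and min: "\<And>V. submodule V R (regular R) \<Longrightarrow> V \<subset> I \<Longrightarrow> \<not> \<not> fg_sub R (regular R) V"
    by (rule artinian_sub_minimal[OF artinian_sub_regular I0(1,2),
        where Q = "\<lambda>U. \<not> fg_sub R (regular R) U", OF I0(3)]) iprover
  have L: "left_module R (regular R)" by (rule left_module_regular) (rule ring_axioms)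
  interpret reg: left_module R "regular R" by (rule L)
  have Isub: "\<zero> \<in> I" "\<And>x y. x \<in> I \<Longrightarrow> y \<in> I \<Longrightarrow> x \<oplus> y \<in> I"
    "\<And>a x. a \<in> carrier R \<Longrightarrow> x \<in> I \<Longrightarrow> a \<otimes> x \<in> I"
    and Ic: "\<And>x. x \<in> I \<Longrightarrow> x \<in> carrier R"
    using I(1) unfolding reg.submodule_iff by auto
  \<comment> \<open>Otherwise a I and the annihilator of a in \<open>I\<close> are both proper in
    \<open>I\<close>, hence finitely generated by minimality, and \<open>I\<close> would be an
    extension of finitely generated pieces.\<close>
  have alt: "(\<lambda>x. a \<otimes> x) ` I = I \<or> (\<forall>x\<in>I. a \<otimes> x = \<zero>)" if a: "a \<in> carrier R" for a
  proof (rule ccontr)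
    assume contra: "\<not> ?thesis"
    have f: "lin_map R (regular R) (regular R) (\<lambda>x. a \<otimes> x)"
      using a by (intro lin_mapI) (auto simp: r_distr m_lcomm)
    have "fg_sub R (regular R) ((\<lambda>x. a \<otimes> x) ` I)"
      using min[OF submodule_image[OF L L f I(1)]] contra Isub a by blast
    moreover have "fg_sub R (regular R) (I \<inter> a_kernel (regular R) (regular R) (\<lambda>x. a \<otimes> x))"
    proof (rule min[THEN notnotD])
      show "submodule (I \<inter> a_kernel (regular R) (regular R) (\<lambda>x. a \<otimes> x)) R (regular R)"
        by (intro reg.submodule_inter I submodule_kernel[OF L L f])
      show "I \<inter> a_kernel (regular R) (regular R) (\<lambda>x. a \<otimes> x) \<subset> I"
        using contra by (auto simp: a_kernel_def')
    qed
    ultimately show False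
      using fg_sub_extension[OF L L f I(1)] I(3) by blast
  qed
  \<comment> \<open>The chain of ideals a^n R becomes stationary, so a^n = a^(n+1) b for some b. As
    a I = I, every x in \<open>I\<close> is of the form a^n y, and therefore b a x = x: the scalar a
    acts invertibly on \<open>I\<close>.\<close>
  have inv: "\<exists>b\<in>carrier R. \<forall>x\<in>I. b \<otimes> (a \<otimes> x) = x"
    if a: "a \<in> carrier R" and "\<not> (\<forall>x\<in>I. a \<otimes> x = \<zero>)" for a
  proof -
    have aI: "(\<lambda>x. a \<otimes> x) ` I = I" using alt that by blast
    have pow: "(\<lambda>x. a [^] n \<otimes> x) ` I = I" for n :: nat
    proof (induction n)
      case 0
      have "(\<lambda>x. a [^] (0::nat) \<otimes> x) ` I = (\<lambda>x. x) ` I"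
        using Ic by (intro image_cong) auto
      then show ?case by simp
    next
      case (Suc n)
      have "(\<lambda>x. a [^] Suc n \<otimes> x) ` I = (\<lambda>x. a [^] n \<otimes> x) ` ((\<lambda>x. a \<otimes> x) ` I)"
        unfolding image_image using a Ic by (intro image_cong) (auto simp: m_assoc)
      then show ?case by (simp add: aI Suc)
    qed
    let ?J = "\<lambda>n::nat. (\<lambda>x. a [^] n \<otimes> x) ` carrier R"
    have "submodule (?J n) R (regular R)" for n
    proof -
      have "lin_map R (regular R) (regular R) (\<lambda>x. a [^] n \<otimes> x)"
        using a by (intro lin_mapI) (auto simp: r_distr m_lcomm)
      from submodule_image[OF L L this reg.submodule_carrier] show ?thesis by simp
    qed
    moreover have "?J (Suc n) \<subseteq> ?J n" for n
      using a by (auto simp: m_assoc)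
    ultimately obtain n where n: "\<And>m. m \<ge> n \<Longrightarrow> ?J m = ?J n"
      using descending_chain[of ?J] unfolding submodule_regular_iff by metis
    have "a [^] n \<in> ?J n" using a by (auto intro!: image_eqI[of _ _ \<one>])
    also have "?J n = ?J (Suc n)" by (rule n[symmetric]) simp
    finally obtain b where b: "b \<in> carrier R" "a [^] n = a [^] Suc n \<otimes> b"
      by blast
    have "b \<otimes> (a \<otimes> x) = x" if x: "x \<in> I" for x
    proof -
      have "x \<in> (\<lambda>x. a [^] n \<otimes> x) ` I" using x by (simp only: pow)
      then obtain y where y: "y \<in> I" "x = a [^] n \<otimes> y" by auto
      have "b \<otimes> (a \<otimes> x) = (a [^] Suc n \<otimes> b) \<otimes> y"
        unfolding y(2) using a b(1) Ic[OF y(1)] by (simp add: m_ac)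
      also have "\<dots> = x" by (simp only: b(2)[symmetric] y(2)[symmetric])
      finally show ?thesis .
    qed
    then show ?thesis using b by blast
  qed
  have "fg_sub R (regular R) {\<zero>}"
    by (intro fg_subI[of "{\<zero>}"]) auto
  then have "I \<noteq> {\<zero>}" using I(3) by auto
  then obtain x0 where x0: "x0 \<in> I" "x0 \<noteq> \<zero>"
    using Isub(1) by blast
  \<comment> \<open>A maximal member \<open>H\<close> is a hyperplane avoiding \<open>x0\<close>. It
    is proper in \<open>I\<close>, hence finitely generated. For y outside \<open>H\<close> one has
    x0 = h + c y with c y nonzero, so c can be inverted on \<open>I\<close> and y lies in H + R x0;
    thus \<open>I\<close> is finitely generated after all.\<close>
  let ?H = "{H. submodule H R (regular R) \<and> H \<subseteq> I \<and> x0 \<notin> H}"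
  have "\<exists>H\<in>?H. \<forall>X\<in>?H. H \<subseteq> X \<longrightarrow> X = H"
  proof (rule subset_Zorn_nonempty)
    show "?H \<noteq> {}" using reg.submodule_zero x0 Isub by auto
    fix C assume C: "C \<noteq> {}" "subset.chain ?H C"
    then have C': "\<And>U. U \<in> C \<Longrightarrow> submodule U R (regular R) \<and> U \<subseteq> I \<and> x0 \<notin> U"
      "\<And>U V. U \<in> C \<Longrightarrow> V \<in> C \<Longrightarrow> U \<subseteq> V \<or> V \<subseteq> U"
      by (auto simp: subset.chain_def)
    then have "submodule (\<Union>C) R (regular R)"
      by (intro submodule_Union_chain[OF L C(1)]) auto
    then show "\<Union>C \<in> ?H" using C' by blast
  qed
  then obtain H where H_in: "H \<in> ?H" and H_max: "\<forall>X\<in>?H. H \<subseteq> X \<longrightarrow> X = H" ..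
  have H: "submodule H R (regular R)" "H \<subseteq> I" "x0 \<notin> H"
    using H_in by simp_all
  have max: "X = H" if "submodule X R (regular R)" "X \<subseteq> I" "x0 \<notin> X" "H \<subseteq> X" for X
    using H_max that by simp
  have "H \<subset> I" using H x0 by blast
  then have "fg_sub R (regular R) H" using min[OF H(1)] by blast
  then obtain S where S: "finite S" "S \<subseteq> H" "\<And>W. submodule W R (regular R) \<Longrightarrow> S \<subseteq> W \<Longrightarrow> H \<subseteq> W"
    by (rule fg_subE) iprover
  have "fg_sub R (regular R) I"
  proof (rule fg_subI[of "insert x0 S"])
    show "finite (insert x0 S)" "insert x0 S \<subseteq> I" using S x0 H by auto
    fix W assume W: "submodule W R (regular R)" "insert x0 S \<subseteq> W"
    then have HW: "H \<subseteq> W" using S by simp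
    have Wsub: "\<And>a x. a \<in> carrier R \<Longrightarrow> x \<in> W \<Longrightarrow> a \<otimes> x \<in> W"
      using W(1) unfolding reg.submodule_iff by auto
    show "I \<subseteq> W"
    proof
      fix y assume y: "y \<in> I"
      show "y \<in> W"
      proof (cases "y \<in> H")
        case False
        have yc: "y \<in> carrier (regular R)" using Ic y by simp
        note Hy = adjoin[OF L H(1) yc]
        have "adjoin R (regular R) H y \<subseteq> I"
          using H(2) Isub y by (auto simp: adjoin_def)
        then have "x0 \<in> adjoin R (regular R) H y"
          using max[OF Hy(1)] Hy(2,3) False by blast
        then obtain h c where h: "h \<in> H" "c \<in> carrier R" "x0 = h \<oplus> c \<otimes> y"
          by (auto simp: adjoin_def)
        have hc: "h \<in> carrier R" "c \<otimes> y \<in> carrier R" "x0 \<in> carrier R" using h H Ic y x0 by auto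
        have "c \<otimes> y \<noteq> \<zero>" using h H(3) hc by auto
        then obtain b where b: "b \<in> carrier R" "b \<otimes> (c \<otimes> y) = y"
          using inv[OF h(2)] y by blast
        have "c \<otimes> y = x0 \<ominus> h"
          using hc unfolding h(3) a_minus_def by (simp add: a_ac r_neg1 r_neg2 r_neg)
        moreover have "x0 \<ominus> h \<in> W"
          using ideal.axioms(1)[OF W(1)[unfolded submodule_regular_iff]] W(2) HW h(1)
          by (auto simp: a_minus_def additive_subgroup.a_closed additive_subgroup.a_inv_closed subset_iff)
        ultimately show ?thesis using Wsub[OF b(1), of "c \<otimes> y"] b(2) by simp
      qed (use HW in blast)
    qed
  qed
  then show False using I(3) by blast
qed


context artin_algebra
begin

lemma left_module_self: "left_module R A"
  by (intro left_module.intro left_module_axioms.intro R.ring_axioms A.abelian_group_axioms)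
     (auto simp: smult_l_distr smult_r_distr smult_assoc1)

lemma submodule_regular_imp_submodule:
  assumes "submodule I A (regular A)" shows "submodule I R A"
proof -
  interpret reg: left_module A "regular A" by (rule left_module_regular) (rule A.ring_axioms)
  interpret self: left_module R A by (rule left_module_self)
  have "r \<odot>\<^bsub>A\<^esub> x \<in> I" if "r \<in> carrier R" "x \<in> I" for r x
  proof -
    have x: "x \<in> carrier A" using assms that by (auto simp: reg.submodule_iff)
    then have "r \<odot>\<^bsub>A\<^esub> x = (r \<odot>\<^bsub>A\<^esub> \<one>\<^bsub>A\<^esub>) \<otimes>\<^bsub>A\<^esub> x"
      using that by (simp add: smult_mult_left)
    then show ?thesis
      using assms that smult_closed[OF that(1) A.one_closed] by (auto simp: reg.submodule_iff)
  qed
  then show ?thesis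
    using assms by (auto simp: self.submodule_iff reg.submodule_iff)
qed

text \<open>As a finitely generated module over \<open>R\<close>, \<open>A\<close> satisfies both
  chain conditions, and left ideals are \<open>R\<close>-submodules because \<open>R\<close> acts
  through multiples of the unit.\<close>

lemma finite_length_regular:
  "noetherian_sub A (regular A) (carrier A)" "artinian_sub A (regular A) (carrier A)"
proof -
  note fl = fin_gen_finite_length[OF left_module_self finitely_generated
    R.noetherian_sub_regular R.artinian_sub_regular]
  have "fg_sub A (regular A) U" if U: "submodule U A (regular A)" "U \<subseteq> carrier A" for U
  proof -
    have "fg_sub R A U"
      using fl(1) submodule_regular_imp_submodule[OF U(1)] U(2) by (simp add: noetherian_sub_def)
    then obtain S where S: "finite S" "S \<subseteq> U" "\<And>W. submodule W R A \<Longrightarrow> S \<subseteq> W \<Longrightarrow> U \<subseteq> W"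
      by (rule fg_subE) iprover
    then show ?thesis
      by (intro fg_subI[of S]) (simp_all add: submodule_regular_imp_submodule)
  qed
  then show "noetherian_sub A (regular A) (carrier A)" by (simp add: noetherian_sub_def)
  show "artinian_sub A (regular A) (carrier A)"
    using fl(2) submodule_regular_imp_submodule unfolding artinian_sub_def by meson
qed

text \<open>Finite generation over \<open>R\<close> involves only the addition and the
  \<open>R\<close>-action, which \<open>A\<close> and its opposite share. This supplies the chain
  conditions for right modules, where the transpose lives.\<close>

lemma artin_algebra_opposite: "artin_algebra R (opposite A)"
proof -
  have *: "ring.add (opposite A) = ring.add A" "smult (opposite A) = smult A"
    by (simp_all add: opposite_def)
  have sub: "submodule N R (opposite A) \<longleftrightarrow> submodule N R A" for N
    unfolding submodule_def submodule_axioms_def subgroup_def a_inv_def m_inv_def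
    by (simp add: opposite_def)
  have "module R (opposite A)"
    using ring.is_abelian_group[OF ring_opposite[OF A.ring_axioms]] R.cring_axioms
    by (intro moduleI) (auto simp: * smult_l_distr smult_r_distr smult_assoc1)
  moreover have "fin_gen R (opposite A)"
    using finitely_generated by (simp add: fin_gen_def sub)
  ultimately show ?thesis
    using R.artinian_cring_axioms ring_opposite[OF A.ring_axioms]
    by (intro artin_algebra.intro artin_algebra_axioms.intro)
       (auto simp: * smult_mult_left smult_mult_right)
qed

end

section \<open>Existence of resolutions and minimal presentations\<close>

text \<open>\<open>Ext\<close> and \<open>transpose_module\<close> choose among modules in
  \<open>'a univ\<close>, so the free cover is copied there by means of singletons.\<close>

lemma free_cover_univ:
  fixes X :: "('a, 'x) module"
  assumes "left_module A X" "fin_gen A X"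
  obtains P :: "('a, 'a univ) module" and n b c f
  where "dual_basis A P n b c" "f \<in> lmod_hom A P X" "f ` carrier P = carrier X"
proof -
  have A: "ring A" by (rule left_module_ring[OF assms(1)])
  obtain n \<pi> where \<pi>: "lin_map A (free_module A n) X \<pi>" "\<pi> ` carrier (free_module A n) = carrier X"
    using fin_gen_free_cover[OF assms] by metis
  let ?F = "free_module A n"
  let ?s = "\<lambda>v::nat \<Rightarrow> 'a. {v}"
  let ?i = "inv_into (carrier ?F) ?s"
  let ?P = "copy_module ?s ?F"
  have F: "left_module A ?F" by (rule left_module_free[OF A])
  have s: "inj_on ?s (carrier ?F)" by simp
  have i: "?i {v} = v" if "v \<in> carrier ?F" for v
    using inv_into_f_f[OF s that] .
  note cF = copy_module[OF F s]
  have "dual_basis A ?P n (\<lambda>k. ?s (unit_vector A n k)) (\<lambda>k x. ?i x k)"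
    using i by (intro dual_basis_retract[OF dual_basis_free[OF A] cF(1,2,3)]) (auto simp: cF(4))
  moreover have "restrict (\<lambda>x. \<pi> (?i x)) (carrier ?P) \<in> lmod_hom A ?P X"
    by (intro restrict_lmod_hom cF lin_map_comp[OF cF(3) \<pi>(1)])
  moreover have "restrict (\<lambda>x. \<pi> (?i x)) (carrier ?P) ` carrier ?P = carrier X"
    by (simp add: cF(4) image_image \<pi>(2)[symmetric] i cong: image_cong_simp)
  ultimately show thesis by (rule that)
qed

text \<open>The terms are finitely generated over a noetherian ring, so each kernel is finitely
  generated and the next term can cover it.\<close>

lemma projective_resolution_exists:
  fixes X :: "('a, 'x) module"
  assumes "left_module A X" "fin_gen A X" "noetherian_sub A (regular A) (carrier A)"
    "artinian_sub A (regular A) (carrier A)"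
  shows "\<exists>(P :: nat \<Rightarrow> ('a, 'a univ) module) d e. projective_resolution A X P d e"
proof -
  obtain P0 :: "('a, 'a univ) module" and n0 b0 c0 e where
    P0: "dual_basis A P0 n0 b0 c0" and e: "e \<in> lmod_hom A P0 X" "e ` carrier P0 = carrier X"
    by (rule free_cover_univ[OF assms(1,2)])
  \<comment> \<open>A state holds the current term, the submodule of it to be covered next, and the
    differential leaving it. The initial state carries \<open>undefined\<close>, as the augmentation
    ends in another type and \<open>d 0\<close> is irrelevant.\<close>
  define good :: "('a, 'a univ) module \<times> 'a univ set \<times> ('a univ \<Rightarrow> 'a univ) \<Rightarrow> bool" where
    "good = (\<lambda>(P, K, d). fin_gen A P \<and> projective A P \<and> submodule K A P)"
  define rel :: "('a, 'a univ) module \<times> 'a univ set \<times> ('a univ \<Rightarrow> 'a univ)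
      \<Rightarrow> ('a, 'a univ) module \<times> 'a univ set \<times> ('a univ \<Rightarrow> 'a univ) \<Rightarrow> bool" where
    "rel = (\<lambda>(P, K, d) (P', K', d'). d' \<in> lmod_hom A P' P \<and> d' ` carrier P' = K \<and>
        K' = a_kernel P' P d')"
  let ?s = "(P0, a_kernel P0 X e, undefined)"
  have "\<exists>f. \<forall>n::nat. (good (f n) \<and> (n = 0 \<longrightarrow> f n = ?s)) \<and> rel (f n) (f (Suc n))"
  proof (rule dependent_nat_choice)
    have "good ?s"
      using P0 dual_basis_fin_gen dual_basis_projective
        submodule_kernel[OF dual_basisD(1)[OF P0] assms(1) lmod_hom_lin[OF e(1)]]
      by (auto simp: good_def)
    then show "\<exists>x. good x \<and> ((0::nat) = 0 \<longrightarrow> x = ?s)" by blast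
    fix x and n :: nat assume "good x \<and> (n = 0 \<longrightarrow> x = ?s)"
    then obtain P K d where x: "x = (P, K, d)" and P: "fin_gen A P" "projective A P"
      and K: "submodule K A P"
      by (cases x) (auto simp: good_def)
    have lP: "left_module A P" using P by (simp add: projective_def)
    have "fin_gen A (P\<lparr>carrier := K\<rparr>)"
      using fin_gen_finite_length(1)[OF lP P(1) assms(3,4)] K submodule_subset[OF K]
      by (simp add: fin_gen_submodule_iff[OF lP K] noetherian_sub_def)
    then obtain P' :: "('a, 'a univ) module" and n' b' c' f where
      P': "dual_basis A P' n' b' c'" and f: "f \<in> lmod_hom A P' (P\<lparr>carrier := K\<rparr>)"
        "f ` carrier P' = carrier (P\<lparr>carrier := K\<rparr>)"
      by (rule free_cover_univ[OF left_module_submodule[OF lP K]])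
    have f': "f \<in> lmod_hom A P' P"
      using f(1) submodule_subset[OF K] by (auto simp: lmod_hom_iff intro: lin_map_from_submodule)
    have "good (P', a_kernel P' P f, f)"
      using P' dual_basis_fin_gen dual_basis_projective
        submodule_kernel[OF dual_basisD(1)[OF P'] lP lmod_hom_lin[OF f']]
      by (auto simp: good_def)
    moreover have "rel x (P', a_kernel P' P f, f)"
      using f(2) f' by (simp add: rel_def x)
    ultimately show "\<exists>y. (good y \<and> (Suc n = 0 \<longrightarrow> y = ?s)) \<and> rel x y" by blast
  qed
  then obtain f where f: "\<And>n::nat. good (f n)" "f 0 = ?s" "\<And>n. rel (f n) (f (Suc n))"
    by blast
  define P K d where "P n = fst (f n)" and "K n = fst (snd (f n))" and "d n = snd (snd (f n))" for n
  have fn: "f n = (P n, K n, d n)" for n by (simp add: P_def K_def d_def)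
  have P0eq: "P 0 = P0" "K 0 = a_kernel P0 X e" using f(2) by (simp_all add: fn)
  have "fin_gen A (P i) \<and> projective A (P i)" for i
    using f(1)[of i] by (simp add: fn good_def)
  moreover have d: "d (Suc i) \<in> lmod_hom A (P (Suc i)) (P i)" "d (Suc i) ` carrier (P (Suc i)) = K i"
    "K (Suc i) = a_kernel (P (Suc i)) (P i) (d (Suc i))" for i
    using f(3)[of i] by (simp_all add: fn rel_def)
  ultimately have "projective_resolution A X P d e"
    unfolding projective_resolution_def
    using e d(2)[of 0] by (auto simp: P0eq d(2) d(3))
  then show ?thesis by blast
qed

text \<open>The choice made inside \<open>Ext\<close> depends on the ring and the first module only.
  Naming it lets one resolution serve all degrees and all coefficient modules.\<close>

definition chosen_resolution :: "('a, 'c) ring_scheme \<Rightarrow> ('a, 'x) module \<Rightarrow>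
    (nat \<Rightarrow> ('a, 'a univ) module) \<times> (nat \<Rightarrow> 'a univ \<Rightarrow> 'a univ) \<times> ('a univ \<Rightarrow> 'x)" where
  "chosen_resolution A X = (SOME (P :: nat \<Rightarrow> ('a, 'a univ) module, d, e).
                         projective_resolution A X P d e)"

lemma Ext_chosen_resolution:
  assumes "chosen_resolution A X = (P, d, e)"
  shows "Ext A i X Y = hom_cohomology A P d Y i"
  using assms unfolding Ext_def chosen_resolution_def by simp

lemma chosen_resolution:
  fixes X :: "('a, 'x) module"
  assumes "left_module A X" "fin_gen A X" "noetherian_sub A (regular A) (carrier A)"
    "artinian_sub A (regular A) (carrier A)"
  obtains P d e where "chosen_resolution A X = (P, d, e)" "projective_resolution A X P d e"
proof -
  obtain P d e where c: "chosen_resolution A X = (P, d, e)"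
    by (cases "chosen_resolution A X")
  obtain Q :: "nat \<Rightarrow> ('a, 'a univ) module" and d' e' where "projective_resolution A X Q d' e'"
    using projective_resolution_exists[OF assms] by blast
  then have "case (Q, d', e') of (P, d, e) \<Rightarrow> projective_resolution A X P d e"
    by simp
  from someI[of "\<lambda>(P, d, e). projective_resolution A X P d e", OF this]
  have "projective_resolution A X P d e"
    using c unfolding chosen_resolution_def by simp
  then show thesis using that c by blast
qed

text \<open>Fitting's lemma. For large m the images and the kernels of the powers of
  \<open>h\<close> are stationary, so g = h^m is bijective on its image, and \<rho> is the
  projection onto this image along the kernel of g.\<close>

lemma fitting_retraction:
  assumes "left_module A P" "noetherian_sub A P (carrier P)" "artinian_sub A P (carrier P)"
    and h: "lin_map A P P h"
  obtains n \<rho> where "lin_map A P P \<rho>" "\<And>x. x \<in> carrier P \<Longrightarrow> \<rho> x \<in> (h ^^ Suc n) ` carrier P"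
    "\<And>x. x \<in> (h ^^ Suc n) ` carrier P \<Longrightarrow> \<rho> x = x"
proof -
  interpret P: left_module A P by fact
  let ?C = "carrier P"
  have hn: "lin_map A P P (h ^^ n)" for n
  proof (induction n)
    case (Suc n)
    then show ?case using lin_map_comp[OF Suc h] by (simp add: comp_def)
  qed (simp add: lin_map_id id_def)
  have cl: "(h ^^ n) x \<in> ?C" if "x \<in> ?C" for n x
    using lin_map_closed[OF hn that] .
  let ?V = "\<lambda>n. (h ^^ n) ` ?C"
  have V: "submodule (?V n) A P" for n
    by (rule submodule_image[OF assms(1,1) hn P.submodule_carrier])
  have "?V (Suc n) \<subseteq> ?V n" for n
    using lin_map_closed[OF h] by (auto simp: funpow_swap1)
  then have "\<forall>i. submodule (?V i) A P \<and> ?V i \<subseteq> ?C \<and> ?V (Suc i) \<subseteq> ?V i"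
    using V submodule_subset[OF V] by blast
  then obtain i1 where i1: "\<And>j. j \<ge> i1 \<Longrightarrow> ?V j = ?V i1"
    using assms(3)[unfolded artinian_sub_def, rule_format, of ?V] by blast
  let ?K = "\<lambda>n. a_kernel P P (h ^^ n)"
  have K: "submodule (?K n) A P" for n
    by (rule submodule_kernel[OF assms(1,1) hn])
  have Ks: "?K n \<subseteq> ?K (Suc n)" for n
    using lin_map_zero[OF assms(1,1) h] by (auto simp: a_kernel_def')
  have Kmono: "?K i \<subseteq> ?K j" if "i \<le> j" for i j
    using lift_Suc_mono_le[of ?K, OF Ks that] .
  have "submodule (\<Union>(range ?K)) A P"
  proof (rule submodule_Union_chain[OF assms(1)])
    fix U W assume "U \<in> range ?K" "W \<in> range ?K"
    then obtain i j where "U = ?K i" "W = ?K j" by blast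
    then show "U \<subseteq> W \<or> W \<subseteq> U" using Kmono[of i j] Kmono[of j i] by (simp add: linear) linarith
  qed (use K in auto)
  then have "fg_sub A P (\<Union>(range ?K))"
    using assms(2) submodule_subset unfolding noetherian_sub_def by blast
  then obtain i2 where i2: "\<And>j. ?K j \<subseteq> ?K i2"
    by (rule fg_sub_of_Union_chain[where U = ?K, OF assms(1) K Ks]) iprover
  \<comment> \<open>The successor keeps the exponent positive, so that the image of the power lies
    in that of \<open>h\<close>.\<close>
  define m where "m = Suc (max i1 i2)"
  define g where "g = h ^^ m"
  have g: "lin_map A P P g" unfolding g_def by (rule hn)
  have gg: "g (g x) = (h ^^ (m + m)) x" for x
    by (simp add: g_def funpow_add)
  have gV: "g ` ?C = g ` (g ` ?C)"
  proof -
    have "g ` (g ` ?C) = ?V (m + m)" by (simp add: image_image gg)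
    also have "\<dots> = ?V m" using i1[of m] i1[of "m + m"] by (simp add: m_def)
    finally show ?thesis by (simp add: g_def)
  qed
  have gK: "g x = \<zero>\<^bsub>P\<^esub>" if "x \<in> ?C" "g (g x) = \<zero>\<^bsub>P\<^esub>" for x
  proof -
    have "x \<in> ?K (m + m)" using that by (simp add: a_kernel_def' gg)
    then have "x \<in> ?K i2" using i2 by blast
    moreover have "i2 \<le> m" by (simp add: m_def)
    ultimately have "x \<in> ?K m" using Kmono by blast
    then show ?thesis by (simp add: g_def a_kernel_def')
  qed
  have gc: "g x \<in> ?C" if "x \<in> ?C" for x using lin_map_closed[OF g that] .
  have uniq: "y = y'" if yy: "y \<in> g ` ?C" "y' \<in> g ` ?C" "g y = g y'" for y y'
  proof -
    obtain u u' where u: "u \<in> ?C" "u' \<in> ?C" "y = g u" "y' = g u'" using yy by blast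
    have "g (g (u \<ominus>\<^bsub>P\<^esub> u')) = \<zero>\<^bsub>P\<^esub>"
      using u yy(3) gc by (simp add: lin_map_minus[OF assms(1,1) g] P.M.minus_eq_zero_iff)
    then have "g (u \<ominus>\<^bsub>P\<^esub> u') = \<zero>\<^bsub>P\<^esub>" by (rule gK[OF P.M.minus_closed[OF u(1,2)]])
    then show ?thesis
      using u gc by (simp add: lin_map_minus[OF assms(1,1) g] P.M.minus_eq_zero_iff)
  qed
  \<comment> \<open>\<open>g\<close> maps its image bijectively onto itself, so exactly one y there
    satisfies g y = g x. Linearity of \<rho> follows from this uniqueness.\<close>
  define \<rho> where "\<rho> = (\<lambda>x. SOME y. y \<in> g ` ?C \<and> g y = g x)"
  have \<rho>: "\<rho> x \<in> g ` ?C \<and> g (\<rho> x) = g x" if x: "x \<in> ?C" for x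
  proof -
    have "g x \<in> g ` (g ` ?C)" using x gV by blast
    then have "\<exists>y. y \<in> g ` ?C \<and> g y = g x" by auto
    then show ?thesis unfolding \<rho>_def by (rule someI_ex)
  qed
  have gsub: "submodule (g ` ?C) A P" unfolding g_def by (rule V)
  have gadd: "\<forall>y\<in>g ` ?C. \<forall>z\<in>g ` ?C. y \<oplus>\<^bsub>P\<^esub> z \<in> g ` ?C"
    and gsmult: "\<forall>a\<in>carrier A. \<forall>y\<in>g ` ?C. a \<odot>\<^bsub>P\<^esub> y \<in> g ` ?C"
    using gsub[unfolded P.submodule_iff, THEN conjunct2, THEN conjunct2] by (rule conjunct1, rule conjunct2)
  have \<rho>c: "\<rho> x \<in> ?C" if "x \<in> ?C" for x
    using \<rho>[OF that] submodule_subset[OF gsub] by blast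
  have "lin_map A P P \<rho>"
  proof (rule lin_mapI)
    fix x assume x: "x \<in> ?C"
    show "\<rho> x \<in> ?C" by (rule \<rho>c[OF x])
    {
      fix y assume y: "y \<in> ?C"
      show "\<rho> (x \<oplus>\<^bsub>P\<^esub> y) = \<rho> x \<oplus>\<^bsub>P\<^esub> \<rho> y"
        using \<rho>[OF x] \<rho>[OF y] \<rho>[of "x \<oplus>\<^bsub>P\<^esub> y"] x y
        by - (rule uniq; simp add: gadd[rule_format] lin_map_add[OF g] \<rho>c)
    }
    {
      fix a assume a: "a \<in> carrier A"
      show "\<rho> (a \<odot>\<^bsub>P\<^esub> x) = a \<odot>\<^bsub>P\<^esub> \<rho> x"
        using \<rho>[OF x] \<rho>[of "a \<odot>\<^bsub>P\<^esub> x"] x a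
        by - (rule uniq; simp add: gsmult[rule_format] lin_map_smult[OF g] \<rho>c P.lsmult_closed)
    }
  qed
  moreover have "\<rho> x = x" if "x \<in> g ` ?C" for x
  proof -
    have "x \<in> ?C" using that submodule_subset[OF gsub] by blast
    then show ?thesis using \<rho> that by - (rule uniq; auto)
  qed
  ultimately show thesis
    using that[of \<rho> "max i1 i2"] \<rho> unfolding g_def m_def by blast
qed

text \<open>Among the direct summands of a free cover that still map onto \<open>X\<close>, a
  minimal one is a projective cover: a proper submodule of it with full image would, by Fitting's
  lemma, contain a smaller such summand.\<close>

lemma projective_cover_exists:
  fixes X :: "('a, 'x) module"
  assumes "left_module A X" "fin_gen A X" "noetherian_sub A (regular A) (carrier A)"
    "artinian_sub A (regular A) (carrier A)"
  shows "\<exists>(P :: ('a, 'a univ) module) f. projective_cover A X P f"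
proof -
  obtain F :: "('a, 'a univ) module" and n b c e where
    F: "dual_basis A F n b c" and e: "e \<in> lmod_hom A F X" "e ` carrier F = carrier X"
    by (rule free_cover_univ[OF assms(1,2)])
  have lF: "left_module A F" by (rule dual_basisD[OF F])
  interpret F: left_module A F by (rule lF)
  interpret X: left_module A X by fact
  have le: "lin_map A F X e" using e(1) by (rule lmod_hom_lin)
  note flF = fin_gen_finite_length[OF lF dual_basis_fin_gen[OF F] assms(3,4)]
  \<comment> \<open>A summand is recorded by an idempotent endomorphism of \<open>F\<close> with
    image \<open>U\<close>; no complement has to be named.\<close>
  define summand where "summand U \<longleftrightarrow> e ` U = carrier X \<and> (\<exists>r. lin_map A F F r \<and>
      (\<forall>x\<in>carrier F. r x \<in> U) \<and> (\<forall>x\<in>U. r x = x))" for U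
  have sF: "summand (carrier F)"
    unfolding summand_def using e by (auto intro!: exI[of _ "\<lambda>x. x"] lin_map_id)
  obtain U where U: "submodule U A F" "U \<subseteq> carrier F" "summand U"
    and min: "\<And>V. submodule V A F \<Longrightarrow> V \<subset> U \<Longrightarrow> \<not> summand V"
    by (rule artinian_sub_minimal[OF flF(2) F.submodule_carrier order_refl,
        where Q = summand, OF sF]) iprover
  have eU: "e ` U = carrier X" using U(3) by (simp add: summand_def)
  have "\<exists>r. lin_map A F F r \<and> (\<forall>x\<in>carrier F. r x \<in> U) \<and> (\<forall>x\<in>U. r x = x)"
    using U(3) by (simp add: summand_def)
  then obtain r where "lin_map A F F r \<and> (\<forall>x\<in>carrier F. r x \<in> U) \<and> (\<forall>x\<in>U. r x = x)" ..
  then have r: "lin_map A F F r" "\<And>x. x \<in> carrier F \<Longrightarrow> r x \<in> U" "\<And>x. x \<in> U \<Longrightarrow> r x = x"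
    by simp_all
  let ?P = "F\<lparr>carrier := U\<rparr>"
  have lP: "left_module A ?P" by (rule left_module_submodule[OF lF U(1)])
  interpret P: left_module A ?P by (rule lP)
  have P: "dual_basis A ?P n (\<lambda>k. r (b k)) (\<lambda>k x. c k x)"
    using r by (intro dual_basis_retract[OF F lP] lin_map_subcodomain lin_map_subdomain[OF lin_map_id] U) auto
  have leP: "lin_map A ?P X e" using lin_map_subdomain[OF le U(2)] .
  have "superfluous A ?P (a_kernel ?P X e)"
    unfolding superfluous_def
  proof (intro conjI allI impI)
    show "submodule (a_kernel ?P X e) A ?P"
      by (rule submodule_kernel[OF lP assms(1) leP])
    fix N assume "submodule N A ?P \<and> a_kernel ?P X e <+>\<^bsub>?P\<^esub> N = carrier ?P"
    then have N: "submodule N A ?P" "a_kernel ?P X e <+>\<^bsub>?P\<^esub> N = carrier ?P"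
      by simp_all
    have NF: "submodule N A F" "N \<subseteq> U"
      using N(1) by (auto simp: submodule_of_submodule[OF lF U(1)])
    have eN: "e x \<in> e ` N" if x: "x \<in> U" for x
    proof -
      have "x \<in> a_kernel ?P X e <+>\<^bsub>?P\<^esub> N" using x N(2) by simp
      then obtain k m where km: "k \<in> a_kernel ?P X e" "m \<in> N" "x = k \<oplus>\<^bsub>F\<^esub> m"
        by (auto simp: set_add_def')
      then have "e x = e m"
        using U(2) NF(2) lin_map_closed[OF le, of m]
        by (auto simp: a_kernel_def' lin_map_add[OF le] subset_iff)
      then show ?thesis using km by blast
    qed
    have lN: "left_module A (F\<lparr>carrier := N\<rparr>)" by (rule left_module_submodule[OF lF NF(1)])
    have NC: "N \<subseteq> carrier F" using NF U by blast
    \<comment> \<open>Since \<open>N\<close> also maps onto \<open>X\<close>, projectivity gives an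
      endomorphism of the summand with values in \<open>N\<close> that commutes with the map to
      \<open>X\<close>.\<close>
    obtain h where h: "lin_map A ?P (F\<lparr>carrier := N\<rparr>) h" "\<And>x. x \<in> carrier ?P \<Longrightarrow> e (h x) = e x"
      by (rule dual_basis_lift[OF P lN assms(1) lin_map_subdomain[OF le NC] leP])
        (use eN in auto)
    have hN: "h x \<in> N" if "x \<in> U" for x
      using lin_map_closed[OF h(1)] that by simp
    have hP: "lin_map A ?P ?P h"
      using h(1) NF(2) by (auto simp: lin_map_def Pi_def subset_iff)
    note flP = fin_gen_finite_length[OF lP dual_basis_fin_gen[OF P] assms(3,4)]
    obtain m \<rho> where \<rho>: "lin_map A ?P ?P \<rho>"
      "\<And>x. x \<in> carrier ?P \<Longrightarrow> \<rho> x \<in> (h ^^ Suc m) ` carrier ?P"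
      "\<And>x. x \<in> (h ^^ Suc m) ` carrier ?P \<Longrightarrow> \<rho> x = x"
      by (rule fitting_retraction[OF lP flP hP]) iprover
    have hm: "(h ^^ j) x \<in> U \<and> e ((h ^^ j) x) = e x" if "x \<in> U" for j x
      using that h(2) hN NF(2) by (induction j) auto
    \<comment> \<open>By Fitting's lemma this image is a summand. It lies in \<open>N\<close> and
      still maps onto \<open>X\<close>, because e h = e; minimality of \<open>U\<close> then forces
      N = U.\<close>
    let ?V = "(h ^^ Suc m) ` U"
    have VN: "?V \<subseteq> N" using hm hN by auto
    have "summand ?V"
      unfolding summand_def
    proof (intro conjI exI[of _ "\<lambda>x. \<rho> (r x)"] ballI)
      show "e ` ?V = carrier X"
        unfolding image_image using hm eU by (simp cong: image_cong_simp del: funpow.simps)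
      have "lin_map A F ?P r" using r by (intro lin_map_subcodomain) auto
      from lin_map_comp[OF this \<rho>(1)] show "lin_map A F F (\<lambda>x. \<rho> (r x))"
        by (rule lin_map_from_submodule) (rule U)
      show "\<rho> (r x) \<in> ?V" if "x \<in> carrier F" for x
        using \<rho>(2)[of "r x"] r(2)[OF that] by simp
      show "\<rho> (r x) = x" if "x \<in> ?V" for x
      proof -
        have "r x = x" using that VN NF(2) by (intro r(3)) blast
        then show ?thesis using \<rho>(3)[of x] that by simp
      qed
    qed
    moreover have "submodule ?V A F"
    proof -
      have "submodule ?V A ?P"
      proof -
        have "lin_map A ?P ?P (h ^^ j)" for j
        proof (induction j)
          case (Suc j)
          then show ?case using lin_map_comp[OF Suc hP] by (simp add: comp_def)
        qed (simp add: lin_map_id id_def)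
        from submodule_image[OF lP lP this[of "Suc m"] P.submodule_carrier] show ?thesis by simp
      qed
      then show ?thesis by (simp add: submodule_of_submodule[OF lF U(1)])
    qed
    ultimately have "\<not> ?V \<subset> U" using min by blast
    then show "N = carrier ?P" using VN NF(2) by auto
  qed
  then have "projective_cover A X ?P (restrict e U)"
    unfolding projective_cover_def
    using P dual_basis_fin_gen dual_basis_projective restrict_lmod_hom[OF lP leP] eU
    by (auto simp: a_kernel_def' cong: conj_cong)
  then show ?thesis by blast
qed

lemma minimal_presentation_exists:
  fixes X :: "('a, 'x) module"
  assumes "left_module A X" "fin_gen A X" "noetherian_sub A (regular A) (carrier A)"
    "artinian_sub A (regular A) (carrier A)"
  shows "\<exists>(P1 :: ('a, 'a univ) module) P0 d e. minimal_presentation A X P1 P0 d e"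
proof -
  obtain P0 :: "('a, 'a univ) module" and e where P0: "projective_cover A X P0 e"
    using projective_cover_exists[OF assms] by blast
  then have l: "left_module A P0" "fin_gen A P0" and e: "lin_map A P0 X e"
    by (auto simp: projective_cover_def projective_def lmod_hom_lin)
  have K: "submodule (a_kernel P0 X e) A P0"
    by (rule submodule_kernel[OF l(1) assms(1) e])
  have "fin_gen A (P0\<lparr>carrier := a_kernel P0 X e\<rparr>)"
    using fin_gen_finite_length(1)[OF l assms(3,4)] K submodule_subset[OF K]
    by (simp add: fin_gen_submodule_iff[OF l(1) K] noetherian_sub_def)
  then obtain P1 :: "('a, 'a univ) module" and d where
    "projective_cover A (P0\<lparr>carrier := a_kernel P0 X e\<rparr>) P1 d"
    using projective_cover_exists[OF left_module_submodule[OF l(1) K] _ assms(3,4)] by blast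
  then show ?thesis using P0 unfolding minimal_presentation_def by blast
qed

lemma transpose_module_presentation:
  fixes M :: "('a, 'm) module"
  assumes "left_module A M" "fin_gen A M" "noetherian_sub A (regular A) (carrier A)"
    "artinian_sub A (regular A) (carrier A)"
  obtains P1 P0 :: "('a, 'a univ) module" and d e where "minimal_presentation A M P1 P0 d e"
    "transpose_module A M = quotient_module (star A P1)
           ((\<lambda>f. compose (carrier P1) f d) ` carrier (star A P0))"
proof -
  let ?c = "SOME (P1 :: ('a, 'a univ) module, P0, d, e). minimal_presentation A M P1 P0 d e"
  obtain P1 P0 :: "('a, 'a univ) module" and d e where c: "?c = (P1, P0, d, e)"
    by (cases ?c)
  obtain Q1 Q0 :: "('a, 'a univ) module" and d' e' where "minimal_presentation A M Q1 Q0 d' e'"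
    using minimal_presentation_exists[OF assms] by blast
  then have "case (Q1, Q0, d', e') of (P1, P0, d, e) \<Rightarrow> minimal_presentation A M P1 P0 d e"
    by simp
  from someI[of "\<lambda>(P1 :: ('a, 'a univ) module, P0, d, e). minimal_presentation A M P1 P0 d e", OF this]
  have "minimal_presentation A M P1 P0 d e"
    using c by simp
  then show thesis
    using that c by (simp add: transpose_module_def)
qed

section \<open>Dual modules, quotients and cohomology\<close>

lemma hom_add_facts:
  assumes "left_module A M" "left_module A N"
  shows hom_add_closed: "f \<in> lmod_hom A M N \<Longrightarrow> g \<in> lmod_hom A M N \<Longrightarrow> hom_add M N f g \<in> lmod_hom A M N"
    and hom_zero_closed: "hom_zero M N \<in> lmod_hom A M N"
    and hom_neg_closed: "f \<in> lmod_hom A M N \<Longrightarrow> (\<lambda>x\<in>carrier M. \<ominus>\<^bsub>N\<^esub> f x) \<in> lmod_hom A M N"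
    and hom_add_assoc: "f \<in> lmod_hom A M N \<Longrightarrow> g \<in> lmod_hom A M N \<Longrightarrow> k \<in> lmod_hom A M N \<Longrightarrow>
      hom_add M N (hom_add M N f g) k = hom_add M N f (hom_add M N g k)"
    and hom_add_comm: "f \<in> lmod_hom A M N \<Longrightarrow> g \<in> lmod_hom A M N \<Longrightarrow>
      hom_add M N f g = hom_add M N g f"
    and hom_add_zero: "f \<in> lmod_hom A M N \<Longrightarrow> hom_add M N (hom_zero M N) f = f"
    and hom_add_neg: "f \<in> lmod_hom A M N \<Longrightarrow>
      hom_add M N (\<lambda>x\<in>carrier M. \<ominus>\<^bsub>N\<^esub> f x) f = hom_zero M N"
proof -
  interpret M: left_module A M by fact
  interpret N: left_module A N by fact
  have c: "f x \<in> carrier N" if "f \<in> lmod_hom A M N" "x \<in> carrier M" for f x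
    using lin_map_closed[OF lmod_hom_lin[OF that(1)] that(2)] .
  show add: "hom_add M N f g \<in> lmod_hom A M N" if "f \<in> lmod_hom A M N" "g \<in> lmod_hom A M N" for f g
    unfolding hom_add_def using that
    by (intro restrict_lmod_hom lin_map_sum assms) (auto dest: lmod_hom_lin)
  show zero: "hom_zero M N \<in> lmod_hom A M N"
    unfolding hom_zero_def by (intro restrict_lmod_hom lin_map_const_zero assms)
  show neg: "(\<lambda>x\<in>carrier M. \<ominus>\<^bsub>N\<^esub> f x) \<in> lmod_hom A M N" if f: "f \<in> lmod_hom A M N" for f
  proof -
    have "lin_map A M N (\<lambda>x. \<zero>\<^bsub>N\<^esub> \<ominus>\<^bsub>N\<^esub> f x)"
      by (intro lin_map_diff lin_map_const_zero assms lmod_hom_lin[OF f])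
    then have "lin_map A M N (\<lambda>x. \<ominus>\<^bsub>N\<^esub> f x)"
      by (rule lin_map_congI[OF assms(1)]) (simp add: a_minus_def c[OF f])
    then show ?thesis by (rule restrict_lmod_hom[OF assms(1)])
  qed
  show "hom_add M N (hom_add M N f g) k = hom_add M N f (hom_add M N g k)"
    if "f \<in> lmod_hom A M N" "g \<in> lmod_hom A M N" "k \<in> lmod_hom A M N" for f g k
    using that by (intro lmod_hom_eqI[of _ A M N] add) (simp_all add: hom_add_def c N.M.a_assoc)
  show "hom_add M N f g = hom_add M N g f"
    if "f \<in> lmod_hom A M N" "g \<in> lmod_hom A M N" for f g
    using that by (intro lmod_hom_eqI[of _ A M N] add) (simp_all add: hom_add_def c N.M.a_comm)
  show "hom_add M N (hom_zero M N) f = f" if "f \<in> lmod_hom A M N" for f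
    using that by (intro lmod_hom_eqI[of _ A M N] add zero) (simp_all add: hom_add_def hom_zero_def c)
  show "hom_add M N (\<lambda>x\<in>carrier M. \<ominus>\<^bsub>N\<^esub> f x) f = hom_zero M N" if "f \<in> lmod_hom A M N" for f
    using that by (intro lmod_hom_eqI[of _ A M N] add zero neg)
      (simp_all add: hom_add_def hom_zero_def c N.M.l_neg)
qed

section \<open>The module of functionals\<close>

lemma star_simps:
  "carrier (star A P) = lmod_hom A P (regular A)" "\<zero>\<^bsub>star A P\<^esub> = hom_zero P (regular A)"
  "f \<oplus>\<^bsub>star A P\<^esub> g = hom_add P (regular A) f g"
  "a \<odot>\<^bsub>star A P\<^esub> f = (\<lambda>x\<in>carrier P. f x \<otimes>\<^bsub>A\<^esub> a)"
  by (simp_all add: star_def)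

lemma star_closed: "f \<in> carrier (star A P) \<Longrightarrow> x \<in> carrier P \<Longrightarrow> f x \<in> carrier A"
  using lin_map_closed[OF lmod_hom_lin, of f A P "regular A" x] by (simp add: star_simps)

lemma star_add_apply: "x \<in> carrier P \<Longrightarrow> (f \<oplus>\<^bsub>star A P\<^esub> g) x = f x \<oplus>\<^bsub>A\<^esub> g x"
  by (simp add: star_simps hom_add_def)

lemma star_smult_apply: "x \<in> carrier P \<Longrightarrow> (a \<odot>\<^bsub>star A P\<^esub> f) x = f x \<otimes>\<^bsub>A\<^esub> a"
  by (simp add: star_simps)

lemma star_zero_apply: "x \<in> carrier P \<Longrightarrow> \<zero>\<^bsub>star A P\<^esub> x = \<zero>\<^bsub>A\<^esub>"
  by (simp add: star_simps hom_zero_def)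

lemma star_eqI:
  assumes "f \<in> carrier (star A P)" "g \<in> carrier (star A P)" "\<And>x. x \<in> carrier P \<Longrightarrow> f x = g x"
  shows "f = g"
  using assms lmod_hom_eqI[of f A P "regular A" g] by (simp add: star_simps)

lemma star_restrict:
  assumes "left_module A P" "lin_map A P (regular A) f"
  shows "restrict f (carrier P) \<in> carrier (star A P)"
  using restrict_lmod_hom[OF assms] by (simp add: star_simps)

lemma left_module_star:
  assumes "left_module A P"
  shows "left_module (opposite A) (star A P)"
proof -
  interpret P: left_module A P by fact
  have reg: "left_module A (regular A)" by (rule left_module_regular[OF left_module_ring[OF assms]])
  note h = hom_add_facts[OF assms reg]
  have lin: "lin_map A P (regular A) f" if "f \<in> carrier (star A P)" for f
    using that by (simp add: star_simps lmod_hom_lin)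
  have smult: "a \<odot>\<^bsub>star A P\<^esub> f \<in> carrier (star A P)"
    if f: "f \<in> carrier (star A P)" and a: "a \<in> carrier A" for f a
  proof -
    have "lin_map A P (regular A) (\<lambda>x. f x \<otimes>\<^bsub>A\<^esub> a)"
      using a star_closed[OF f] lin_map_add[OF lin[OF f]] lin_map_smult[OF lin[OF f]]
      by (intro lin_mapI) (simp_all add: P.R.l_distr P.R.m_assoc)
    from restrict_lmod_hom[OF assms this] show ?thesis by (simp add: star_simps)
  qed
  have add: "f \<oplus>\<^bsub>star A P\<^esub> g \<in> carrier (star A P)"
    if "f \<in> carrier (star A P)" "g \<in> carrier (star A P)" for f g
    using that h(1) by (simp add: star_simps)
  show ?thesis
  proof (rule left_moduleI, goal_cases)
    case 1 show ?case by (rule ring_opposite[OF left_module_ring[OF assms]])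
  next
    case (2 x y) then show ?case by (rule add)
  next
    case 3 show ?case using h(2) by (simp add: star_simps)
  next
    case (4 x y z) then show ?case using h(4) by (simp add: star_simps)
  next
    case (5 x y) then show ?case using h(5) by (simp add: star_simps)
  next
    case (6 x) then show ?case using h(6) by (simp add: star_simps)
  next
    case (7 x) then show ?case using h(3,7) by (auto simp: star_simps)
  next
    case (8 a x) then show ?case by (intro smult) simp_all
  next
    case (9 a b x) then show ?case
      by (intro star_eqI[of _ A P] add smult)
         (simp_all add: star_add_apply star_smult_apply star_closed P.R.r_distr)
  next
    case (10 a x y) then show ?case
      by (intro star_eqI[of _ A P] add smult)
         (simp_all add: star_add_apply star_smult_apply star_closed P.R.l_distr)
  next
    case (11 a b x) then show ?case
      by (intro star_eqI[of _ A P] smult)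
         (simp_all add: star_smult_apply star_closed P.R.m_assoc)
  next
    case (12 x) then show ?case
      by (intro star_eqI[of _ A P] smult) (simp_all add: star_smult_apply star_closed)
  qed
qed

lemma lin_map_evaluation:
  assumes "x \<in> carrier P"
  shows "lin_map (opposite A) (star A P) (regular (opposite A)) (\<lambda>f. f x)"
  using assms by (intro lin_mapI) (simp_all add: star_closed star_add_apply star_smult_apply)

text \<open>The two halves of a dual basis exchange roles: the coordinate functionals generate the
  dual, with evaluations at the old vectors as coordinates.\<close>

lemma dual_basis_star:
  assumes "dual_basis A P n b c"
  shows "dual_basis (opposite A) (star A P) n (\<lambda>k. restrict (c k) (carrier P)) (\<lambda>k f. f (b k))"
proof -
  note db = dual_basisD[OF assms]
  interpret P: left_module A P by (rule db)
  have S: "left_module (opposite A) (star A P)" by (rule left_module_star[OF db(1)])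
  interpret S: left_module "opposite A" "star A P" by (rule S)
  have A: "ring A" by (rule left_module_ring[OF db(1)])
  have cs: "restrict (c k) (carrier P) \<in> carrier (star A P)" if "k < n" for k
    by (rule star_restrict[OF db(1) db(3)[OF that]])
  let ?B = "regular (opposite A)"
  have B: "left_module (opposite A) ?B" by (rule left_module_regular[OF ring_opposite[OF A]])
  interpret B: left_module "opposite A" ?B by (rule B)
  interpret reg: left_module A "regular A" by (rule left_module_regular[OF A])
  \<comment> \<open>\<open>finsum\<close> depends on the additive structure alone, which the left
    and the right regular module share, so sums can be moved between them.\<close>
  have fs: "finsum ?B = finsum (regular A)"
    by (simp add: finsum_def regular_def opposite_def fun_eq_iff)
  have "(\<Oplus>\<^bsub>star A P\<^esub>k\<in>{..<n}. f (b k) \<odot>\<^bsub>star A P\<^esub> restrict (c k) (carrier P)) = f" (is "?g = f")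
    if f: "f \<in> carrier (star A P)" for f
  proof (rule star_eqI)
    have cl: "(\<lambda>k. f (b k) \<odot>\<^bsub>star A P\<^esub> restrict (c k) (carrier P)) \<in> {..<n} \<rightarrow> carrier (star A P)"
      using cs star_closed[OF f db(2)] by (auto intro!: S.lsmult_closed)
    show "?g \<in> carrier (star A P)" by (rule S.M.finsum_closed[OF cl])
    show "f \<in> carrier (star A P)" by (rule f)
    fix x assume x: "x \<in> carrier P"
    have "?g x = (\<Oplus>\<^bsub>?B\<^esub>k\<in>{..<n}. (f (b k) \<odot>\<^bsub>star A P\<^esub> restrict (c k) (carrier P)) x)"
      by (rule lin_map_finsum[OF S B lin_map_evaluation[OF x] _ cl]) simp
    also have "\<dots> = (\<Oplus>\<^bsub>regular A\<^esub>k\<in>{..<n}. c k x \<odot>\<^bsub>regular A\<^esub> f (b k))"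
      unfolding fs using x db star_closed[OF f db(2)]
      by (intro reg.M.finsum_cong') (auto simp: star_smult_apply)
    also have "\<dots> = f x"
      using f by (intro dual_basis_lin_map[OF assms reg.left_module_axioms _ x, symmetric])
        (simp add: star_simps lmod_hom_lin)
    finally show "?g x = f x" .
  qed
  then show ?thesis
    unfolding dual_basis_def
    by (intro conjI allI impI ballI S cs lin_map_evaluation db(2))
qed

text \<open>The coordinates determine an element, so \<open>P\<close> embeds into its bidual.
  Identities between elements of a projective module can thus be checked by applying
  functionals.\<close>

lemma dual_basis_separates:
  assumes "dual_basis A P n b c" "x \<in> carrier P" "y \<in> carrier P"
    and "\<And>f. f \<in> carrier (star A P) \<Longrightarrow> f x = f y"
  shows "x = y"
proof -
  note db = dual_basisD[OF assms(1)]
  interpret P: left_module A P by (rule db)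
  have "c k x = c k y" if "k < n" for k
    using assms(4)[OF star_restrict[OF db(1) db(3)[OF that]]] assms(2,3) by simp
  then have "(\<Oplus>\<^bsub>P\<^esub>k\<in>{..<n}. c k x \<odot>\<^bsub>P\<^esub> b k) = (\<Oplus>\<^bsub>P\<^esub>k\<in>{..<n}. c k y \<odot>\<^bsub>P\<^esub> b k)"
    using db assms(3) by (intro P.M.finsum_cong') (auto intro!: P.lsmult_closed)
  then show ?thesis using db(5) assms(2,3) by simp
qed


section \<open>Quotient modules\<close>

lemma left_module_surj:
  assumes "left_module A M" "q ` carrier M = carrier N" "q \<zero>\<^bsub>M\<^esub> = \<zero>\<^bsub>N\<^esub>"
    and "\<And>x y. x \<in> carrier M \<Longrightarrow> y \<in> carrier M \<Longrightarrow> q x \<oplus>\<^bsub>N\<^esub> q y = q (x \<oplus>\<^bsub>M\<^esub> y)"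
    and "\<And>a x. a \<in> carrier A \<Longrightarrow> x \<in> carrier M \<Longrightarrow> a \<odot>\<^bsub>N\<^esub> q x = q (a \<odot>\<^bsub>M\<^esub> x)"
  shows "left_module A N"
proof -
  interpret M: left_module A M by fact
  have neg: "\<exists>z\<in>carrier M. q (z \<oplus>\<^bsub>M\<^esub> x) = \<zero>\<^bsub>N\<^esub>" if "x \<in> carrier M" for x
    using that assms(3) by (intro bexI[of _ "\<ominus>\<^bsub>M\<^esub> x"]) (simp_all add: M.M.l_neg)
  show ?thesis
    using neg assms(4,5)
    by (intro left_moduleI left_module_ring[OF assms(1)])
       (auto simp: assms(2)[symmetric] assms(3)[symmetric] M.M.a_ac M.lsmult_closed
         M.lsmult_l_distr M.lsmult_r_distr M.lsmult_assoc M.lsmult_one)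
qed

lemma quotient_module:
  assumes "left_module A M" "submodule N A M"
  shows left_module_quotient: "left_module A (quotient_module M N)"
    and lin_map_quotient: "lin_map A M (quotient_module M N) (\<lambda>x. N +>\<^bsub>M\<^esub> x)"
    and surj_quotient: "(\<lambda>x. N +>\<^bsub>M\<^esub> x) ` carrier M = carrier (quotient_module M N)"
    and quotient_eq_zero_iff: "x \<in> carrier M \<Longrightarrow> N +>\<^bsub>M\<^esub> x = \<zero>\<^bsub>quotient_module M N\<^esub> \<longleftrightarrow> x \<in> N"
proof -
  interpret M: left_module A M by fact
  have Ng: "subgroup N (add_monoid M)" using assms(2) by (simp add: submodule_def)
  interpret N: abelian_subgroup N M
    by (intro abelian_subgroupI3 additive_subgroupI Ng M.M.abelian_group_axioms)
  have NM: "N \<subseteq> carrier M" and Nz: "\<zero>\<^bsub>M\<^esub> \<in> N"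
    and Ns: "\<And>a x. a \<in> carrier A \<Longrightarrow> x \<in> N \<Longrightarrow> a \<odot>\<^bsub>M\<^esub> x \<in> N"
    using assms(2) by (auto simp: M.submodule_iff)
  let ?Q = "quotient_module M N" and ?q = "\<lambda>x. N +>\<^bsub>M\<^esub> x"
  show surj: "?q ` carrier M = carrier ?Q"
    by (auto simp: quotient_module_def A_RCOSETS_def')
  have add: "?q x \<oplus>\<^bsub>?Q\<^esub> ?q y = ?q (x \<oplus>\<^bsub>M\<^esub> y)" if "x \<in> carrier M" "y \<in> carrier M" for x y
    using that by (simp add: quotient_module_def N.a_rcos_sum)
  have smult: "a \<odot>\<^bsub>?Q\<^esub> ?q x = ?q (a \<odot>\<^bsub>M\<^esub> x)" if a: "a \<in> carrier A" and x: "x \<in> carrier M" for a x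
  proof -
    \<comment> \<open>The scalar multiple of a coset is defined as a union over its representatives.
      All members of the union are one and the same coset, and the index set is nonempty, so the
      union collapses.\<close>
    have eq: "N +>\<^bsub>M\<^esub> (a \<odot>\<^bsub>M\<^esub> y) = ?q (a \<odot>\<^bsub>M\<^esub> x)" if y: "y \<in> ?q x" for y
    proof -
      obtain n where n: "n \<in> N" "y = n \<oplus>\<^bsub>M\<^esub> x" using y by (auto simp: a_r_coset_def')
      then have "a \<odot>\<^bsub>M\<^esub> y = a \<odot>\<^bsub>M\<^esub> n \<oplus>\<^bsub>M\<^esub> a \<odot>\<^bsub>M\<^esub> x"
        using a x NM by (auto simp: M.lsmult_r_distr)
      then have "a \<odot>\<^bsub>M\<^esub> y \<in> ?q (a \<odot>\<^bsub>M\<^esub> x)"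
        using Ns[OF a n(1)] by (auto simp: a_r_coset_def')
      then show ?thesis
        using M.M.a_repr_independence[OF _ M.lsmult_closed[OF a x] Ng] by simp
    qed
    have "x \<in> ?q x" using x Nz by (auto simp: a_r_coset_def' intro!: bexI[of _ "\<zero>\<^bsub>M\<^esub>"])
    then have ne: "?q x \<noteq> {}" by blast
    have "a \<odot>\<^bsub>?Q\<^esub> ?q x = (\<Union>y\<in>?q x. ?q (a \<odot>\<^bsub>M\<^esub> y))"
      by (simp add: quotient_module_def)
    also have "\<dots> = (\<Union>y\<in>?q x. ?q (a \<odot>\<^bsub>M\<^esub> x))"
      by (rule SUP_cong[OF refl eq])
    also have "\<dots> = ?q (a \<odot>\<^bsub>M\<^esub> x)"
      by (rule cSUP_const[OF ne])
    finally show ?thesis .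
  qed
  have zero: "?q \<zero>\<^bsub>M\<^esub> = \<zero>\<^bsub>?Q\<^esub>" using NM by (simp add: quotient_module_def)
  show "left_module A ?Q"
    by (rule left_module_surj[OF assms(1) surj zero add smult])
  show "lin_map A M ?Q ?q"
    using surj add smult by (intro lin_mapI) auto
  show "?q x = \<zero>\<^bsub>?Q\<^esub> \<longleftrightarrow> x \<in> N" if "x \<in> carrier M"
    using M.M.a_coset_join1[OF _ that Ng] M.M.a_coset_join2[OF that Ng]
    by (auto simp: quotient_module_def)
qed


text \<open>Exactness at \<open>P\<^sub>i\<^sub>+\<^sub>1\<close> of the complex of homomorphisms into \<open>Y\<close>.\<close>

definition hom_exact ::
  "('a, 'c) ring_scheme \<Rightarrow> (nat \<Rightarrow> ('a, 'p) module) \<Rightarrow> (nat \<Rightarrow> 'p \<Rightarrow> 'p) \<Rightarrow>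
     ('a, 'y) module \<Rightarrow> nat \<Rightarrow> bool" where
  "hom_exact A P d Y i \<longleftrightarrow>
     (\<forall>f. lin_map A (P (Suc i)) Y f \<and>
          (\<forall>x\<in>carrier (P (Suc (Suc i))). f (d (Suc (Suc i)) x) = \<zero>\<^bsub>Y\<^esub>) \<longrightarrow>
       (\<exists>h. lin_map A (P i) Y h \<and> (\<forall>x\<in>carrier (P (Suc i)). h (d (Suc i) x) = f x)))"

text \<open>Triviality means that every cocycle is a coboundary, but \<open>trivial_group\<close>
  also asks for a group, so the cocycles have to be shown to form one with the coboundaries as a
  subgroup; \<open>dd\<close> puts the coboundaries among the cocycles. Mind the shift:
  \<open>hom_exact\<close> at \<open>i\<close> concerns cohomology in degree
  \<open>Suc i\<close>.\<close>

lemma trivial_cohomology_iff: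
  assumes Y: "left_module A Y" and P: "\<And>i. left_module A (P i)"
    and d: "\<And>i. lin_map A (P (Suc i)) (P i) (d (Suc i))"
    and dd: "\<And>x. x \<in> carrier (P (Suc (Suc i))) \<Longrightarrow> d (Suc i) (d (Suc (Suc i)) x) = \<zero>\<^bsub>P i\<^esub>"
  shows "trivial_group (hom_cohomology A P d Y (Suc i)) \<longleftrightarrow> hom_exact A P d Y i"
proof -
  interpret Y: left_module A Y by (rule Y)
  let ?P0 = "P i" and ?P1 = "P (Suc i)" and ?P2 = "P (Suc (Suc i))"
  let ?d1 = "d (Suc i)" and ?d2 = "d (Suc (Suc i))"
  let ?Z = "cocycles A P d Y (Suc i)" and ?B = "coboundaries A P d Y (Suc i)"
  let ?G = "\<lparr>carrier = ?Z, monoid.mult = hom_add ?P1 Y, one = hom_zero ?P1 Y\<rparr>"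
  note h = hom_add_facts[OF P[of "Suc i"] Y]
  have c: "f x \<in> carrier Y" if "f \<in> lmod_hom A ?P1 Y" "x \<in> carrier ?P1" for f x
    using lin_map_closed[OF lmod_hom_lin[OF that(1)] that(2)] .
  have d2c: "?d2 x \<in> carrier ?P1" if "x \<in> carrier ?P2" for x
    using lin_map_closed[OF d that] .
  have d1c: "?d1 x \<in> carrier ?P0" if "x \<in> carrier ?P1" for x
    using lin_map_closed[OF d that] .
  have Z: "f \<in> ?Z \<longleftrightarrow> f \<in> lmod_hom A ?P1 Y \<and> (\<forall>x\<in>carrier ?P2. f (?d2 x) = \<zero>\<^bsub>Y\<^esub>)" for f
    by (auto simp: cocycles_def compose_def hom_zero_def fun_eq_iff restrict_def)
  have B: "f \<in> ?B \<longleftrightarrow> f \<in> lmod_hom A ?P1 Y \<and>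
      (\<exists>g. lin_map A ?P0 Y g \<and> (\<forall>x\<in>carrier ?P1. g (?d1 x) = f x))" for f
  proof
    assume "f \<in> ?B"
    then obtain g where g: "g \<in> lmod_hom A ?P0 Y" "f = compose (carrier ?P1) g ?d1"
      by auto
    have "lin_map A ?P1 Y (\<lambda>x. g (?d1 x))"
      by (rule lin_map_comp[OF d lmod_hom_lin[OF g(1)]])
    from restrict_lmod_hom[OF P this]
    show "f \<in> lmod_hom A ?P1 Y \<and> (\<exists>g. lin_map A ?P0 Y g \<and> (\<forall>x\<in>carrier ?P1. g (?d1 x) = f x))"
      using lmod_hom_lin[OF g(1)] by (auto simp: g(2) compose_def)
  next
    assume *: "f \<in> lmod_hom A ?P1 Y \<and>
      (\<exists>g. lin_map A ?P0 Y g \<and> (\<forall>x\<in>carrier ?P1. g (?d1 x) = f x))"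
    then obtain g where g: "lin_map A ?P0 Y g" "\<forall>x\<in>carrier ?P1. g (?d1 x) = f x"
      by blast
    have "f = compose (carrier ?P1) (restrict g (carrier ?P0)) ?d1"
      using * g(2) d1c by (intro extensionalityI[of _ "carrier ?P1"])
        (auto simp: lmod_hom_iff compose_def)
    then show "f \<in> ?B"
      using restrict_lmod_hom[OF P g(1)] by auto
  qed
  have BZ: "f \<in> ?Z" if f: "f \<in> ?B" for f
  proof -
    obtain g where g: "lin_map A ?P0 Y g" "\<forall>x\<in>carrier ?P1. g (?d1 x) = f x" and fl: "f \<in> lmod_hom A ?P1 Y"
      using f unfolding B by blast
    have "f (?d2 x) = \<zero>\<^bsub>Y\<^esub>" if "x \<in> carrier ?P2" for x
      using g(2)[rule_format, OF d2c[OF that]] dd[OF that] lin_map_zero[OF P Y g(1)] by simp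
    then show ?thesis using fl unfolding Z by blast
  qed
  have Zadd: "hom_add ?P1 Y f g \<in> ?Z" if "f \<in> ?Z" "g \<in> ?Z" for f g
    using that h(1)[of f g] by (simp add: Z hom_add_def d2c)
  have Zzero: "hom_zero ?P1 Y \<in> ?Z"
    using h(2) by (simp add: Z hom_zero_def d2c)
  have Zneg: "(\<lambda>x\<in>carrier ?P1. \<ominus>\<^bsub>Y\<^esub> f x) \<in> ?Z" if "f \<in> ?Z" for f
    using that h(3)[of f] by (simp add: Z d2c)
  have G: "comm_group ?G"
  proof (rule comm_groupI, goal_cases)
    case (1 f g) then show ?case using Zadd by simp
  next
    case 2 show ?case using Zzero by simp
  next
    case (3 f g k) then show ?case using h(4) by (simp add: Z)
  next
    case (4 f g) then show ?case using h(5) by (simp add: Z)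
  next
    case (5 f) then show ?case using h(6) by (simp add: Z)
  next
    case (6 f) then show ?case using Zneg[of f] h(7)[of f] by (auto simp: Z)
  qed
  interpret G: comm_group ?G by (rule G)
  have inv: "inv\<^bsub>?G\<^esub> f = (\<lambda>x\<in>carrier ?P1. \<ominus>\<^bsub>Y\<^esub> f x)" if "f \<in> ?Z" for f
    using that Zneg[OF that] h(7)[of f] by (intro G.inv_equality) (auto simp: Z)
  have sub: "subgroup ?B ?G"
  proof (rule G.subgroupI, goal_cases)
    case 1 show ?case using BZ by auto
  next
    case 2
    have "hom_zero ?P1 Y \<in> ?B"
      unfolding B using h(2) lin_map_const_zero[OF Y, of ?P0] by (auto simp: hom_zero_def)
    then show ?case by blast
  next
    case (3 f)
    then obtain g where g: "lin_map A ?P0 Y g" "\<forall>x\<in>carrier ?P1. g (?d1 x) = f x" and fl: "f \<in> lmod_hom A ?P1 Y"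
      unfolding B by blast
    have "lin_map A ?P0 Y (\<lambda>x. \<zero>\<^bsub>Y\<^esub> \<ominus>\<^bsub>Y\<^esub> g x)"
      by (intro lin_map_diff lin_map_const_zero P Y g(1))
    then have "(\<lambda>x\<in>carrier ?P1. \<ominus>\<^bsub>Y\<^esub> f x) \<in> ?B"
      unfolding B using h(3)[OF fl] g(2) c[OF fl]
      by (intro conjI exI[of _ "\<lambda>x. \<zero>\<^bsub>Y\<^esub> \<ominus>\<^bsub>Y\<^esub> g x"]) (auto simp: a_minus_def)
    then show ?case using inv[OF BZ[OF 3]] by simp
  next
    case (4 f1 f2)
    then obtain g1 g2 where g: "lin_map A ?P0 Y g1" "\<forall>x\<in>carrier ?P1. g1 (?d1 x) = f1 x"
      "lin_map A ?P0 Y g2" "\<forall>x\<in>carrier ?P1. g2 (?d1 x) = f2 x"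
      and fl: "f1 \<in> lmod_hom A ?P1 Y" "f2 \<in> lmod_hom A ?P1 Y"
      unfolding B by blast
    have "lin_map A ?P0 Y (\<lambda>x. g1 x \<oplus>\<^bsub>Y\<^esub> g2 x)"
      by (intro lin_map_sum P Y g)
    then have "hom_add ?P1 Y f1 f2 \<in> ?B"
      unfolding B using h(1)[OF fl] g(2,4)
      by (intro conjI exI[of _ "\<lambda>x. g1 x \<oplus>\<^bsub>Y\<^esub> g2 x"]) (auto simp: hom_add_def)
    then show ?case by simp
  qed
  have "trivial_group (?G Mod ?B) \<longleftrightarrow> ?Z \<subseteq> ?B"
  proof
    assume t: "trivial_group (?G Mod ?B)"
    show "?Z \<subseteq> ?B"
    proof
      fix f assume f: "f \<in> ?Z"
      then have "?B #>\<^bsub>?G\<^esub> f \<in> carrier (?G Mod ?B)"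
        by (auto simp: carrier_FactGroup)
      then have "?B #>\<^bsub>?G\<^esub> f = ?B"
        using t by (simp add: trivial_group_def)
      then show "f \<in> ?B"
        using f by (intro G.coset_join1[OF _ _ sub]) auto
    qed
  next
    assume ZB: "?Z \<subseteq> ?B"
    have "group (?G Mod ?B)"
      using comm_group.abelian_FactGroup[OF G sub] by (simp add: comm_group_def)
    moreover have "carrier (?G Mod ?B) = {?B}"
    proof -
      have "?B #>\<^bsub>?G\<^esub> f = ?B" if "f \<in> ?Z" for f
        using that ZB by (intro G.coset_join2[OF _ sub]) auto
      then have "(\<lambda>x. ?B #>\<^bsub>?G\<^esub> x) ` carrier ?G = (\<lambda>x. ?B) ` carrier ?G"
        by (intro image_cong) auto
      then show ?thesis
        using Zzero by (auto simp: carrier_FactGroup)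
    qed
    ultimately show "trivial_group (?G Mod ?B)"
      by (simp add: trivial_group_def)
  qed
  also have "\<dots> \<longleftrightarrow> hom_exact A P d Y i"
  proof
    assume ZB: "?Z \<subseteq> ?B"
    show "hom_exact A P d Y i"
      unfolding hom_exact_def
    proof (intro allI impI)
      fix f assume f: "lin_map A ?P1 Y f \<and> (\<forall>x\<in>carrier ?P2. f (?d2 x) = \<zero>\<^bsub>Y\<^esub>)"
      then have "restrict f (carrier ?P1) \<in> ?Z"
        unfolding Z using restrict_lmod_hom[OF P, of _ Y f] by (simp add: d2c)
      then have "restrict f (carrier ?P1) \<in> ?B" using ZB by blast
      then show "\<exists>h. lin_map A ?P0 Y h \<and> (\<forall>x\<in>carrier ?P1. h (?d1 x) = f x)"
        unfolding B by simp
    qed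
  next
    assume ex: "hom_exact A P d Y i"
    show "?Z \<subseteq> ?B"
    proof
      fix f assume "f \<in> ?Z"
      then have f: "f \<in> lmod_hom A ?P1 Y" "\<forall>x\<in>carrier ?P2. f (?d2 x) = \<zero>\<^bsub>Y\<^esub>"
        unfolding Z by simp_all
      then show "f \<in> ?B"
        unfolding B using ex[unfolded hom_exact_def, rule_format, of f] lmod_hom_lin[OF f(1)] by simp
    qed
  qed
  finally show ?thesis by (simp add: hom_cohomology_def del: coboundaries.simps)
qed

section \<open>Injectivity of the dual of the algebra\<close>

text \<open>The definition of injectivity tests injective maps within \<open>'a univ\<close>. Here
  \<alpha> is replaced by the inclusion of its image, on which \<gamma> is well defined by
  \<open>ker\<close>; finite generation of \<open>V\<close> provides the embedding into
  \<open>'a univ\<close>.\<close>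

lemma injective_extend:
  fixes U :: "('a, 'u) module" and V :: "('a, 'v) module"
  assumes "injective A J" "left_module A U" "left_module A V" "fin_gen A V"
    and \<alpha>: "lin_map A U V \<alpha>" and \<gamma>: "lin_map A U J \<gamma>"
    and ker: "\<And>u. u \<in> carrier U \<Longrightarrow> \<alpha> u = \<zero>\<^bsub>V\<^esub> \<Longrightarrow> \<gamma> u = \<zero>\<^bsub>J\<^esub>"
  obtains \<eta> where "lin_map A V J \<eta>" "\<And>u. u \<in> carrier U \<Longrightarrow> \<eta> (\<alpha> u) = \<gamma> u"
proof -
  have J: "left_module A J" using assms(1) by (simp add: injective_def)
  interpret J: left_module A J by (rule J)
  interpret U: left_module A U by fact
  interpret V: left_module A V by fact
  have wd: "\<gamma> u = \<gamma> w" if uw: "u \<in> carrier U" "w \<in> carrier U" "\<alpha> u = \<alpha> w" for u w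
  proof -
    have "\<alpha> (u \<ominus>\<^bsub>U\<^esub> w) = \<zero>\<^bsub>V\<^esub>"
      using uw lin_map_closed[OF \<alpha>]
      by (simp add: lin_map_minus[OF assms(2,3) \<alpha>] V.M.minus_eq_zero_iff)
    then have "\<gamma> (u \<ominus>\<^bsub>U\<^esub> w) = \<zero>\<^bsub>J\<^esub>"
      by (intro ker U.M.minus_closed uw)
    then show ?thesis
      using uw lin_map_closed[OF \<gamma>]
      by (simp add: lin_map_minus[OF assms(2) J \<gamma>] J.M.minus_eq_zero_iff)
  qed
  obtain h :: "'v \<Rightarrow> 'a univ" where h: "inj_on h (carrier V)"
    using univ_embedding[OF assms(3,4)] by blast
  note cV = copy_module[OF assms(3) h]
  let ?Y = "copy_module h V"
  have h\<alpha>: "lin_map A U ?Y (\<lambda>u. h (\<alpha> u))" by (rule lin_map_comp[OF \<alpha> cV(2)])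
  have imeq: "(\<lambda>u. h (\<alpha> u)) ` carrier U = h ` \<alpha> ` carrier U" by (simp add: image_image)
  let ?X = "?Y\<lparr>carrier := (\<lambda>u. h (\<alpha> u)) ` carrier U\<rparr>"
  have subX: "submodule ((\<lambda>u. h (\<alpha> u)) ` carrier U) A ?Y"
    by (rule submodule_image[OF assms(2) cV(1) h\<alpha> U.submodule_carrier])
  have X: "left_module A ?X" by (rule left_module_submodule[OF cV(1) subX])
  \<comment> \<open>This is \<gamma> read on the image of \<alpha> through an arbitrary preimage;
    \<open>wd\<close> makes the choice harmless.\<close>
  define f where "f y = \<gamma> (SOME u. u \<in> carrier U \<and> h (\<alpha> u) = y)" for y
  have f: "f (h (\<alpha> u)) = \<gamma> u" if u: "u \<in> carrier U" for u
  proof -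
    have "\<exists>w. w \<in> carrier U \<and> h (\<alpha> w) = h (\<alpha> u)" using u by blast
    then have "(SOME w. w \<in> carrier U \<and> h (\<alpha> w) = h (\<alpha> u)) \<in> carrier U \<and>
        h (\<alpha> (SOME w. w \<in> carrier U \<and> h (\<alpha> w) = h (\<alpha> u))) = h (\<alpha> u)"
      by (rule someI_ex)
    then show ?thesis
      unfolding f_def using u h lin_map_closed[OF \<alpha>] by (intro wd) (auto dest: inj_onD)
  qed
  have fl: "lin_map A ?X J f"
  proof (rule lin_mapI)
    fix x assume "x \<in> carrier ?X"
    then obtain u where u: "u \<in> carrier U" "x = h (\<alpha> u)" by auto
    show "f x \<in> carrier J" using u f lin_map_closed[OF \<gamma>] by simp
    {
      fix y assume "y \<in> carrier ?X"
      then obtain w where w: "w \<in> carrier U" "y = h (\<alpha> w)" by auto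
      have "x \<oplus>\<^bsub>?X\<^esub> y = h (\<alpha> (u \<oplus>\<^bsub>U\<^esub> w))"
        using lin_map_add[OF h\<alpha> u(1) w(1)] u w by simp
      then show "f (x \<oplus>\<^bsub>?X\<^esub> y) = f x \<oplus>\<^bsub>J\<^esub> f y"
        using u w f lin_map_add[OF \<gamma>] by simp
    }
    {
      fix a assume a: "a \<in> carrier A"
      have "a \<odot>\<^bsub>?X\<^esub> x = h (\<alpha> (a \<odot>\<^bsub>U\<^esub> u))"
        using lin_map_smult[OF h\<alpha> a u(1)] u by simp
      then show "f (a \<odot>\<^bsub>?X\<^esub> x) = a \<odot>\<^bsub>J\<^esub> f x"
        using u a f lin_map_smult[OF \<gamma>] by (simp add: U.lsmult_closed)
    }
  qed
  have "restrict (\<lambda>x. x) (carrier ?X) \<in> lmod_hom A ?X ?Y"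
    by (rule restrict_lmod_hom[OF X])
      (rule lin_map_subdomain[OF lin_map_id submodule_subset[OF subX]])
  moreover have "inj_on (restrict (\<lambda>x. x) (carrier ?X)) (carrier ?X)"
    by (simp add: inj_on_def)
  moreover have "restrict f (carrier ?X) \<in> lmod_hom A ?X J"
    by (rule restrict_lmod_hom[OF X fl])
  ultimately have "\<exists>k\<in>lmod_hom A ?Y J. \<forall>x\<in>carrier ?X.
      k (restrict (\<lambda>x. x) (carrier ?X) x) = restrict f (carrier ?X) x"
    using assms(1)[unfolded injective_def, THEN conjunct2, rule_format, of ?X ?Y] X cV(1) by blast
  then obtain k where k: "k \<in> lmod_hom A ?Y J"
    "\<And>x. x \<in> carrier ?X \<Longrightarrow> k (restrict (\<lambda>x. x) (carrier ?X) x) = restrict f (carrier ?X) x"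
    by blast
  show thesis
  proof (rule that)
    show "lin_map A V J (\<lambda>v. k (h v))" by (rule lin_map_comp[OF cV(2) lmod_hom_lin[OF k(1)]])
    show "k (h (\<alpha> u)) = \<gamma> u" if "u \<in> carrier U" for u
      using k(2)[of "h (\<alpha> u)"] that f by simp
  qed
qed

section \<open>Restriction of scalars and the dual of the regular module\<close>

lemma restrict_scalars_simps:
  "carrier (restrict_scalars A X) = carrier X" "\<zero>\<^bsub>restrict_scalars A X\<^esub> = \<zero>\<^bsub>X\<^esub>"
  "x \<oplus>\<^bsub>restrict_scalars A X\<^esub> y = x \<oplus>\<^bsub>X\<^esub> y"
  "r \<odot>\<^bsub>restrict_scalars A X\<^esub> x = (r \<odot>\<^bsub>A\<^esub> \<one>\<^bsub>A\<^esub>) \<odot>\<^bsub>X\<^esub> x"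
  by (simp_all add: restrict_scalars_def)

context artin_algebra
begin

lemma left_module_restrict_scalars:
  assumes "left_module A X"
  shows "left_module R (restrict_scalars A X)"
proof -
  interpret X: left_module A X by fact
  have c: "r \<odot>\<^bsub>A\<^esub> \<one>\<^bsub>A\<^esub> \<in> carrier A" if "r \<in> carrier R" for r
    using that by simp
  have m: "(r \<otimes>\<^bsub>R\<^esub> s) \<odot>\<^bsub>A\<^esub> \<one>\<^bsub>A\<^esub> = (r \<odot>\<^bsub>A\<^esub> \<one>\<^bsub>A\<^esub>) \<otimes>\<^bsub>A\<^esub> (s \<odot>\<^bsub>A\<^esub> \<one>\<^bsub>A\<^esub>)"
    if "r \<in> carrier R" "s \<in> carrier R" for r s
    using that by (simp add: smult_mult_left smult_assoc1)
  have inv: "\<exists>y\<in>carrier X. y \<oplus>\<^bsub>X\<^esub> x = \<zero>\<^bsub>X\<^esub>" if "x \<in> carrier X" for x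
    using that by (intro bexI[of _ "\<ominus>\<^bsub>X\<^esub> x"]) (simp_all add: X.M.l_neg)
  show ?thesis
    by (intro left_moduleI R.ring_axioms)
       (simp_all add: restrict_scalars_simps X.M.a_ac X.lsmult_closed c m smult_l_distr
         X.lsmult_l_distr X.lsmult_r_distr X.lsmult_assoc X.lsmult_one inv)
qed

lemma lin_map_restrict_scalars:
  "lin_map A X Y f \<Longrightarrow> lin_map R (restrict_scalars A X) (restrict_scalars A Y) f"
  by (simp add: lin_map_def restrict_scalars_simps)

text \<open>The products t s generate, where t runs through generators of \<open>A\<close> over
  \<open>R\<close> and s through those of \<open>X\<close> over \<open>A\<close>. If
  \<open>N\<close> contains them, the a with a s in \<open>N\<close> form an
  \<open>R\<close>-submodule of \<open>A\<close>, and the x with A x inside \<open>N\<close> form an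
  \<open>A\<close>-submodule of \<open>X\<close>; both are everything.\<close>

lemma fin_gen_restrict_scalars:
  assumes "left_module A X" "fin_gen A X"
  shows "fin_gen R (restrict_scalars A X)"
proof -
  interpret X: left_module A X by fact
  let ?X = "restrict_scalars A X"
  have X': "left_module R ?X" by (rule left_module_restrict_scalars) fact
  interpret X': left_module R ?X by (rule X')
  interpret self: left_module R A by (rule left_module_self)
  obtain S where S: "finite S" "S \<subseteq> carrier X"
      "\<And>N. submodule N A X \<Longrightarrow> S \<subseteq> N \<Longrightarrow> N = carrier X"
    using assms(2) by (auto simp: fin_gen_def)
  obtain T where T: "finite T" "T \<subseteq> carrier A"
      "\<And>N. submodule N R A \<Longrightarrow> T \<subseteq> N \<Longrightarrow> N = carrier A"
    using finitely_generated by (auto simp: fin_gen_def)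
  let ?G = "(\<lambda>(t, s). t \<odot>\<^bsub>X\<^esub> s) ` (T \<times> S)"
  have "N = carrier ?X" if N: "submodule N R ?X" "?G \<subseteq> N" for N
  proof -
    have Nsub: "N \<subseteq> carrier X" "\<zero>\<^bsub>X\<^esub> \<in> N" "\<And>x y. x \<in> N \<Longrightarrow> y \<in> N \<Longrightarrow> x \<oplus>\<^bsub>X\<^esub> y \<in> N"
      "\<And>r x. r \<in> carrier R \<Longrightarrow> x \<in> N \<Longrightarrow> (r \<odot>\<^bsub>A\<^esub> \<one>\<^bsub>A\<^esub>) \<odot>\<^bsub>X\<^esub> x \<in> N"
      using N(1) unfolding X'.submodule_iff by (auto simp: restrict_scalars_simps)
    have as: "a \<odot>\<^bsub>X\<^esub> s \<in> N" if s: "s \<in> S" and a: "a \<in> carrier A" for s a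
    proof -
      have "lin_map R A ?X (\<lambda>a. a \<odot>\<^bsub>X\<^esub> s)"
        using s S(2) by (intro lin_mapI)
          (auto simp: restrict_scalars_simps X.lsmult_closed X.lsmult_l_distr
             X.lsmult_assoc[symmetric] smult_mult_left)
      then have "submodule {a \<in> carrier A. a \<odot>\<^bsub>X\<^esub> s \<in> N} R A"
        by (rule submodule_vimage[OF left_module_self X' _ N(1)])
      then have "{a \<in> carrier A. a \<odot>\<^bsub>X\<^esub> s \<in> N} = carrier A"
        using T(2) N(2) s by (intro T(3)) auto
      then show ?thesis using a by blast
    qed
    let ?N = "{x \<in> carrier X. \<forall>a\<in>carrier A. a \<odot>\<^bsub>X\<^esub> x \<in> N}"
    have "submodule ?N A X"
      unfolding X.submodule_iff using Nsub(2,3)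
      by (auto simp: X.lsmult_r_null X.lsmult_r_distr X.lsmult_closed X.lsmult_assoc[symmetric])
    then have "?N = carrier X"
      using as S(2) by (intro S(3)) auto
    then have "\<one>\<^bsub>A\<^esub> \<odot>\<^bsub>X\<^esub> x \<in> N" if "x \<in> carrier X" for x
      using that A.one_closed by blast
    then have "carrier X \<subseteq> N"
      using X.lsmult_one by auto
    then show ?thesis using Nsub(1) by (auto simp: restrict_scalars_simps)
  qed
  moreover have "finite ?G" "?G \<subseteq> carrier ?X"
    using S T by (auto simp: restrict_scalars_simps intro!: X.lsmult_closed)
  ultimately show ?thesis
    unfolding fin_gen_def by (intro exI[of _ ?G]) simp
qed

abbreviation dual_regular :: "('r, 'j) module \<Rightarrow> ('a, 'a \<Rightarrow> 'j) module" where
  "dual_regular J \<equiv> dual_module R A J (regular (opposite A))"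

abbreviation restricted_regular :: "('r, 'a) module" where
  "restricted_regular \<equiv> restrict_scalars A (regular (opposite A))"

lemma restricted_regular_smult:
  "r \<in> carrier R \<Longrightarrow> x \<in> carrier A \<Longrightarrow> r \<odot>\<^bsub>restricted_regular\<^esub> x = r \<odot>\<^bsub>A\<^esub> x"
  by (simp add: restrict_scalars_simps smult_mult_right)

lemma left_module_restricted_regular: "left_module R restricted_regular"
proof (rule left_module_surj[OF left_module_self, where q = "\<lambda>x. x"])
  show "r \<odot>\<^bsub>restricted_regular\<^esub> x = r \<odot>\<^bsub>A\<^esub> x" if "r \<in> carrier R" "x \<in> carrier A" for r x
    using that by (rule restricted_regular_smult)
qed (simp_all add: restrict_scalars_simps)

lemma dual_regular_simps:
  "carrier (dual_regular J) = lmod_hom R restricted_regular J"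
  "\<zero>\<^bsub>dual_regular J\<^esub> = hom_zero restricted_regular J"
  "f \<oplus>\<^bsub>dual_regular J\<^esub> g = hom_add restricted_regular J f g"
  "a \<odot>\<^bsub>dual_regular J\<^esub> f = (\<lambda>x\<in>carrier A. f (x \<otimes>\<^bsub>A\<^esub> a))"
  by (simp_all add: dual_module_def)

lemma dual_regular_iff:
  "f \<in> carrier (dual_regular J) \<longleftrightarrow> f \<in> extensional (carrier A) \<and> (\<forall>x\<in>carrier A. f x \<in> carrier J) \<and>
     (\<forall>x\<in>carrier A. \<forall>y\<in>carrier A. f (x \<oplus>\<^bsub>A\<^esub> y) = f x \<oplus>\<^bsub>J\<^esub> f y) \<and>
     (\<forall>r\<in>carrier R. \<forall>x\<in>carrier A. f (r \<odot>\<^bsub>A\<^esub> x) = r \<odot>\<^bsub>J\<^esub> f x)"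
  unfolding dual_regular_simps lmod_hom_iff lin_map_def
  by (auto simp: restricted_regular_smult restrict_scalars_simps smult_mult_right)

lemma dual_regular_apply:
  "x \<in> carrier A \<Longrightarrow> (f \<oplus>\<^bsub>dual_regular J\<^esub> g) x = f x \<oplus>\<^bsub>J\<^esub> g x"
  "x \<in> carrier A \<Longrightarrow> (a \<odot>\<^bsub>dual_regular J\<^esub> f) x = f (x \<otimes>\<^bsub>A\<^esub> a)"
  "x \<in> carrier A \<Longrightarrow> \<zero>\<^bsub>dual_regular J\<^esub> x = \<zero>\<^bsub>J\<^esub>"
  by (simp_all add: dual_regular_simps hom_add_def hom_zero_def restrict_scalars_simps)

lemma dual_regular_eqI:
  "f \<in> carrier (dual_regular J) \<Longrightarrow> g \<in> carrier (dual_regular J) \<Longrightarrow>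
     (\<And>x. x \<in> carrier A \<Longrightarrow> f x = g x) \<Longrightarrow> f = g"
  using extensionalityI[of f "carrier A" g] by (simp add: dual_regular_iff)

lemma left_module_dual_regular:
  assumes "left_module R J" shows "left_module A (dual_regular J)"
proof -
  interpret J: left_module R J by fact
  let ?D = "dual_regular J"
  note h = hom_add_facts[OF left_module_restricted_regular assms]
  have add: "f \<oplus>\<^bsub>?D\<^esub> g \<in> carrier ?D" if "f \<in> carrier ?D" "g \<in> carrier ?D" for f g
    using that h(1) by (simp add: dual_regular_simps)
  have smult: "a \<odot>\<^bsub>?D\<^esub> f \<in> carrier ?D" if f: "f \<in> carrier ?D" and a: "a \<in> carrier A" for f a
    using f a unfolding dual_regular_iff
    by (auto simp: dual_regular_simps A.l_distr smult_mult_left)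
  have app: "f (x \<oplus>\<^bsub>A\<^esub> y) = f x \<oplus>\<^bsub>J\<^esub> f y"
    if "f \<in> carrier ?D" "x \<in> carrier A" "y \<in> carrier A" for f x y
    using that by (simp add: dual_regular_iff)
  show ?thesis
  proof (rule left_moduleI, goal_cases)
    case 1 show ?case by (rule A.ring_axioms)
  next
    case (2 x y) then show ?case by (rule add)
  next
    case 3 show ?case using h(2) by (simp add: dual_regular_simps)
  next
    case (4 x y z) then show ?case using h(4) by (simp add: dual_regular_simps)
  next
    case (5 x y) then show ?case using h(5) by (simp add: dual_regular_simps)
  next
    case (6 x) then show ?case using h(6) by (simp add: dual_regular_simps)
  next
    case (7 x) then show ?case using h(3,7) by (auto simp: dual_regular_simps)
  next
    case (8 a x) then show ?case by (intro smult)
  next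
    case (9 a b x) then show ?case
      by (intro dual_regular_eqI[of _ J] add smult A.a_closed) (simp_all add: dual_regular_apply A.r_distr app)
  next
    case (10 a x y) then show ?case
      by (intro dual_regular_eqI[of _ J] add smult) (simp_all add: dual_regular_apply)
  next
    case (11 a b x) then show ?case
      by (intro dual_regular_eqI[of _ J] smult A.m_closed) (simp_all add: dual_regular_apply A.m_assoc)
  next
    case (12 x) then show ?case
      by (intro dual_regular_eqI[of _ J] smult A.one_closed) (simp_all add: dual_regular_apply)
  qed
qed

text \<open>The adjunction between Hom over \<open>A\<close> into Hom(A, J) and Hom over
  \<open>R\<close> into \<open>J\<close>: a map g into the dual corresponds to u \<mapsto> g(u)(1),
  and \<eta> gives back v \<mapsto> (a \<mapsto> \<eta>(a v)). Injectivity of \<open>J\<close> over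
  \<open>R\<close> thus becomes injectivity of the dual over \<open>A\<close>, for finitely
  generated \<open>V\<close>.\<close>

lemma dual_regular_extend:
  assumes "injective R J" "left_module A U" "left_module A V" "fin_gen A V"
    and \<alpha>: "lin_map A U V \<alpha>" and g: "lin_map A U (dual_regular J) g"
    and ker: "\<And>u. u \<in> carrier U \<Longrightarrow> \<alpha> u = \<zero>\<^bsub>V\<^esub> \<Longrightarrow> g u = \<zero>\<^bsub>dual_regular J\<^esub>"
  obtains h where "lin_map A V (dual_regular J) h" "\<And>u. u \<in> carrier U \<Longrightarrow> h (\<alpha> u) = g u"
proof -
  have J: "left_module R J" using assms(1) by (simp add: injective_def)
  interpret J: left_module R J by (rule J)
  interpret U: left_module A U by fact
  interpret V: left_module A V by fact
  let ?D = "dual_regular J"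
  have gc: "g u \<in> carrier ?D" if "u \<in> carrier U" for u by (rule lin_map_closed[OF g that])
  have \<gamma>: "lin_map R (restrict_scalars A U) J (\<lambda>u. g u \<one>\<^bsub>A\<^esub>)"
  proof (rule lin_mapI)
    fix u assume u: "u \<in> carrier (restrict_scalars A U)"
    then show "g u \<one>\<^bsub>A\<^esub> \<in> carrier J"
      using gc[of u] by (simp add: restrict_scalars_simps dual_regular_iff)
    show "g (u \<oplus>\<^bsub>restrict_scalars A U\<^esub> w) \<one>\<^bsub>A\<^esub> = g u \<one>\<^bsub>A\<^esub> \<oplus>\<^bsub>J\<^esub> g w \<one>\<^bsub>A\<^esub>"
      if "w \<in> carrier (restrict_scalars A U)" for w
      using u that by (simp add: restrict_scalars_simps lin_map_add[OF g] dual_regular_apply)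
    show "g (r \<odot>\<^bsub>restrict_scalars A U\<^esub> u) \<one>\<^bsub>A\<^esub> = r \<odot>\<^bsub>J\<^esub> g u \<one>\<^bsub>A\<^esub>" if "r \<in> carrier R" for r
      using u that gc[of u]
      by (simp add: restrict_scalars_simps lin_map_smult[OF g] dual_regular_apply dual_regular_iff)
  qed
  obtain \<eta> where \<eta>: "lin_map R (restrict_scalars A V) J \<eta>"
    "\<And>u. u \<in> carrier (restrict_scalars A U) \<Longrightarrow> \<eta> (\<alpha> u) = g u \<one>\<^bsub>A\<^esub>"
  proof (rule injective_extend[OF assms(1) left_module_restrict_scalars[OF assms(2)]
      left_module_restrict_scalars[OF assms(3)] fin_gen_restrict_scalars[OF assms(3,4)]
      lin_map_restrict_scalars[OF \<alpha>] \<gamma>])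
    show "g u \<one>\<^bsub>A\<^esub> = \<zero>\<^bsub>J\<^esub>" if "u \<in> carrier (restrict_scalars A U)"
      "\<alpha> u = \<zero>\<^bsub>restrict_scalars A V\<^esub>" for u
      using ker[of u] that by (simp add: restrict_scalars_simps dual_regular_apply)
  qed iprover
  have \<eta>c: "\<eta> v \<in> carrier J" if "v \<in> carrier V" for v
    using lin_map_closed[OF \<eta>(1)] that by (simp add: restrict_scalars_simps)
  have \<eta>add: "\<eta> (v \<oplus>\<^bsub>V\<^esub> w) = \<eta> v \<oplus>\<^bsub>J\<^esub> \<eta> w" if "v \<in> carrier V" "w \<in> carrier V" for v w
    using lin_map_add[OF \<eta>(1)] that by (simp add: restrict_scalars_simps)
  have \<eta>smult: "\<eta> ((r \<odot>\<^bsub>A\<^esub> \<one>\<^bsub>A\<^esub>) \<odot>\<^bsub>V\<^esub> v) = r \<odot>\<^bsub>J\<^esub> \<eta> v" if "v \<in> carrier V" "r \<in> carrier R" for v r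
    using lin_map_smult[OF \<eta>(1)] that by (simp add: restrict_scalars_simps)
  \<comment> \<open>The \<open>R\<close>-linearity of a \<mapsto> \<eta>(a v), which makes this
    functional an element of the dual.\<close>
  have \<eta>ra: "\<eta> ((r \<odot>\<^bsub>A\<^esub> a) \<odot>\<^bsub>V\<^esub> v) = r \<odot>\<^bsub>J\<^esub> \<eta> (a \<odot>\<^bsub>V\<^esub> v)"
    if "v \<in> carrier V" "r \<in> carrier R" "a \<in> carrier A" for v r a
  proof -
    have "(r \<odot>\<^bsub>A\<^esub> a) \<odot>\<^bsub>V\<^esub> v = (r \<odot>\<^bsub>A\<^esub> \<one>\<^bsub>A\<^esub>) \<odot>\<^bsub>V\<^esub> (a \<odot>\<^bsub>V\<^esub> v)"
      using that by (simp add: V.lsmult_assoc[symmetric] smult_mult_left)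
    then show ?thesis using \<eta>smult that by (simp add: V.lsmult_closed)
  qed
  define h where "h v = (\<lambda>a\<in>carrier A. \<eta> (a \<odot>\<^bsub>V\<^esub> v))" for v
  have hc: "h v \<in> carrier ?D" if "v \<in> carrier V" for v
    using that unfolding dual_regular_iff h_def
    by (simp add: \<eta>c \<eta>add \<eta>ra V.lsmult_closed V.lsmult_l_distr)
  show thesis
  proof (rule that)
    show "lin_map A V ?D h"
    proof (rule lin_mapI)
      fix v assume v: "v \<in> carrier V"
      show "h v \<in> carrier ?D" by (rule hc[OF v])
      note D = left_module_dual_regular[OF J]
      show "h (v \<oplus>\<^bsub>V\<^esub> w) = h v \<oplus>\<^bsub>?D\<^esub> h w" if "w \<in> carrier V" for w
        using v that
        by (intro dual_regular_eqI[of _ J] hc left_module_add[OF D] V.M.a_closed)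
          (simp_all add: dual_regular_apply h_def \<eta>add V.lsmult_r_distr V.lsmult_closed)
      show "h (a \<odot>\<^bsub>V\<^esub> v) = a \<odot>\<^bsub>?D\<^esub> h v" if "a \<in> carrier A" for a
        using v that
        by (intro dual_regular_eqI[of _ J] hc left_module_smult[OF D] V.lsmult_closed)
          (simp_all add: dual_regular_apply h_def V.lsmult_assoc)
    qed
    fix u assume u: "u \<in> carrier U"
    show "h (\<alpha> u) = g u"
    proof (rule dual_regular_eqI[OF hc[OF lin_map_closed[OF \<alpha> u]] gc[OF u]])
      fix a assume a: "a \<in> carrier A"
      have "h (\<alpha> u) a = \<eta> (\<alpha> (a \<odot>\<^bsub>U\<^esub> u))"
        using a u by (simp add: h_def lin_map_smult[OF \<alpha>])
      also have "\<dots> = g (a \<odot>\<^bsub>U\<^esub> u) \<one>\<^bsub>A\<^esub>"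
        using a u by (intro \<eta>(2)) (simp add: restrict_scalars_simps U.lsmult_closed)
      also have "\<dots> = g u a"
        using a u by (simp add: lin_map_smult[OF g] dual_regular_apply)
      finally show "h (\<alpha> u) a = g u a" .
    qed
  qed
qed

end

section \<open>Complexes dual to a resolution\<close>

lemma regular_minus: "x \<ominus>\<^bsub>regular A\<^esub> y = x \<ominus>\<^bsub>A\<^esub> y"
  by (simp add: a_minus_def a_inv_def m_inv_def regular_def)

lemma opposite_minus: "x \<ominus>\<^bsub>opposite A\<^esub> y = x \<ominus>\<^bsub>A\<^esub> y"
  by (simp add: a_minus_def a_inv_def m_inv_def opposite_def)

lemma star_minus_apply:
  assumes "left_module A P" "f \<in> carrier (star A P)" "g \<in> carrier (star A P)" "x \<in> carrier P"
  shows "(f \<ominus>\<^bsub>star A P\<^esub> g) x = f x \<ominus>\<^bsub>A\<^esub> g x"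
  using lin_map_minus[OF left_module_star[OF assms(1)] left_module_regular lin_map_evaluation[OF assms(4)] assms(2,3)]
    ring_opposite[OF left_module_ring[OF assms(1)]]
  by (simp add: regular_minus opposite_minus)

lemma functional_minus:
  assumes "left_module A P" "f \<in> carrier (star A P)" "x \<in> carrier P" "y \<in> carrier P"
  shows "f (x \<ominus>\<^bsub>P\<^esub> y) = f x \<ominus>\<^bsub>A\<^esub> f y"
  using lin_map_minus[OF assms(1) left_module_regular[OF left_module_ring[OF assms(1)]] _ assms(3,4), of f] assms(2)
  by (simp add: regular_minus star_simps lmod_hom_lin)

lemma functional_lin: "f \<in> carrier (star A P) \<Longrightarrow> lin_map A P (regular A) f"
  by (simp add: star_simps lmod_hom_lin)

lemma functional_zero:
  assumes "left_module A P" "f \<in> carrier (star A P)"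
  shows "f \<zero>\<^bsub>P\<^esub> = \<zero>\<^bsub>A\<^esub>"
  using lin_map_zero[OF assms(1) left_module_regular[OF left_module_ring[OF assms(1)]] functional_lin[OF assms(2)]]
  by simp

text \<open>A functional \<xi> on the dual is evaluation at the sum of \<xi>(c_k) b_k.\<close>

lemma dual_basis_reflexive:
  assumes "dual_basis A P n b c"
    and \<xi>: "lin_map (opposite A) (star A P) (regular (opposite A)) \<xi>"
  obtains x where "x \<in> carrier P" "\<And>f. f \<in> carrier (star A P) \<Longrightarrow> \<xi> f = f x"
proof -
  note db = dual_basisD[OF assms(1)]
  note dbs = dual_basisD[OF dual_basis_star[OF assms(1)]]
  interpret P: left_module A P by (rule db)
  have A: "ring A" by (rule left_module_ring[OF db(1)])
  interpret reg: left_module A "regular A" by (rule left_module_regular[OF A])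
  let ?B = "regular (opposite A)"
  have B: "left_module (opposite A) ?B" by (rule left_module_regular[OF ring_opposite[OF A]])
  have fs: "finsum ?B = finsum (regular A)"
    by (simp add: finsum_def regular_def opposite_def fun_eq_iff)
  define a where "a k = \<xi> (restrict (c k) (carrier P))" for k
  have a: "a k \<in> carrier A" if "k < n" for k
    using lin_map_closed[OF \<xi> dbs(2)[OF that]] by (simp add: a_def)
  have cl: "(\<lambda>k. a k \<odot>\<^bsub>P\<^esub> b k) \<in> {..<n} \<rightarrow> carrier P"
    using a db(2) by (auto intro: P.lsmult_closed)
  show thesis
  proof (rule that)
    show "(\<Oplus>\<^bsub>P\<^esub>k\<in>{..<n}. a k \<odot>\<^bsub>P\<^esub> b k) \<in> carrier P" by (rule P.M.finsum_closed[OF cl])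
    fix f assume f: "f \<in> carrier (star A P)"
    have "\<xi> f = (\<Oplus>\<^bsub>?B\<^esub>k\<in>{..<n}. f (b k) \<odot>\<^bsub>?B\<^esub> a k)"
      unfolding a_def by (rule dual_basis_lin_map[OF dual_basis_star[OF assms(1)] B \<xi> f])
    also have "\<dots> = (\<Oplus>\<^bsub>regular A\<^esub>k\<in>{..<n}. f (a k \<odot>\<^bsub>P\<^esub> b k))"
      unfolding fs using a db(2) star_closed[OF f] lin_map_smult[OF functional_lin[OF f]]
      by (intro reg.M.finsum_cong') auto
    also have "\<dots> = f (\<Oplus>\<^bsub>P\<^esub>k\<in>{..<n}. a k \<odot>\<^bsub>P\<^esub> b k)"
      by (rule lin_map_finsum[OF db(1) reg.left_module_axioms functional_lin[OF f] _ cl, symmetric]) simp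
    finally show "\<xi> f = f (\<Oplus>\<^bsub>P\<^esub>k\<in>{..<n}. a k \<odot>\<^bsub>P\<^esub> b k)" .
  qed
qed

text \<open>Reflexivity with parameters: in this way the dual of a map defined on the dual of
  \<open>P\<close> becomes a map into \<open>P\<close> itself instead of its bidual.\<close>

lemma dual_basis_represent:
  assumes "dual_basis A P n b c" "left_module A L"
    and F: "\<And>l. l \<in> carrier L \<Longrightarrow> lin_map (opposite A) (star A P) (regular (opposite A)) (F l)"
    and add: "\<And>l m f. l \<in> carrier L \<Longrightarrow> m \<in> carrier L \<Longrightarrow> f \<in> carrier (star A P) \<Longrightarrow>
      F (l \<oplus>\<^bsub>L\<^esub> m) f = F l f \<oplus>\<^bsub>A\<^esub> F m f"
    and smult: "\<And>a l f. a \<in> carrier A \<Longrightarrow> l \<in> carrier L \<Longrightarrow> f \<in> carrier (star A P) \<Longrightarrow>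
      F (a \<odot>\<^bsub>L\<^esub> l) f = a \<otimes>\<^bsub>A\<^esub> F l f"
  obtains \<sigma> where "lin_map A L P \<sigma>"
    "\<And>l f. l \<in> carrier L \<Longrightarrow> f \<in> carrier (star A P) \<Longrightarrow> f (\<sigma> l) = F l f"
proof -
  note db = dual_basisD[OF assms(1)]
  interpret P: left_module A P by (rule db)
  interpret L: left_module A L by fact
  define \<sigma> where "\<sigma> l = (SOME x. x \<in> carrier P \<and> (\<forall>f\<in>carrier (star A P). F l f = f x))" for l
  have \<sigma>: "\<sigma> l \<in> carrier P \<and> (\<forall>f\<in>carrier (star A P). F l f = f (\<sigma> l))" if l: "l \<in> carrier L" for l
  proof -
    have "\<exists>x. x \<in> carrier P \<and> (\<forall>f\<in>carrier (star A P). F l f = f x)"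
      by (rule dual_basis_reflexive[OF assms(1) F[OF l]]) blast
    then show ?thesis unfolding \<sigma>_def by (rule someI_ex)
  qed
  show thesis
  proof (rule that)
    show "lin_map A L P \<sigma>"
    proof (rule lin_mapI)
      fix l assume l: "l \<in> carrier L"
      show "\<sigma> l \<in> carrier P" using \<sigma>[OF l] by blast
      show "\<sigma> (l \<oplus>\<^bsub>L\<^esub> m) = \<sigma> l \<oplus>\<^bsub>P\<^esub> \<sigma> m" if m: "m \<in> carrier L" for m
      proof (rule dual_basis_separates[OF assms(1)])
        show "\<sigma> (l \<oplus>\<^bsub>L\<^esub> m) \<in> carrier P" "\<sigma> l \<oplus>\<^bsub>P\<^esub> \<sigma> m \<in> carrier P"
          using \<sigma>[OF l] \<sigma>[OF m] \<sigma>[OF L.M.a_closed[OF l m]] by simp_all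
        show "f (\<sigma> (l \<oplus>\<^bsub>L\<^esub> m)) = f (\<sigma> l \<oplus>\<^bsub>P\<^esub> \<sigma> m)" if f: "f \<in> carrier (star A P)" for f
          using \<sigma>[OF l] \<sigma>[OF m] \<sigma>[OF L.M.a_closed[OF l m]] add[OF l m f] f
            lin_map_add[OF functional_lin[OF f], of "\<sigma> l" "\<sigma> m"] by simp
      qed
      show "\<sigma> (a \<odot>\<^bsub>L\<^esub> l) = a \<odot>\<^bsub>P\<^esub> \<sigma> l" if a: "a \<in> carrier A" for a
      proof (rule dual_basis_separates[OF assms(1)])
        show "\<sigma> (a \<odot>\<^bsub>L\<^esub> l) \<in> carrier P" "a \<odot>\<^bsub>P\<^esub> \<sigma> l \<in> carrier P"
          using \<sigma>[OF l] \<sigma>[OF L.lsmult_closed[OF a l]] a by (simp_all add: P.lsmult_closed)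
        show "f (\<sigma> (a \<odot>\<^bsub>L\<^esub> l)) = f (a \<odot>\<^bsub>P\<^esub> \<sigma> l)" if f: "f \<in> carrier (star A P)" for f
          using \<sigma>[OF l] \<sigma>[OF L.lsmult_closed[OF a l]] smult[OF a l f] f
            lin_map_smult[OF functional_lin[OF f] a, of "\<sigma> l"] by simp
      qed
    qed
    show "f (\<sigma> l) = F l f" if "l \<in> carrier L" "f \<in> carrier (star A P)" for l f
      using \<sigma> that by simp
  qed
qed


text \<open>The dual of the map \<open>p\<close>, written as in \<open>transpose_module\<close> so
  that the submodule factored out there is an image under it.\<close>

definition star_map :: "('a, 'p) module \<Rightarrow> ('p \<Rightarrow> 'q) \<Rightarrow> ('q \<Rightarrow> 'a) \<Rightarrow> 'p \<Rightarrow> 'a" where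
  "star_map P p f = compose (carrier P) f p"

lemma star_map_apply: "x \<in> carrier P \<Longrightarrow> star_map P p f x = f (p x)"
  by (simp add: star_map_def compose_def)

lemma lin_map_star_map:
  assumes "left_module A P" "lin_map A P Q p"
  shows "lin_map (opposite A) (star A Q) (star A P) (star_map P p)"
proof -
  have m: "star_map P p f \<in> carrier (star A P)" if "f \<in> carrier (star A Q)" for f
    unfolding star_map_def compose_def
    by (rule star_restrict[OF assms(1) lin_map_comp[OF assms(2) functional_lin[OF that]]])
  have S: "left_module (opposite A) (star A P)" by (rule left_module_star[OF assms(1)])
  show ?thesis
  proof (rule lin_mapI)
    fix f assume f: "f \<in> carrier (star A Q)"
    show "star_map P p f \<in> carrier (star A P)" by (rule m[OF f])
    show "star_map P p (f \<oplus>\<^bsub>star A Q\<^esub> g) = star_map P p f \<oplus>\<^bsub>star A P\<^esub> star_map P p g"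
      if "g \<in> carrier (star A Q)" for g
      by (rule ext) (simp add: star_map_def compose_def star_simps hom_add_def restrict_def
          lin_map_closed[OF assms(2)])
    show "star_map P p (a \<odot>\<^bsub>star A Q\<^esub> f) = a \<odot>\<^bsub>star A P\<^esub> star_map P p f" for a
      by (rule ext) (simp add: star_map_def compose_def star_simps restrict_def
          lin_map_closed[OF assms(2)])
  qed
qed


section \<open>Resolutions and exactness with various coefficients\<close>

lemma projective_resolutionD:
  assumes "projective_resolution A X P d e" "left_module A X"
  shows "left_module A (P i)" "fin_gen A (P i)" "\<exists>n b c. dual_basis A (P i) n b c"
    "lin_map A (P 0) X e" "e ` carrier (P 0) = carrier X" "lin_map A (P (Suc i)) (P i) (d (Suc i))"
    "x \<in> carrier (P 0) \<Longrightarrow> e x = \<zero>\<^bsub>X\<^esub> \<longleftrightarrow> x \<in> d 1 ` carrier (P 1)"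
    "y \<in> carrier (P (Suc i)) \<Longrightarrow>
       d (Suc i) y = \<zero>\<^bsub>P i\<^esub> \<longleftrightarrow> y \<in> d (Suc (Suc i)) ` carrier (P (Suc (Suc i)))"
    "z \<in> carrier (P (Suc (Suc i))) \<Longrightarrow> d (Suc i) (d (Suc (Suc i)) z) = \<zero>\<^bsub>P i\<^esub>"
    "y \<in> carrier (P 1) \<Longrightarrow> e (d 1 y) = \<zero>\<^bsub>X\<^esub>"
proof -
  have r: "fin_gen A (P i)" "projective A (P i)" "e \<in> lmod_hom A (P 0) X"
    "\<And>i. d (Suc i) \<in> lmod_hom A (P (Suc i)) (P i)" "e ` carrier (P 0) = carrier X"
    "d 1 ` carrier (P 1) = a_kernel (P 0) X e"
    "d (Suc (Suc i)) ` carrier (P (Suc (Suc i))) = a_kernel (P (Suc i)) (P i) (d (Suc i))" for i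
    using assms(1) by (simp_all add: projective_resolution_def)
  show "left_module A (P i)" using r(2) by (simp add: projective_def)
  show "fin_gen A (P i)" by (rule r)
  show "\<exists>n b c. dual_basis A (P i) n b c" using r(1,2) fin_gen_projective_iff by blast
  show "lin_map A (P 0) X e" by (rule lmod_hom_lin[OF r(3)])
  show "e ` carrier (P 0) = carrier X" by (rule r)
  show "lin_map A (P (Suc i)) (P i) (d (Suc i))" by (rule lmod_hom_lin[OF r(4)])
  show "x \<in> carrier (P 0) \<Longrightarrow> e x = \<zero>\<^bsub>X\<^esub> \<longleftrightarrow> x \<in> d 1 ` carrier (P 1)"
    unfolding r(6) by (simp add: a_kernel_def')
  show "y \<in> carrier (P (Suc i)) \<Longrightarrow>
       d (Suc i) y = \<zero>\<^bsub>P i\<^esub> \<longleftrightarrow> y \<in> d (Suc (Suc i)) ` carrier (P (Suc (Suc i)))"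
    unfolding r(7) by (simp add: a_kernel_def')
  show "d (Suc i) (d (Suc (Suc i)) z) = \<zero>\<^bsub>P i\<^esub>" if "z \<in> carrier (P (Suc (Suc i)))"
    using imageI[OF that, of "d (Suc (Suc i))"] unfolding r(7) by (simp add: a_kernel_def')
  show "e (d 1 y) = \<zero>\<^bsub>X\<^esub>" if "y \<in> carrier (P 1)"
    using imageI[OF that, of "d 1"] unfolding r(6) by (simp add: a_kernel_def')
qed

text \<open>Exactness passes from the ring to a projective module coordinatewise: each c_k f extends
  to some h_k, and x \<mapsto> sum of h_k(x) b_k reassembles an extension of
  \<open>f\<close>.\<close>

lemma hom_exact_dual_basis:
  assumes "dual_basis A Y n b c" "hom_exact A P d (regular A) i" "\<And>i. left_module A (P i)"
  shows "hom_exact A P d Y i"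
  unfolding hom_exact_def
proof (intro allI impI)
  note db = dual_basisD[OF assms(1)]
  interpret Y: left_module A Y by (rule db)
  have A: "left_module A (regular A)" by (rule left_module_regular[OF left_module_ring[OF db(1)]])
  let ?P = "carrier (P (Suc i))"
  fix f assume f: "lin_map A (P (Suc i)) Y f \<and>
    (\<forall>x\<in>carrier (P (Suc (Suc i))). f (d (Suc (Suc i)) x) = \<zero>\<^bsub>Y\<^esub>)"
  have "\<exists>h. lin_map A (P i) (regular A) h \<and> (\<forall>x\<in>?P. h (d (Suc i) x) = c k (f x))" if k: "k < n" for k
    using assms(2)[unfolded hom_exact_def, rule_format, of "\<lambda>x. c k (f x)"] f
      lin_map_comp[OF _ db(3)[OF k], of "P (Suc i)" f] lin_map_zero[OF db(1) A db(3)[OF k]]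
    by simp
  then have "\<exists>h. \<forall>k<n. lin_map A (P i) (regular A) (h k) \<and> (\<forall>x\<in>?P. h k (d (Suc i) x) = c k (f x))"
    by (intro choice) blast
  then obtain h where h: "\<And>k. k < n \<Longrightarrow> lin_map A (P i) (regular A) (h k)"
    "\<And>k x. k < n \<Longrightarrow> x \<in> ?P \<Longrightarrow> h k (d (Suc i) x) = c k (f x)"
    by blast
  let ?h = "\<lambda>x. \<Oplus>\<^bsub>Y\<^esub>k\<in>{..<n}. h k x \<odot>\<^bsub>Y\<^esub> b k"
  have "lin_map A (P i) Y ?h"
    by (intro lin_map_comb assms(3) db h)
  moreover have "?h (d (Suc i) x) = f x" if x: "x \<in> ?P" for x
  proof -
    have fx: "f x \<in> carrier Y" by (rule lin_map_closed[OF conjunct1[OF f] x])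
    have "?h (d (Suc i) x) = (\<Oplus>\<^bsub>Y\<^esub>k\<in>{..<n}. c k (f x) \<odot>\<^bsub>Y\<^esub> b k)"
      using h(2)[OF _ x] db(2) db(4)[OF _ fx] by (intro Y.M.finsum_cong') (auto intro: Y.lsmult_closed)
    then show ?thesis using db(5)[OF fx] by simp
  qed
  ultimately show "\<exists>h. lin_map A (P i) Y h \<and> (\<forall>x\<in>?P. h (d (Suc i) x) = f x)" by blast
qed


text \<open>
  For a cochain complex \<open>L\<^sub>0 \<rightarrow> L\<^sub>1 \<rightarrow> \<dots>\<close> with differentials \<open>D i : L i \<rightarrow> L (Suc i)\<close>: exactness of
  \<open>Hom(L, X)\<close> at \<open>L\<^sub>i\<^sub>+\<^sub>1\<close>. When \<open>L\<close> is the dual of a projective resolution of a right module \<open>T\<close>,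
  this says \<open>Tor\<^sub>i\<^sub>+\<^sub>1(T, X) = 0\<close>.
\<close>

definition cohom_exact ::
  "('a, 'c) ring_scheme \<Rightarrow> (nat \<Rightarrow> ('a, 'l) module) \<Rightarrow> (nat \<Rightarrow> 'l \<Rightarrow> 'l) \<Rightarrow>
     ('a, 'x) module \<Rightarrow> nat \<Rightarrow> bool" where
  "cohom_exact A L D X i \<longleftrightarrow>
     (\<forall>g. lin_map A (L (Suc i)) X g \<and> (\<forall>x\<in>carrier (L i). g (D i x) = \<zero>\<^bsub>X\<^esub>) \<longrightarrow>
       (\<exists>h. lin_map A (L (Suc (Suc i))) X h \<and> (\<forall>x\<in>carrier (L (Suc i)). h (D (Suc i) x) = g x)))"

lemma cohom_exactE:
  assumes "cohom_exact A L D X i" "lin_map A (L (Suc i)) X g"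
    and "\<And>x. x \<in> carrier (L i) \<Longrightarrow> g (D i x) = \<zero>\<^bsub>X\<^esub>"
  obtains h where "lin_map A (L (Suc (Suc i))) X h"
    "\<And>x. x \<in> carrier (L (Suc i)) \<Longrightarrow> h (D (Suc i) x) = g x"
  using assms unfolding cohom_exact_def by blast

text \<open>Dimension shift along \<open>0 \<rightarrow> K\<^sub>j\<^sub>+\<^sub>1 \<rightarrow> P\<^sub>j \<rightarrow> K\<^sub>j \<rightarrow> 0\<close>.\<close>

lemma cohom_exact_shift:
  fixes K :: "nat \<Rightarrow> ('a, 'k) module" and P :: "nat \<Rightarrow> ('a, 'p) module"
  assumes L: "\<And>i. \<exists>n b c. dual_basis A (L i) n b c"
    and D: "\<And>i. lin_map A (L i) (L (Suc i)) (D i)"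
    and DD: "\<And>i x. x \<in> carrier (L i) \<Longrightarrow> D (Suc i) (D i x) = \<zero>\<^bsub>L (Suc (Suc i))\<^esub>"
    and K: "\<And>j. left_module A (K j)" and P: "\<And>j. left_module A (P j)"
    and \<pi>: "\<And>j. lin_map A (P j) (K j) (\<pi> j)" "\<And>j. \<pi> j ` carrier (P j) = carrier (K j)"
    and \<iota>: "\<And>j. lin_map A (K (Suc j)) (P j) (\<iota> j)" "\<And>j. inj_on (\<iota> j) (carrier (K (Suc j)))"
    and ker: "\<And>j x. x \<in> carrier (P j) \<Longrightarrow> \<pi> j x = \<zero>\<^bsub>K j\<^esub> \<longleftrightarrow> x \<in> \<iota> j ` carrier (K (Suc j))"
    and PE: "\<And>i j. cohom_exact A L D (P j) i"
    and base: "\<And>i. enat (Suc i) \<le> t \<Longrightarrow> cohom_exact A L D (K 0) i"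
  shows "enat (Suc i + j) \<le> t \<Longrightarrow> cohom_exact A L D (K j) i"
proof (induction j arbitrary: i)
  case 0
  then show ?case using base by simp
next
  case (Suc j)
  show ?case
    unfolding cohom_exact_def
  proof (intro allI impI)
    fix g assume "lin_map A (L (Suc i)) (K (Suc j)) g \<and> (\<forall>x\<in>carrier (L i). g (D i x) = \<zero>\<^bsub>K (Suc j)\<^esub>)"
    then have g: "lin_map A (L (Suc i)) (K (Suc j)) g"
      and g0: "\<And>x. x \<in> carrier (L i) \<Longrightarrow> g (D i x) = \<zero>\<^bsub>K (Suc j)\<^esub>" by blast+
    have lL: "left_module A (L i)" for i using L[of i] dual_basisD(1) by blast
    interpret Pj: left_module A "P j" by (rule P)
    interpret Kj: left_module A "K j" by (rule K)
    note Dc = lin_map_closed[OF D]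
    \<comment> \<open>\<open>P j\<close> has no cohomology in this degree, so \<iota> g extends; the
      task is to move the extension back into K_(j+1).\<close>
    obtain h where h: "lin_map A (L (Suc (Suc i))) (P j) h"
      "\<And>x. x \<in> carrier (L (Suc i)) \<Longrightarrow> h (D (Suc i) x) = \<iota> j (g x)"
      by (rule cohom_exactE[OF PE lin_map_comp[OF g \<iota>(1)]])
        (use g0 lin_map_zero[OF K P \<iota>(1)] in auto)
    have \<pi>\<iota>: "\<pi> j (\<iota> j x) = \<zero>\<^bsub>K j\<^esub>" if "x \<in> carrier (K (Suc j))" for x
      using ker[of "\<iota> j x" j] lin_map_closed[OF \<iota>(1) that] that by blast
    \<comment> \<open>One step in the resolution is traded for one cohomological degree, so the
      bound on the sum stays the same. This is why the induction keeps \<open>i\<close>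
      arbitrary.\<close>
    have "enat (Suc (Suc i) + j) \<le> t" using Suc.prems by simp
    note IH = Suc.IH[OF this]
    obtain k where k: "lin_map A (L (Suc (Suc (Suc i)))) (K j) k"
      "\<And>x. x \<in> carrier (L (Suc (Suc i))) \<Longrightarrow> k (D (Suc (Suc i)) x) = \<pi> j (h x)"
      by (rule cohom_exactE[OF IH lin_map_comp[OF h(1) \<pi>(1)]])
        (use h(2) \<pi>\<iota> lin_map_closed[OF g] in auto)
    obtain n b c where db: "dual_basis A (L (Suc (Suc (Suc i)))) n b c" using L by blast
    obtain k' where k': "lin_map A (L (Suc (Suc (Suc i)))) (P j) k'"
      "\<And>x. x \<in> carrier (L (Suc (Suc (Suc i)))) \<Longrightarrow> \<pi> j (k' x) = k x"
      by (rule dual_basis_lift[OF db P K \<pi>(1) k(1)])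
        (use \<pi>(2) lin_map_closed[OF k(1)] in auto)
    \<comment> \<open>Subtracting k' D moves \<open>h\<close> into the kernel of \<pi>, which is the
      image of K_(j+1), and does not change its values on the image of the previous differential,
      because D D = 0.\<close>
    let ?m = "\<lambda>x. h x \<ominus>\<^bsub>P j\<^esub> k' (D (Suc (Suc i)) x)"
    have m: "lin_map A (L (Suc (Suc i))) (P j) ?m"
      by (rule lin_map_diff[OF lL P h(1) lin_map_comp[OF D k'(1)]])
    have \<pi>m: "\<pi> j (?m x) = \<zero>\<^bsub>K j\<^esub>" if x: "x \<in> carrier (L (Suc (Suc i)))" for x
      using x lin_map_closed[OF h(1) x] lin_map_closed[OF k'(1) Dc[OF x]] k(2) k'(2)[OF Dc[OF x]]
        lin_map_closed[OF \<pi>(1) lin_map_closed[OF h(1) x]]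
      by (simp add: lin_map_minus[OF P K \<pi>(1)] Kj.M.minus_eq_zero_iff)
    obtain n2 b2 c2 where db2: "dual_basis A (L (Suc (Suc i))) n2 b2 c2" using L by blast
    obtain m' where m': "lin_map A (L (Suc (Suc i))) (K (Suc j)) m'"
      "\<And>x. x \<in> carrier (L (Suc (Suc i))) \<Longrightarrow> \<iota> j (m' x) = ?m x"
    proof (rule dual_basis_lift[OF db2 K P \<iota>(1) m])
      show "?m x \<in> \<iota> j ` carrier (K (Suc j))" if x: "x \<in> carrier (L (Suc (Suc i)))" for x
        using ker[OF lin_map_closed[OF m x]] \<pi>m[OF x] by blast
    qed iprover
    have "m' (D (Suc i) x) = g x" if x: "x \<in> carrier (L (Suc i))" for x
    proof -
      have "\<iota> j (m' (D (Suc i) x)) = \<iota> j (g x) \<ominus>\<^bsub>P j\<^esub> \<zero>\<^bsub>P j\<^esub>"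
        using m'(2)[OF Dc[OF x]] h(2)[OF x] DD[OF x] lin_map_zero[OF lL P k'(1)] by simp
      also have "\<dots> = \<iota> j (g x)"
        using lin_map_closed[OF \<iota>(1) lin_map_closed[OF g x]] by (simp add: a_minus_def)
      finally show ?thesis
        using inj_onD[OF \<iota>(2)] lin_map_closed[OF m'(1) Dc[OF x]] lin_map_closed[OF g x] by blast
    qed
    then show "\<exists>h. lin_map A (L (Suc (Suc i))) (K (Suc j)) h \<and>
        (\<forall>x\<in>carrier (L (Suc i)). h (D (Suc i) x) = g x)"
      using m'(1) by blast
  qed
qed

section \<open>The transpose and lifting\<close>

text \<open>The dual of a right module is a left module: the facts on \<open>star\<close> are taken
  over \<open>opposite A\<close>, and \<open>opposite (opposite A)\<close> simplifies to
  \<open>A\<close>.\<close>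

lemma costar:
  shows left_module_costar: "left_module (opposite A) Q \<Longrightarrow> left_module A (star (opposite A) Q)"
    and dual_basis_costar: "dual_basis (opposite A) Q n b c \<Longrightarrow>
      dual_basis A (star (opposite A) Q) n (\<lambda>k. restrict (c k) (carrier Q)) (\<lambda>k f. f (b k))"
    and lin_map_coevaluation: "x \<in> carrier Q \<Longrightarrow>
      lin_map A (star (opposite A) Q) (regular A) (\<lambda>f. f x)"
    and lin_map_costar_map: "left_module (opposite A) Q \<Longrightarrow> lin_map (opposite A) Q Q' p \<Longrightarrow>
      lin_map A (star (opposite A) Q') (star (opposite A) Q) (star_map Q p)"
  using left_module_star[of "opposite A" Q] dual_basis_star[of "opposite A" Q n b c]
    lin_map_evaluation[of x Q "opposite A"] lin_map_star_map[of "opposite A" Q Q' p]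
  by simp_all

abbreviation dual_complex ::
  "('a, 'c) ring_scheme \<Rightarrow> (nat \<Rightarrow> ('a, 'q) module) \<Rightarrow> nat \<Rightarrow> ('a, 'q \<Rightarrow> 'a) module" where
  "dual_complex A Q i \<equiv> star (opposite A) (Q i)"

abbreviation dual_differential ::
  "(nat \<Rightarrow> ('a, 'q) module) \<Rightarrow> (nat \<Rightarrow> 'q \<Rightarrow> 'q) \<Rightarrow> nat \<Rightarrow> ('q \<Rightarrow> 'a) \<Rightarrow> 'q \<Rightarrow> 'a" where
  "dual_differential Q d i \<equiv> star_map (Q (Suc i)) (d (Suc i))"

lemma dual_complex:
  assumes "projective_resolution (opposite A) T Q d e" "left_module (opposite A) T"
  shows "left_module A (dual_complex A Q i)" "\<exists>n b c. dual_basis A (dual_complex A Q i) n b c"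
    "lin_map A (dual_complex A Q i) (dual_complex A Q (Suc i)) (dual_differential Q d i)"
    "f \<in> carrier (dual_complex A Q i) \<Longrightarrow> dual_differential Q d (Suc i) (dual_differential Q d i f)
       = \<zero>\<^bsub>dual_complex A Q (Suc (Suc i))\<^esub>"
proof -
  note r = projective_resolutionD[OF assms]
  show l: "left_module A (dual_complex A Q i)" for i by (rule left_module_costar[OF r(1)])
  show "\<exists>n b c. dual_basis A (dual_complex A Q i) n b c"
    using r(3)[of i] dual_basis_costar by blast
  show D: "lin_map A (dual_complex A Q i) (dual_complex A Q (Suc i)) (dual_differential Q d i)" for i
    by (rule lin_map_costar_map[OF r(1,6)])
  show "dual_differential Q d (Suc i) (dual_differential Q d i f)
       = \<zero>\<^bsub>dual_complex A Q (Suc (Suc i))\<^esub>" if f: "f \<in> carrier (dual_complex A Q i)"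
  proof (rule star_eqI)
    show "dual_differential Q d (Suc i) (dual_differential Q d i f) \<in> carrier (dual_complex A Q (Suc (Suc i)))"
      by (intro lin_map_closed[OF D] f)
    show "\<zero>\<^bsub>dual_complex A Q (Suc (Suc i))\<^esub> \<in> carrier (dual_complex A Q (Suc (Suc i)))"
      by (rule left_module_zero[OF l])
    show "dual_differential Q d (Suc i) (dual_differential Q d i f) x
        = \<zero>\<^bsub>dual_complex A Q (Suc (Suc i))\<^esub> x" if x: "x \<in> carrier (Q (Suc (Suc i)))" for x
      using x lin_map_closed[OF r(6) x] r(9)[OF x] functional_zero[OF r(1) f]
      by (simp add: star_map_apply star_zero_apply)
  qed
qed

text \<open>By reflexivity each c_k g is evaluation at some x in Q_(i+1). As \<open>g\<close> kills
  the coboundaries, x is a cycle, hence x = d q_k for some q_k, and f \<mapsto> sum of f(q_k) b_k is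
  the required extension.\<close>

lemma cohom_exact_projective:
  assumes "projective_resolution (opposite A) T Q d e" "left_module (opposite A) T"
    and "dual_basis A P n b c"
  shows "cohom_exact A (dual_complex A Q) (dual_differential Q d) P i"
  unfolding cohom_exact_def
proof (intro allI impI)
  note r = projective_resolutionD[OF assms(1,2)]
  note dc = dual_complex[OF assms(1,2)]
  note db = dual_basisD[OF assms(3)]
  interpret P: left_module A P by (rule db)
  let ?L = "\<lambda>i. carrier (dual_complex A Q i)"
  fix g assume "lin_map A (dual_complex A Q (Suc i)) P g \<and>
    (\<forall>f\<in>?L i. g (dual_differential Q d i f) = \<zero>\<^bsub>P\<^esub>)"
  then have g: "lin_map A (dual_complex A Q (Suc i)) P g"
    and g0: "\<And>f. f \<in> ?L i \<Longrightarrow> g (dual_differential Q d i f) = \<zero>\<^bsub>P\<^esub>" by blast+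
  have A: "left_module A (regular A)" by (rule left_module_regular[OF left_module_ring[OF db(1)]])
  have "\<exists>q. q \<in> carrier (Q (Suc (Suc i))) \<and> (\<forall>f\<in>?L (Suc i). c k (g f) = f (d (Suc (Suc i)) q))"
    if k: "k < n" for k
  proof -
    obtain n' b' c' where db': "dual_basis (opposite A) (Q (Suc i)) n' b' c'" using r(3) by blast
    obtain n2 b2 c2 where db2: "dual_basis (opposite A) (Q i) n2 b2 c2" using r(3) by blast
    have "lin_map (opposite (opposite A)) (dual_complex A Q (Suc i)) (regular (opposite (opposite A)))
        (\<lambda>f. c k (g f))"
      using lin_map_comp[OF g db(3)[OF k]] by simp
    then obtain x where x: "x \<in> carrier (Q (Suc i))" "\<And>f. f \<in> ?L (Suc i) \<Longrightarrow> c k (g f) = f x"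
      by (rule dual_basis_reflexive[OF db']) iprover
    have "d (Suc i) x = \<zero>\<^bsub>Q i\<^esub>"
    proof (rule dual_basis_separates[OF db2])
      show "d (Suc i) x \<in> carrier (Q i)" by (rule lin_map_closed[OF r(6) x(1)])
      show "\<zero>\<^bsub>Q i\<^esub> \<in> carrier (Q i)" by (rule left_module_zero[OF r(1)])
      show "f (d (Suc i) x) = f \<zero>\<^bsub>Q i\<^esub>" if f: "f \<in> ?L i" for f
        using x(2)[OF lin_map_closed[OF dc(3) f]] g0[OF f] lin_map_zero[OF db(1) A db(3)[OF k]]
          functional_zero[OF r(1) f] x(1) by (simp add: star_map_apply)
    qed
    then have "x \<in> d (Suc (Suc i)) ` carrier (Q (Suc (Suc i)))" using r(8)[OF x(1)] by simp
    then show ?thesis using x(2) by blast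
  qed
  then have "\<exists>q. \<forall>k<n. q k \<in> carrier (Q (Suc (Suc i))) \<and>
      (\<forall>f\<in>?L (Suc i). c k (g f) = f (d (Suc (Suc i)) (q k)))"
    by (intro choice) blast
  then obtain q where q: "\<And>k. k < n \<Longrightarrow> q k \<in> carrier (Q (Suc (Suc i)))"
    "\<And>k f. k < n \<Longrightarrow> f \<in> ?L (Suc i) \<Longrightarrow> c k (g f) = f (d (Suc (Suc i)) (q k))"
    by blast
  let ?h = "\<lambda>f. \<Oplus>\<^bsub>P\<^esub>k\<in>{..<n}. f (q k) \<odot>\<^bsub>P\<^esub> b k"
  have "lin_map A (dual_complex A Q (Suc (Suc i))) P ?h"
    by (intro lin_map_comb dc(1) db lin_map_coevaluation q)
  moreover have "?h (dual_differential Q d (Suc i) f) = g f" if f: "f \<in> ?L (Suc i)" for f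
  proof -
    have gf: "g f \<in> carrier P" by (rule lin_map_closed[OF g f])
    have "?h (dual_differential Q d (Suc i) f) = (\<Oplus>\<^bsub>P\<^esub>k\<in>{..<n}. c k (g f) \<odot>\<^bsub>P\<^esub> b k)"
      using q db(2) db(4)[OF _ gf] f
      by (intro P.M.finsum_cong') (auto simp: star_map_apply intro: P.lsmult_closed)
    then show ?thesis using db(5)[OF gf] by simp
  qed
  ultimately show "\<exists>h. lin_map A (dual_complex A Q (Suc (Suc i))) P h \<and>
      (\<forall>f\<in>?L (Suc i). h (dual_differential Q d (Suc i) f) = g f)" by blast
qed

text \<open>A cocycle of the dual complex is a coboundary by hypothesis, so \<open>g\<close>
  vanishes on the kernel of the differential. It is therefore defined on the image, from which
  injectivity of the dual of the ring extends it.\<close>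

lemma (in artin_algebra) cohom_exact_dual:
  assumes "projective_resolution (opposite A) T Q d e" "left_module (opposite A) T"
    and "hom_exact (opposite A) Q d (regular (opposite A)) i"
    and "injective R J"
  shows "cohom_exact A (dual_complex A Q) (dual_differential Q d) (dual_regular J) i"
  unfolding cohom_exact_def
proof (intro allI impI)
  note r = projective_resolutionD[OF assms(1,2)]
  note dc = dual_complex[OF assms(1,2)]
  let ?L = "\<lambda>i. carrier (dual_complex A Q i)"
  fix g assume "lin_map A (dual_complex A Q (Suc i)) (dual_regular J) g \<and>
    (\<forall>f\<in>?L i. g (dual_differential Q d i f) = \<zero>\<^bsub>dual_regular J\<^esub>)"
  then have g: "lin_map A (dual_complex A Q (Suc i)) (dual_regular J) g"
    and g0: "\<And>f. f \<in> ?L i \<Longrightarrow> g (dual_differential Q d i f) = \<zero>\<^bsub>dual_regular J\<^esub>" by blast+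
  have fg: "fin_gen A (dual_complex A Q (Suc (Suc i)))"
    using dc(2) dual_basis_fin_gen by blast
  have ker: "g f = \<zero>\<^bsub>dual_regular J\<^esub>" if f: "f \<in> ?L (Suc i)"
    and Df: "dual_differential Q d (Suc i) f = \<zero>\<^bsub>dual_complex A Q (Suc (Suc i))\<^esub>" for f
  proof -
    have "f (d (Suc (Suc i)) x) = \<zero>\<^bsub>regular (opposite A)\<^esub>" if x: "x \<in> carrier (Q (Suc (Suc i)))" for x
      using fun_cong[OF Df, of x] x by (simp add: star_map_apply star_zero_apply)
    then obtain h where h: "lin_map (opposite A) (Q i) (regular (opposite A)) h"
      "\<And>x. x \<in> carrier (Q (Suc i)) \<Longrightarrow> h (d (Suc i) x) = f x"
      using assms(3)[unfolded hom_exact_def, rule_format, of f] functional_lin[OF f] by blast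
    let ?h = "restrict h (carrier (Q i))"
    have hL: "?h \<in> ?L i" by (rule star_restrict[OF r(1) h(1)])
    have "dual_differential Q d i ?h = f"
      using h(2) lin_map_closed[OF r(6)]
      by (intro star_eqI[OF lin_map_closed[OF dc(3) hL] f]) (simp add: star_map_apply)
    then show ?thesis using g0[OF hL] by simp
  qed
  obtain h where "lin_map A (dual_complex A Q (Suc (Suc i))) (dual_regular J) h"
    "\<And>f. f \<in> ?L (Suc i) \<Longrightarrow> h (dual_differential Q d (Suc i) f) = g f"
    by (rule dual_regular_extend[OF assms(4) dc(1) dc(1) fg dc(3) g ker]) blast+
  then show "\<exists>h. lin_map A (dual_complex A Q (Suc (Suc i))) (dual_regular J) h \<and>
      (\<forall>f\<in>?L (Suc i). h (dual_differential Q d (Suc i) f) = g f)" by blast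
qed

text \<open>
  If \<open>Tor\<^sub>1(Tr M, X) = 0\<close>, then every map \<open>M \<rightarrow> X\<close> factors through a projective module and hence
  lifts to \<open>Y\<close>; here \<open>M\<close> is the cokernel of \<open>p\<close>.
  The resolution of \<open>T\<close> need not begin with \<open>P0\<^sup>* \<rightarrow> P1\<^sup>* \<rightarrow> T\<close>, so the two are compared by chain maps
  \<open>\<phi>\<close>, \<open>\<psi>\<close> in degrees 0 and 1 and a homotopy \<open>s\<close>; all of them are then dualized.
\<close>

lemma lift_of_transpose:
  fixes A :: "('a, 'c) ring_scheme"
  assumes P1: "dual_basis A P1 n1 b1 c1" and P0: "dual_basis A P0 n0 b0 c0"
    and p: "lin_map A P1 P0 p"
    and T: "T = quotient_module (star A P1) (star_map P1 p ` carrier (star A P0))"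
    and res: "projective_resolution (opposite A) T Q d e"
    and X: "left_module A X" and Y: "left_module A Y"
    and \<pi>: "lin_map A Y X \<pi>" "\<pi> ` carrier Y = carrier X"
    and ex: "cohom_exact A (dual_complex A Q) (dual_differential Q d) X 0"
    and u: "lin_map A P0 X u" "\<And>z. z \<in> carrier P1 \<Longrightarrow> u (p z) = \<zero>\<^bsub>X\<^esub>"
  obtains w where "lin_map A P0 Y w" "\<And>x. x \<in> carrier P0 \<Longrightarrow> \<pi> (w x) = u x"
    "\<And>z. z \<in> carrier P1 \<Longrightarrow> w (p z) = \<zero>\<^bsub>Y\<^esub>"
proof -
  let ?B = "opposite A" and ?S0 = "star A P0" and ?S1 = "star A P1" and ?p = "star_map P1 p"
  note db1 = dual_basisD[OF P1] and db0 = dual_basisD[OF P0]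
  note sdb1 = dual_basis_star[OF P1] and sdb0 = dual_basis_star[OF P0]
  have S1: "left_module ?B ?S1" and S0: "left_module ?B ?S0"
    using left_module_star db1(1) db0(1) by blast+
  have sp: "lin_map ?B ?S0 ?S1 ?p" by (rule lin_map_star_map[OF db1(1) p])
  let ?N = "?p ` carrier ?S0"
  have N: "submodule ?N ?B ?S1"
    by (rule submodule_image[OF S0 S1 sp left_module.submodule_carrier[OF S0]])
  let ?q = "\<lambda>x. ?N +>\<^bsub>?S1\<^esub> x"
  note qm = quotient_module[OF S1 N, folded T]
  note r = projective_resolutionD[OF res qm(1)]
  note dc = dual_complex[OF res qm(1)]
  interpret P0: left_module A P0 by (rule db0(1))
  interpret X: left_module A X by (rule X)
  interpret Y: left_module A Y by (rule Y)
  interpret S1: left_module ?B ?S1 by (rule S1)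
  interpret T: left_module ?B T by (rule qm(1))
  have A: "ring A" by (rule left_module_ring[OF X])
  have regB: "left_module ?B (regular ?B)" by (rule left_module_regular[OF ring_opposite[OF A]])

  obtain m0 v0 w0 where Q0: "dual_basis ?B (Q 0) m0 v0 w0" using r(3) by blast
  obtain m1 v1 w1 where Q1: "dual_basis ?B (Q 1) m1 v1 w1" using r(3) by blast
  have d1: "lin_map ?B (Q 1) (Q 0) (d 1)" using r(6)[of 0] by simp
  \<comment> \<open>\<phi> and \<psi> compare \<open>Q 1\<close>, \<open>Q 0\<close> with
    \<open>?S0\<close>, \<open>?S1\<close> in both directions, over the identity of
    \<open>T\<close>.\<close>
  obtain \<phi>0 where \<phi>0: "lin_map ?B (Q 0) ?S1 \<phi>0" "\<And>y. y \<in> carrier (Q 0) \<Longrightarrow> ?q (\<phi>0 y) = e y"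
    by (rule dual_basis_lift[OF Q0 S1 qm(1,2) r(4)]) (use r(4) qm(3) lin_map_closed in auto)
  obtain \<phi>1 where \<phi>1: "lin_map ?B (Q 1) ?S0 \<phi>1" "\<And>y. y \<in> carrier (Q 1) \<Longrightarrow> ?p (\<phi>1 y) = \<phi>0 (d 1 y)"
  proof (rule dual_basis_lift[OF Q1 S0 S1 sp lin_map_comp[OF d1 \<phi>0(1)]])
    show "\<phi>0 (d 1 y) \<in> ?N" if y: "y \<in> carrier (Q 1)" for y
      using qm(4)[OF lin_map_closed[OF \<phi>0(1) lin_map_closed[OF d1 y]]]
        \<phi>0(2)[OF lin_map_closed[OF d1 y]] r(10)[OF y] by simp
  qed iprover
  obtain \<psi>0 where \<psi>0: "lin_map ?B ?S1 (Q 0) \<psi>0" "\<And>y. y \<in> carrier ?S1 \<Longrightarrow> e (\<psi>0 y) = ?q y"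
    by (rule dual_basis_lift[OF sdb1 r(1) qm(1) r(4) qm(2)])
      (simp_all add: r(5) lin_map_closed[OF qm(2)])
  obtain \<psi>1 where \<psi>1: "lin_map ?B ?S0 (Q 1) \<psi>1" "\<And>y. y \<in> carrier ?S0 \<Longrightarrow> d 1 (\<psi>1 y) = \<psi>0 (?p y)"
  proof (rule dual_basis_lift[OF sdb0 r(1) r(1) d1 lin_map_comp[OF sp \<psi>0(1)]])
    show "\<psi>0 (?p y) \<in> d 1 ` carrier (Q 1)" if y: "y \<in> carrier ?S0" for y
      using r(7)[OF lin_map_closed[OF \<psi>0(1) lin_map_closed[OF sp y]]]
        \<psi>0(2)[OF lin_map_closed[OF sp y]] qm(4)[OF lin_map_closed[OF sp y]] y by simp
  qed iprover
  \<comment> \<open>\<phi>0 \<psi>0 and the identity induce the same map on \<open>T\<close>, so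
    their difference takes values in the image of \<open>?p\<close>; lifting it along
    \<open>?p\<close> gives the homotopy.\<close>
  let ?t = "\<lambda>y. \<phi>0 (\<psi>0 y) \<ominus>\<^bsub>?S1\<^esub> y"
  have t: "lin_map ?B ?S1 ?S1 ?t"
    by (rule lin_map_diff[OF S1 S1 lin_map_comp[OF \<psi>0(1) \<phi>0(1)] lin_map_id])
  obtain s where s: "lin_map ?B ?S1 ?S0 s" "\<And>y. y \<in> carrier ?S1 \<Longrightarrow> ?p (s y) = ?t y"
  proof (rule dual_basis_lift[OF sdb1 S0 S1 sp t])
    show "?t y \<in> ?N" if y: "y \<in> carrier ?S1" for y
    proof -
      have "?q (?t y) = \<zero>\<^bsub>T\<^esub>"
        using y lin_map_closed[OF \<psi>0(1) y] \<phi>0 \<psi>0(2)[OF y] lin_map_closed[OF \<phi>0(1)] lin_map_closed[OF qm(2) y]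
        by (simp add: lin_map_minus[OF S1 qm(1,2)] T.M.minus_eq_zero_iff)
      then show ?thesis using qm(4)[OF lin_map_closed[OF t y]] by simp
    qed
  qed iprover

  let ?L = "\<lambda>i. carrier (dual_complex A Q i)"
  have \<psi>_sharp: "lin_map ?B (star A P) (regular ?B) (\<lambda>f. l (\<psi> f))"
    if "lin_map ?B (star A P) (Q i) \<psi>" "l \<in> ?L i" for P \<psi> i l
    by (rule lin_map_comp[OF that(1) functional_lin[OF that(2)]])
  \<comment> \<open>The duals of \<psi>1, \<psi>0 and s take values in biduals, which reflexivity
    identifies with \<open>P0\<close> and \<open>P1\<close>. For the dual of \<phi>1, restricted to
    \<open>P0\<close>, no such identification is needed.\<close>
  obtain \<psi>1' where \<psi>1': "lin_map A (dual_complex A Q 1) P0 \<psi>1'"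
    "\<And>l f. l \<in> ?L 1 \<Longrightarrow> f \<in> carrier ?S0 \<Longrightarrow> f (\<psi>1' l) = l (\<psi>1 f)"
    by (rule dual_basis_represent[OF P0 dc(1), where F = "\<lambda>l f. l (\<psi>1 f)"])
      (auto simp: star_add_apply star_smult_apply lin_map_closed[OF \<psi>1(1)]
         simp del: One_nat_def intro: \<psi>_sharp[OF \<psi>1(1)])
  obtain \<psi>0' where \<psi>0': "lin_map A (dual_complex A Q 0) P1 \<psi>0'"
    "\<And>l f. l \<in> ?L 0 \<Longrightarrow> f \<in> carrier ?S1 \<Longrightarrow> f (\<psi>0' l) = l (\<psi>0 f)"
    by (rule dual_basis_represent[OF P1 dc(1), where F = "\<lambda>l f. l (\<psi>0 f)"])
      (auto simp: star_add_apply star_smult_apply lin_map_closed[OF \<psi>0(1)] intro: \<psi>_sharp[OF \<psi>0(1)])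
  have sc: "s f \<in> carrier ?S0" if "f \<in> carrier ?S1" for f by (rule lin_map_closed[OF s(1) that])
  obtain s' where s': "lin_map A P0 P1 s'"
    "\<And>x f. x \<in> carrier P0 \<Longrightarrow> f \<in> carrier ?S1 \<Longrightarrow> f (s' x) = s f x"
    by (rule dual_basis_represent[OF P1 db0(1), where F = "\<lambda>x f. s f x"])
      (auto simp: lin_map_add[OF functional_lin[OF sc]] lin_map_smult[OF functional_lin[OF sc]]
         intro: lin_map_comp[OF s(1) lin_map_evaluation])
  define \<phi>1' where "\<phi>1' x = (\<lambda>q\<in>carrier (Q 1). \<phi>1 q x)" for x
  have \<phi>1c: "\<phi>1 q \<in> carrier ?S0" if "q \<in> carrier (Q 1)" for q by (rule lin_map_closed[OF \<phi>1(1) that])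
  have \<phi>1'c: "\<phi>1' x \<in> ?L 1" if x: "x \<in> carrier P0" for x
    unfolding \<phi>1'_def by (rule star_restrict[OF r(1) lin_map_comp[OF \<phi>1(1) lin_map_evaluation[OF x]]])
  have \<phi>1': "lin_map A P0 (dual_complex A Q 1) \<phi>1'"
  proof (rule lin_mapI)
    fix x assume x: "x \<in> carrier P0"
    show "\<phi>1' x \<in> ?L 1" by (rule \<phi>1'c[OF x])
    show "\<phi>1' (x \<oplus>\<^bsub>P0\<^esub> y) = \<phi>1' x \<oplus>\<^bsub>dual_complex A Q 1\<^esub> \<phi>1' y" if y: "y \<in> carrier P0" for y
      using x y by (intro star_eqI[OF \<phi>1'c left_module_add[OF dc(1) \<phi>1'c \<phi>1'c]])
        (auto simp: star_add_apply \<phi>1'_def lin_map_add[OF functional_lin[OF \<phi>1c]])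
    show "\<phi>1' (a \<odot>\<^bsub>P0\<^esub> x) = a \<odot>\<^bsub>dual_complex A Q 1\<^esub> \<phi>1' x" if a: "a \<in> carrier A" for a
      using x a by (intro star_eqI[OF \<phi>1'c left_module_smult[OF dc(1) a \<phi>1'c]])
        (auto simp: star_smult_apply \<phi>1'_def lin_map_smult[OF functional_lin[OF \<phi>1c]] P0.lsmult_closed)
  qed

  \<comment> \<open>Dualizing d \<psi>1 = \<psi>0 \<open>?p\<close> gives \<psi>1' D = p \<psi>0'.
    As u p = 0, the map u \<psi>1' is a cocycle, and exactness extends it along the next
    differential.\<close>
  have "u (\<psi>1' (dual_differential Q d 0 g)) = \<zero>\<^bsub>X\<^esub>" if g: "g \<in> ?L 0" for g
  proof -
    have Dg: "dual_differential Q d 0 g \<in> ?L 1" using lin_map_closed[OF dc(3) g] by simp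
    have "\<psi>1' (dual_differential Q d 0 g) = p (\<psi>0' g)"
    proof (rule dual_basis_separates[OF P0])
      show "\<psi>1' (dual_differential Q d 0 g) \<in> carrier P0" by (rule lin_map_closed[OF \<psi>1'(1) Dg])
      have g': "\<psi>0' g \<in> carrier P1" by (rule lin_map_closed[OF \<psi>0'(1) g])
      then show "p (\<psi>0' g) \<in> carrier P0" by (rule lin_map_closed[OF p])
      fix f assume f: "f \<in> carrier ?S0"
      have "f (\<psi>1' (dual_differential Q d 0 g)) = g (d 1 (\<psi>1 f))"
        using \<psi>1'(2)[OF Dg f] lin_map_closed[OF \<psi>1(1) f] by (simp add: star_map_apply)
      also have "\<dots> = ?p f (\<psi>0' g)"
        using \<psi>1(2)[OF f] \<psi>0'(2)[OF g lin_map_closed[OF sp f]] by simp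
      also have "\<dots> = f (p (\<psi>0' g))" by (rule star_map_apply[OF g'])
      finally show "f (\<psi>1' (dual_differential Q d 0 g)) = f (p (\<psi>0' g))" .
    qed
    then show ?thesis using u(2) lin_map_closed[OF \<psi>0'(1) g] by simp
  qed
  then obtain v where v: "lin_map A (dual_complex A Q (Suc (Suc 0))) X v"
    "\<And>l. l \<in> ?L (Suc 0) \<Longrightarrow> v (dual_differential Q d (Suc 0) l) = u (\<psi>1' l)"
    using cohom_exactE[OF ex lin_map_comp[OF \<psi>1'(1)[unfolded One_nat_def] u(1)]] by metis
  obtain m2 v2 w2 where L2: "dual_basis A (dual_complex A Q (Suc (Suc 0))) m2 v2 w2" using dc(2) by blast
  obtain v' where v': "lin_map A (dual_complex A Q (Suc (Suc 0))) Y v'"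
    "\<And>l. l \<in> ?L (Suc (Suc 0)) \<Longrightarrow> \<pi> (v' l) = v l"
    by (rule dual_basis_lift[OF L2 Y X \<pi>(1) v(1)]) (use \<pi>(2) lin_map_closed[OF v(1)] in auto)
  obtain u' where u': "lin_map A P0 Y u'" "\<And>x. x \<in> carrier P0 \<Longrightarrow> \<pi> (u' x) = u x"
    by (rule dual_basis_lift[OF P0 Y X \<pi>(1) u(1)]) (use \<pi>(2) lin_map_closed[OF u(1)] in auto)

  \<comment> \<open>The dual of \<phi>1 \<psi>1 - 1 - s \<open>?p\<close>, whose values lie in the
    kernel of \<open>?p\<close> by the choice of s. Hence \<tau> p = 0, and \<tau> factors through
    the cokernel of \<open>p\<close>.\<close>
  let ?\<tau> = "\<lambda>x. (\<psi>1' (\<phi>1' x) \<ominus>\<^bsub>P0\<^esub> x) \<ominus>\<^bsub>P0\<^esub> p (s' x)"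
  have \<tau>: "lin_map A P0 P0 ?\<tau>"
    by (intro lin_map_diff db0(1) lin_map_comp[OF \<phi>1' \<psi>1'(1)] lin_map_id lin_map_comp[OF s'(1) p])
  let ?D = "dual_differential Q d (Suc 0)"
  have D: "lin_map A (dual_complex A Q 1) (dual_complex A Q (Suc (Suc 0))) ?D"
    using dc(3)[of "Suc 0"] by simp
  \<comment> \<open>As u p = 0, one has u \<tau> = u \<psi>1' \<phi>1' - u. The first term lifts u
    \<psi>1' \<phi>1', and subtracting the lift u' \<tau> corrects it to a lift of \<open>u\<close>.
    Both terms vanish on the image of \<open>p\<close>.\<close>
  let ?w = "\<lambda>x. v' (?D (\<phi>1' x)) \<ominus>\<^bsub>Y\<^esub> u' (?\<tau> x)"
  show thesis
  proof (rule that)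
    show "lin_map A P0 Y ?w"
      by (rule lin_map_diff[OF db0(1) Y lin_map_comp[OF lin_map_comp[OF \<phi>1' D] v'(1)] lin_map_comp[OF \<tau> u'(1)]])
    show "\<pi> (?w x) = u x" if x: "x \<in> carrier P0" for x
    proof -
      have Dx: "?D (\<phi>1' x) \<in> ?L (Suc (Suc 0))" by (rule lin_map_closed[OF D \<phi>1'c[OF x]])
      have \<tau>x: "?\<tau> x \<in> carrier P0" by (rule lin_map_closed[OF \<tau> x])
      have a: "\<psi>1' (\<phi>1' x) \<in> carrier P0" by (rule lin_map_closed[OF \<psi>1'(1) \<phi>1'c[OF x]])
      have s'x: "s' x \<in> carrier P1" by (rule lin_map_closed[OF s'(1) x])
      have ps: "p (s' x) \<in> carrier P0" by (rule lin_map_closed[OF p s'x])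
      have uc: "u y \<in> carrier X" if "y \<in> carrier P0" for y by (rule lin_map_closed[OF u(1) that])
      have "\<pi> (?w x) = u (\<psi>1' (\<phi>1' x)) \<ominus>\<^bsub>X\<^esub> u (?\<tau> x)"
        using v'(2)[OF Dx] u'(2)[OF \<tau>x] v(2) \<phi>1'c[OF x]
        by (simp add: lin_map_minus[OF Y X \<pi>(1) lin_map_closed[OF v'(1) Dx] lin_map_closed[OF u'(1) \<tau>x]])
      also have "u (?\<tau> x) = u (\<psi>1' (\<phi>1' x)) \<ominus>\<^bsub>X\<^esub> u x"
        using a ps x uc u(2)[OF s'x]
        by (simp add: lin_map_minus[OF db0(1) X u(1)]) (simp add: a_minus_def)
      also have "u (\<psi>1' (\<phi>1' x)) \<ominus>\<^bsub>X\<^esub> (u (\<psi>1' (\<phi>1' x)) \<ominus>\<^bsub>X\<^esub> u x) = u x"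
        using uc[OF a] uc[OF x]
        by (simp add: a_minus_def X.M.minus_add X.M.r_neg1 X.M.r_neg2 X.M.a_assoc[symmetric] X.M.r_neg)
      finally show ?thesis .
    qed
    show "?w (p z) = \<zero>\<^bsub>Y\<^esub>" if z: "z \<in> carrier P1" for z
    proof -
      have pz: "p z \<in> carrier P0" by (rule lin_map_closed[OF p z])
      \<comment> \<open>This is dual to \<open>?p\<close> \<phi>1 d = \<phi>0 d d = 0.\<close>
      have "?D (\<phi>1' (p z)) = \<zero>\<^bsub>dual_complex A Q (Suc (Suc 0))\<^esub>"
      proof (rule star_eqI[OF lin_map_closed[OF D \<phi>1'c[OF pz]] left_module_zero[OF dc(1)]])
        fix q assume q: "q \<in> carrier (Q (Suc (Suc 0)))"
        have dq: "d (Suc (Suc 0)) q \<in> carrier (Q 1)" using lin_map_closed[OF r(6) q] by simp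
        have "?D (\<phi>1' (p z)) q = ?p (\<phi>1 (d (Suc (Suc 0)) q)) z"
          using q dq z by (simp add: star_map_apply \<phi>1'_def)
        also have "\<dots> = \<zero>\<^bsub>?S1\<^esub> z"
          using \<phi>1(2)[OF dq] r(9)[OF q] lin_map_zero[OF r(1) S1 \<phi>0(1)] by simp
        finally show "?D (\<phi>1' (p z)) q = \<zero>\<^bsub>dual_complex A Q (Suc (Suc 0))\<^esub> q"
          using q z by (simp add: star_zero_apply)
      qed
      moreover have "?\<tau> (p z) = \<zero>\<^bsub>P0\<^esub>"
      proof (rule dual_basis_separates[OF P0 lin_map_closed[OF \<tau> pz] P0.M.zero_closed])
        fix f assume f: "f \<in> carrier ?S0"
        have pf: "?p f \<in> carrier ?S1" by (rule lin_map_closed[OF sp f])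
        have \<psi>f: "\<psi>1 f \<in> carrier (Q 1)" by (rule lin_map_closed[OF \<psi>1(1) f])
        have a: "\<psi>1' (\<phi>1' (p z)) \<in> carrier P0" by (rule lin_map_closed[OF \<psi>1'(1) \<phi>1'c[OF pz]])
        have s'x: "s' (p z) \<in> carrier P1" by (rule lin_map_closed[OF s'(1) pz])
        have c0: "\<phi>0 (\<psi>0 (?p f)) \<in> carrier ?S1"
          by (rule lin_map_closed[OF \<phi>0(1) lin_map_closed[OF \<psi>0(1) pf]])
        let ?y = "\<phi>0 (\<psi>0 (?p f)) z \<ominus>\<^bsub>A\<^esub> f (p z)"
        have "f (\<psi>1' (\<phi>1' (p z))) = \<phi>1 (\<psi>1 f) (p z)"
          using \<psi>1'(2)[OF \<phi>1'c[OF pz] f] \<psi>f by (simp add: \<phi>1'_def)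
        also have "\<dots> = \<phi>0 (\<psi>0 (?p f)) z"
          using \<phi>1(2)[OF \<psi>f] \<psi>1(2)[OF f] star_map_apply[OF z, of p "\<phi>1 (\<psi>1 f)"] by simp
        finally have 1: "f (\<psi>1' (\<phi>1' (p z)) \<ominus>\<^bsub>P0\<^esub> p z) = ?y"
          by (simp add: functional_minus[OF db0(1) f a pz])
        have "f (p (s' (p z))) = ?p (s (?p f)) z"
          using s'(2)[OF pz pf] s'x z by (simp add: star_map_apply)
        also have "\<dots> = ?y"
          using s(2)[OF pf] z by (simp add: star_minus_apply[OF db1(1) c0 pf z] star_map_apply)
        finally have 2: "f (p (s' (p z))) = ?y" .
        have "f (?\<tau> (p z)) = ?y \<ominus>\<^bsub>A\<^esub> ?y"
          using functional_minus[OF db0(1) f P0.M.minus_closed[OF a pz] lin_map_closed[OF p s'x]]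
          by (simp add: 1 2)
        also have "\<dots> = \<zero>\<^bsub>A\<^esub>"
          using star_closed[OF c0 z] star_closed[OF f pz]
          by (simp add: abelian_group.minus_eq_zero_iff[OF ring.is_abelian_group[OF A]]
            abelian_group.minus_closed[OF ring.is_abelian_group[OF A]])
        finally show "f (?\<tau> (p z)) = f \<zero>\<^bsub>P0\<^esub>"
          by (simp add: functional_zero[OF db0(1) f])
      qed
      ultimately show ?thesis
        using lin_map_zero[OF dc(1) Y v'(1)] lin_map_zero[OF db0(1) Y u'(1)]
        by (simp add: Y.M.minus_eq_zero_iff)
    qed
  qed
qed

section \<open>Syzygies\<close>

text \<open>Composition with the two maps moves the problem to \<open>Y\<close> and back. The
  application is to the copy of D \<Lambda> inside the sum type.\<close>

lemma hom_exact_retract: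
  assumes "hom_exact A P d Y i" "left_module A Y" "left_module A Y'"
    and "lin_map A Y Y' \<phi>" "lin_map A Y' Y \<psi>" "\<And>y. y \<in> carrier Y' \<Longrightarrow> \<phi> (\<psi> y) = y"
  shows "hom_exact A P d Y' i"
  unfolding hom_exact_def
proof (intro allI impI, elim conjE)
  fix f assume f: "lin_map A (P (Suc i)) Y' f"
    "\<forall>x\<in>carrier (P (Suc (Suc i))). f (d (Suc (Suc i)) x) = \<zero>\<^bsub>Y'\<^esub>"
  then obtain h where h: "lin_map A (P i) Y h"
    "\<And>x. x \<in> carrier (P (Suc i)) \<Longrightarrow> h (d (Suc i) x) = \<psi> (f x)"
    using assms(1)[unfolded hom_exact_def, rule_format, of "\<lambda>x. \<psi> (f x)"]
      lin_map_comp[OF f(1) assms(5)] lin_map_zero[OF assms(3,2,5)] by auto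
  show "\<exists>h. lin_map A (P i) Y' h \<and> (\<forall>x\<in>carrier (P (Suc i)). h (d (Suc i) x) = f x)"
    using lin_map_comp[OF h(1) assms(4)] h(2) assms(6) lin_map_closed[OF f(1)]
    by (intro exI[of _ "\<lambda>x. \<phi> (h x)"]) simp
qed

lemma cohom_exact_retract:
  assumes "cohom_exact A L D Y i" "left_module A Y" "left_module A Y'"
    and "lin_map A Y Y' \<phi>" "lin_map A Y' Y \<psi>" "\<And>y. y \<in> carrier Y' \<Longrightarrow> \<phi> (\<psi> y) = y"
  shows "cohom_exact A L D Y' i"
  unfolding cohom_exact_def
proof (intro allI impI, elim conjE)
  fix g assume g: "lin_map A (L (Suc i)) Y' g" "\<forall>x\<in>carrier (L i). g (D i x) = \<zero>\<^bsub>Y'\<^esub>"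
  then obtain h where h: "lin_map A (L (Suc (Suc i))) Y h"
    "\<And>x. x \<in> carrier (L (Suc i)) \<Longrightarrow> h (D (Suc i) x) = \<psi> (g x)"
    using assms(1)[unfolded cohom_exact_def, rule_format, of "\<lambda>x. \<psi> (g x)"]
      lin_map_comp[OF g(1) assms(5)] lin_map_zero[OF assms(3,2,5)] by auto
  show "\<exists>h. lin_map A (L (Suc (Suc i))) Y' h \<and> (\<forall>x\<in>carrier (L (Suc i)). h (D (Suc i) x) = g x)"
    using lin_map_comp[OF h(1) assms(4)] h(2) assms(6) lin_map_closed[OF g(1)]
    by (intro exI[of _ "\<lambda>x. \<phi> (h x)"]) simp
qed

text \<open>By exactness of \<open>F\<close> a cocycle vanishes on the kernel of the differential,
  so it extends along that differential by injectivity of the dual.\<close>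

lemma (in artin_algebra) hom_exact_dual:
  assumes "projective_resolution A M F \<delta> e" "left_module A M" "injective R J"
  shows "hom_exact A F \<delta> (dual_regular J) i"
  unfolding hom_exact_def
proof (intro allI impI, elim conjE)
  note r = projective_resolutionD[OF assms(1,2)]
  fix f assume f: "lin_map A (F (Suc i)) (dual_regular J) f"
    "\<forall>x\<in>carrier (F (Suc (Suc i))). f (\<delta> (Suc (Suc i)) x) = \<zero>\<^bsub>dual_regular J\<^esub>"
  have ker: "f x = \<zero>\<^bsub>dual_regular J\<^esub>" if "x \<in> carrier (F (Suc i))" "\<delta> (Suc i) x = \<zero>\<^bsub>F i\<^esub>" for x
    using r(8)[OF that(1)] that(2) f(2) by auto
  obtain h where "lin_map A (F i) (dual_regular J) h"
    "\<And>x. x \<in> carrier (F (Suc i)) \<Longrightarrow> h (\<delta> (Suc i) x) = f x"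
    by (rule dual_regular_extend[OF assms(3) r(1,1,2,6) f(1) ker]) blast+
  then show "\<exists>h. lin_map A (F i) (dual_regular J) h \<and>
      (\<forall>x\<in>carrier (F (Suc i)). h (\<delta> (Suc i) x) = f x)" by blast
qed

text \<open>
  The maps \<open>M \<rightarrow> K\<close> that have to lift to \<open>Y\<close> are given on a presentation \<open>P1 \<rightarrow> P0 \<rightarrow> M\<close> that may
  differ from the start of the resolution \<open>F\<close>.
\<close>

lemma hom_exact_kernel:
  assumes F: "projective_resolution A M F \<delta> e" and M: "left_module A M"
    and P0: "dual_basis A P0 n b c" and e': "lin_map A P0 M e'" "e' ` carrier P0 = carrier M"
    and p: "\<And>x. x \<in> carrier P0 \<Longrightarrow> e' x = \<zero>\<^bsub>M\<^esub> \<longleftrightarrow> x \<in> p ` carrier P1" "\<And>z. z \<in> carrier P1 \<Longrightarrow> p z \<in> carrier P0"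
    and K': "left_module A K'" and Y: "left_module A Y" and K: "left_module A K"
    and \<iota>: "lin_map A K' Y \<iota>" "inj_on \<iota> (carrier K')" and \<pi>: "lin_map A Y K \<pi>"
    and ker: "\<And>y. y \<in> carrier Y \<Longrightarrow> \<pi> y = \<zero>\<^bsub>K\<^esub> \<longleftrightarrow> y \<in> \<iota> ` carrier K'"
    and lift: "\<And>u. lin_map A P0 K u \<Longrightarrow> (\<And>z. z \<in> carrier P1 \<Longrightarrow> u (p z) = \<zero>\<^bsub>K\<^esub>) \<Longrightarrow>
      \<exists>w. lin_map A P0 Y w \<and> (\<forall>x\<in>carrier P0. \<pi> (w x) = u x) \<and> (\<forall>z\<in>carrier P1. w (p z) = \<zero>\<^bsub>Y\<^esub>)"
    and ex: "hom_exact A F \<delta> Y 0"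
  shows "hom_exact A F \<delta> K' 0"
  unfolding hom_exact_def
proof (intro allI impI, elim conjE)
  note r = projective_resolutionD[OF F M]
  interpret F0: left_module A "F 0" by (rule r(1))
  interpret Y: left_module A Y by (rule Y)
  interpret K: left_module A K by (rule K)
  interpret M: left_module A M by (rule M)
  have P0l: "left_module A P0" by (rule dual_basisD[OF P0])
  have \<delta>: "lin_map A (F (Suc 0)) (F 0) (\<delta> (Suc 0))" by (rule r(6))
  fix f assume f: "lin_map A (F (Suc 0)) K' f"
    "\<forall>x\<in>carrier (F (Suc (Suc 0))). f (\<delta> (Suc (Suc 0)) x) = \<zero>\<^bsub>K'\<^esub>"
  \<comment> \<open>\<iota> f extends by \<open>ex\<close>, and \<pi> g then kills the kernel of
    \<open>e\<close>: it represents a map M \<rightarrow> K, to which the lifting hypothesis will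
    apply.\<close>
  obtain g where g: "lin_map A (F 0) Y g"
    "\<And>x. x \<in> carrier (F (Suc 0)) \<Longrightarrow> g (\<delta> (Suc 0) x) = \<iota> (f x)"
    using ex[unfolded hom_exact_def, rule_format, of "\<lambda>x. \<iota> (f x)"]
      lin_map_comp[OF f(1) \<iota>(1)] lin_map_zero[OF K' Y \<iota>(1)] f(2) by auto
  have \<pi>g: "lin_map A (F 0) K (\<lambda>x. \<pi> (g x))" by (rule lin_map_comp[OF g(1) \<pi>])
  have \<pi>g0: "\<pi> (g x) = \<zero>\<^bsub>K\<^esub>" if x: "x \<in> carrier (F 0)" "e x = \<zero>\<^bsub>M\<^esub>" for x
  proof -
    obtain y where y: "y \<in> carrier (F (Suc 0))" "x = \<delta> (Suc 0) y" using r(7)[OF x(1)] x(2) by auto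
    then have "g x = \<iota> (f y)" using g(2) by simp
    then show ?thesis
      using ker[OF lin_map_closed[OF g(1) x(1)]] lin_map_closed[OF f(1) y(1)] by blast
  qed
  \<comment> \<open>\<open>P0\<close> and \<open>F 0\<close> both cover \<open>M\<close>; \<chi> and
    l compare them over \<open>M\<close> in opposite directions.\<close>
  obtain \<chi> where \<chi>: "lin_map A P0 (F 0) \<chi>" "\<And>x. x \<in> carrier P0 \<Longrightarrow> e (\<chi> x) = e' x"
    by (rule dual_basis_lift[OF P0 r(1) M r(4) e'(1)]) (simp_all add: r(5) lin_map_closed[OF e'(1)])
  obtain n0 b0 c0 where F0: "dual_basis A (F 0) n0 b0 c0" using r(3) by blast
  obtain l where l: "lin_map A (F 0) P0 l" "\<And>x. x \<in> carrier (F 0) \<Longrightarrow> e' (l x) = e x"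
    by (rule dual_basis_lift[OF F0 P0l M e'(1) r(4)]) (simp_all add: e'(2) lin_map_closed[OF r(4)])
  have u0: "\<pi> (g (\<chi> (p z))) = \<zero>\<^bsub>K\<^esub>" if z: "z \<in> carrier P1" for z
    using \<chi>(2)[OF p(2)[OF z]] p(1)[OF p(2)[OF z]] z lin_map_closed[OF \<chi>(1) p(2)[OF z]]
    by (intro \<pi>g0) auto
  obtain w where w: "lin_map A P0 Y w" "\<And>x. x \<in> carrier P0 \<Longrightarrow> \<pi> (w x) = \<pi> (g (\<chi> x))"
    "\<And>z. z \<in> carrier P1 \<Longrightarrow> w (p z) = \<zero>\<^bsub>Y\<^esub>"
    using lift[OF lin_map_comp[OF \<chi>(1) \<pi>g] u0] by blast
  \<comment> \<open>The difference takes values in the kernel of \<pi>, because x - \<chi>(l x) lies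
    in the kernel of \<open>e\<close>. It still extends \<iota> f, because l \<delta> takes values
    in the image of \<open>p\<close>, which w kills.\<close>
  let ?g = "\<lambda>x. g x \<ominus>\<^bsub>Y\<^esub> w (l x)"
  have g': "lin_map A (F 0) Y ?g"
    by (rule lin_map_diff[OF r(1) Y g(1) lin_map_comp[OF l(1) w(1)]])
  have "?g x \<in> \<iota> ` carrier K'" if x: "x \<in> carrier (F 0)" for x
  proof -
    have lx: "l x \<in> carrier P0" by (rule lin_map_closed[OF l(1) x])
    have \<chi>lx: "\<chi> (l x) \<in> carrier (F 0)" by (rule lin_map_closed[OF \<chi>(1) lx])
    have "e (x \<ominus>\<^bsub>F 0\<^esub> \<chi> (l x)) = \<zero>\<^bsub>M\<^esub>"
      using \<chi>(2)[OF lx] l(2)[OF x] lin_map_closed[OF r(4) x]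
      by (simp add: lin_map_minus[OF r(1) M r(4) x \<chi>lx] M.M.minus_eq_zero_iff)
    then have "\<pi> (g (x \<ominus>\<^bsub>F 0\<^esub> \<chi> (l x))) = \<zero>\<^bsub>K\<^esub>"
      by (rule \<pi>g0[OF F0.M.minus_closed[OF x \<chi>lx]])
    then have "\<pi> (?g x) = \<zero>\<^bsub>K\<^esub>"
      using w(2)[OF lx]
      by (simp add: lin_map_minus[OF r(1) K \<pi>g x \<chi>lx]
          lin_map_minus[OF Y K \<pi> lin_map_closed[OF g(1) x] lin_map_closed[OF w(1) lx]])
    then show ?thesis using ker[OF lin_map_closed[OF g' x]] by blast
  qed
  then obtain h where h: "lin_map A (F 0) K' h" "\<And>x. x \<in> carrier (F 0) \<Longrightarrow> \<iota> (h x) = ?g x"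
    using dual_basis_lift[OF F0 K' Y \<iota>(1) g'] by metis
  have "h (\<delta> (Suc 0) x) = f x" if x: "x \<in> carrier (F (Suc 0))" for x
  proof -
    have \<delta>x: "\<delta> (Suc 0) x \<in> carrier (F 0)" by (rule lin_map_closed[OF \<delta> x])
    have "e' (l (\<delta> (Suc 0) x)) = \<zero>\<^bsub>M\<^esub>"
      using l(2)[OF \<delta>x] r(10)[of x] x by simp
    then have "w (l (\<delta> (Suc 0) x)) = \<zero>\<^bsub>Y\<^esub>"
      using p(1)[OF lin_map_closed[OF l(1) \<delta>x]] w(3) by auto
    then have "\<iota> (h (\<delta> (Suc 0) x)) = \<iota> (f x)"
      using h(2)[OF \<delta>x] g(2)[OF x] lin_map_closed[OF \<iota>(1) lin_map_closed[OF f(1) x]]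
      by (simp add: a_minus_def)
    then show ?thesis
      using inj_onD[OF \<iota>(2)] lin_map_closed[OF h(1) \<delta>x] lin_map_closed[OF f(1) x] by blast
  qed
  then show "\<exists>h. lin_map A (F 0) K' h \<and> (\<forall>x\<in>carrier (F (Suc 0)). h (\<delta> (Suc 0) x) = f x)"
    using h(1) by blast
qed


text \<open>The map P_j \<rightarrow> K_j. Degree 0 is separate because K_0 is reached by the
  augmentation; the tags are those of \<open>syzygy\<close>.\<close>

definition syzygy_proj :: "(nat \<Rightarrow> 'p \<Rightarrow> 'p) \<Rightarrow> ('p \<Rightarrow> 'x) \<Rightarrow> nat \<Rightarrow> 'p \<Rightarrow> 'x + 'p" where
  "syzygy_proj d e j x = (case j of 0 \<Rightarrow> Inl (e x) | Suc i \<Rightarrow> Inr (d (Suc i) x))"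

text \<open>The resolution cut into short exact sequences 0 \<rightarrow> K_(j+1) \<rightarrow> P_j
  \<rightarrow> K_j \<rightarrow> 0. Every K_(j+1) lives in the right summand, so removing the tag
  by \<open>projr\<close> is the inclusion for all j at once.\<close>

lemma syzygy:
  assumes "projective_resolution A X P d e" "left_module A X"
  shows left_module_syzygy: "left_module A (syzygy X P d j)"
    and lin_map_syzygy_proj: "lin_map A (P j) (syzygy X P d j) (syzygy_proj d e j)"
    and surj_syzygy_proj: "syzygy_proj d e j ` carrier (P j) = carrier (syzygy X P d j)"
    and lin_map_syzygy_incl: "lin_map A (syzygy X P d (Suc j)) (P j) projr"
    and inj_syzygy_incl: "inj_on projr (carrier (syzygy X P d (Suc j)))"
    and syzygy_proj_eq_zero_iff: "x \<in> carrier (P j) \<Longrightarrow>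
      syzygy_proj d e j x = \<zero>\<^bsub>syzygy X P d j\<^esub> \<longleftrightarrow> x \<in> projr ` carrier (syzygy X P d (Suc j))"
proof -
  note r = projective_resolutionD[OF assms]
  let ?I = "\<lambda>j. d (Suc j) ` carrier (P (Suc j))"
  let ?K = "\<lambda>j. (P j)\<lparr>carrier := ?I j\<rparr>"
  have I: "submodule (?I j) A (P j)" for j
    by (rule submodule_image[OF r(1,1,6) left_module.submodule_carrier[OF r(1)]])
  have lI: "left_module A (?K j)" for j by (rule left_module_submodule[OF r(1) I])
  have injr: "inj_on Inr (carrier (?K j))" and injl: "inj_on Inl (carrier X)" for j
    by (simp_all add: inj_on_def)
  note cr = copy_module[OF lI injr] and cl = copy_module[OF assms(2) injl]
  show "left_module A (syzygy X P d j)"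
    using cl(1) cr(1) by (cases j) simp_all
  show "lin_map A (P j) (syzygy X P d j) (syzygy_proj d e j)"
  proof (cases j)
    case 0
    show ?thesis
      using lin_map_comp[OF r(4) cl(2)] by (simp add: 0 syzygy_proj_def[abs_def])
  next
    case (Suc i)
    have "lin_map A (P (Suc i)) (?K i) (d (Suc i))"
      by (rule lin_map_subcodomain[OF r(6)]) simp
    from lin_map_comp[OF this cr(2)] show ?thesis by (simp add: Suc syzygy_proj_def[abs_def])
  qed
  show "syzygy_proj d e j ` carrier (P j) = carrier (syzygy X P d j)"
    by (cases j) (simp_all add: cl(4) cr(4) syzygy_proj_def[abs_def] image_image r(5)[symmetric])
  have cc: "carrier (syzygy X P d (Suc j)) = Inr ` ?I j" using cr(4) by simp
  show "lin_map A (syzygy X P d (Suc j)) (P j) projr"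
  proof (rule lin_map_congI)
    show "left_module A (syzygy X P d (Suc j))" using cr(1) by simp
    show "lin_map A (syzygy X P d (Suc j)) (P j) (inv_into (carrier (?K j)) Inr)"
      using lin_map_from_submodule[OF cr(3) submodule_subset[OF I]] by simp
    show "inv_into (carrier (?K j)) Inr x = projr x" if "x \<in> carrier (syzygy X P d (Suc j))" for x
      using that inv_into_f_f[OF injr] unfolding cc by auto
  qed
  show "inj_on projr (carrier (syzygy X P d (Suc j)))"
    unfolding cc by (auto simp: inj_on_def)
  show "syzygy_proj d e j x = \<zero>\<^bsub>syzygy X P d j\<^esub> \<longleftrightarrow> x \<in> projr ` carrier (syzygy X P d (Suc j))"
    if x: "x \<in> carrier (P j)"
  proof -
    have "projr ` carrier (syzygy X P d (Suc j)) = ?I j"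
      unfolding cc by (simp add: image_image)
    moreover have "syzygy_proj d e j x = \<zero>\<^bsub>syzygy X P d j\<^esub> \<longleftrightarrow> x \<in> ?I j"
    proof (cases j)
      case 0
      then show ?thesis
        using r(7)[of x] x by (simp add: syzygy_proj_def copy_module_def)
    next
      case (Suc i)
      then show ?thesis
        using r(8)[of x i] x by (simp add: syzygy_proj_def copy_module_def)
    qed
    ultimately show ?thesis by simp
  qed
qed

lemma minimal_presentationD:
  assumes "minimal_presentation A M P1 P0 d e" "left_module A M"
  shows "\<exists>n b c. dual_basis A P0 n b c" "\<exists>n b c. dual_basis A P1 n b c"
    "lin_map A P0 M e" "e ` carrier P0 = carrier M" "lin_map A P1 P0 d"
    "x \<in> carrier P0 \<Longrightarrow> e x = \<zero>\<^bsub>M\<^esub> \<longleftrightarrow> x \<in> d ` carrier P1"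
proof -
  have p: "fin_gen A P0" "projective A P0" "e \<in> lmod_hom A P0 M" "e ` carrier P0 = carrier M"
    "fin_gen A P1" "projective A P1" "d \<in> lmod_hom A P1 (P0\<lparr>carrier := a_kernel P0 M e\<rparr>)"
    "d ` carrier P1 = a_kernel P0 M e"
    using assms(1) by (simp_all add: minimal_presentation_def projective_cover_def)
  show "\<exists>n b c. dual_basis A P0 n b c" "\<exists>n b c. dual_basis A P1 n b c"
    using p fin_gen_projective_iff by blast+
  show "lin_map A P0 M e" by (rule lmod_hom_lin[OF p(3)])
  show "e ` carrier P0 = carrier M" by (rule p)
  show "lin_map A P1 P0 d"
    by (rule lin_map_from_submodule[OF lmod_hom_lin[OF p(7)]]) (auto simp: a_kernel_def')
  show "x \<in> carrier P0 \<Longrightarrow> e x = \<zero>\<^bsub>M\<^esub> \<longleftrightarrow> x \<in> d ` carrier P1"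
    unfolding p(8) by (simp add: a_kernel_def')
qed

theorem proposition3p3:
  fixes R :: "'r ring" and \<Lambda> :: "('r, 'a) module"
    and J :: "('r, 'j) module" and \<iota> :: "'r set \<Rightarrow> 'j"
    and DA :: "('a, 'a \<Rightarrow> 'j) module"
    and P :: "nat \<Rightarrow> ('a, 'p) module" and d :: "nat \<Rightarrow> 'p \<Rightarrow> 'p" and \<epsilon> :: "'p \<Rightarrow> 'a \<Rightarrow> 'j"
    and M :: "('a, 'm) module" and t :: enat
  assumes "artin_algebra R \<Lambda>"
    and "injective_envelope R (quotient_module (regular R) (jacobson_radical R)) J \<iota>"
    and "DA = dual_module R \<Lambda> J (regular (opposite \<Lambda>))"
    and "minimal_projective_resolution \<Lambda> DA P d \<epsilon>"
    and "left_module \<Lambda> M" and "fin_gen \<Lambda> M"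
    and "t \<ge> 1"
    and "trivial_group (Ext \<Lambda> 1 M (regular \<Lambda>))"
    and "torsionfree \<Lambda> t M"
  shows "M \<in> perp1 \<Lambda> (syzygies DA P d t)"
proof -
  interpret artin_algebra R \<Lambda> by fact
  let ?B = "opposite \<Lambda>"
  note M = assms(5) and fl = finite_length_regular
  \<comment> \<open>The transpose is a right module, so its resolution needs the chain conditions
    for the opposite algebra.\<close>
  note flB = artin_algebra.finite_length_regular[OF artin_algebra_opposite]
  have J: "injective R J" using assms(2) by (simp add: injective_envelope_def)
  then have lJ: "left_module R J" by (simp add: injective_def)
  have DA: "left_module \<Lambda> DA" unfolding assms(3) by (rule left_module_dual_regular[OF lJ])
  have P: "projective_resolution \<Lambda> DA P d \<epsilon>"
    using assms(4) by (simp add: minimal_projective_resolution_def)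
  note rP = projective_resolutionD[OF P DA] and syz = syzygy[OF P DA]
  let ?K = "syzygy DA P d"

  obtain P1 P0 :: "('a, 'a univ) module" and p e where
    pres: "minimal_presentation \<Lambda> M P1 P0 p e" and
    T: "transpose_module \<Lambda> M = quotient_module (star \<Lambda> P1) (star_map P1 p ` carrier (star \<Lambda> P0))"
    using transpose_module_presentation[OF M assms(6) fl] unfolding star_map_def by metis
  note pr = minimal_presentationD[OF pres M]
  obtain n0 b0 c0 where P0: "dual_basis \<Lambda> P0 n0 b0 c0" using pr(1) by blast
  obtain n1 b1 c1 where P1: "dual_basis \<Lambda> P1 n1 b1 c1" using pr(2) by blast
  have S0: "left_module ?B (star \<Lambda> P0)" and S1: "left_module ?B (star \<Lambda> P1)"
    using left_module_star dual_basisD(1) P0 P1 by blast+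
  have N: "submodule (star_map P1 p ` carrier (star \<Lambda> P0)) ?B (star \<Lambda> P1)"
    by (rule submodule_image[OF S0 S1 lin_map_star_map[OF dual_basisD(1)[OF P1] pr(5)]
        left_module.submodule_carrier[OF S0]])
  note qm = quotient_module[OF S1 N, folded T]
  have fgT: "fin_gen ?B (transpose_module \<Lambda> M)"
    by (rule fin_gen_image[OF S1 qm(1,2,3) dual_basis_fin_gen[OF dual_basis_star[OF P1]]])
  obtain Q dQ eQ where Q: "chosen_resolution ?B (transpose_module \<Lambda> M) = (Q, dQ, eQ)"
    and rQ: "projective_resolution ?B (transpose_module \<Lambda> M) Q dQ eQ"
    by (rule chosen_resolution[OF qm(1) fgT flB])
  obtain F \<delta> e0 where F: "chosen_resolution \<Lambda> M = (F, \<delta>, e0)"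
    and rF: "projective_resolution \<Lambda> M F \<delta> e0"
    by (rule chosen_resolution[OF M assms(6) fl])
  note rQ' = projective_resolutionD[OF rQ qm(1)] and rF' = projective_resolutionD[OF rF M]
  have lB: "left_module ?B (regular ?B)" and l\<Lambda>: "left_module \<Lambda> (regular \<Lambda>)"
    by (rule left_module_regular, rule ring_opposite, rule A.ring_axioms,
        rule left_module_regular, rule A.ring_axioms)

  \<comment> \<open>The index counts from 0 while torsionfreeness starts in degree 1, whence the
    bound on \<open>Suc i\<close>.\<close>
  have tf: "hom_exact ?B Q dQ (regular ?B) i" if "enat (Suc i) \<le> t" for i
  proof -
    have "trivial_group (Ext ?B (Suc i) (transpose_module \<Lambda> M) (regular ?B))"
      using assms(9) that by (simp add: torsionfree_def)
    then show ?thesis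
      using trivial_cohomology_iff[where P = Q and d = dQ and i = i, OF lB rQ'(1) rQ'(6) rQ'(9)]
      by (simp add: Ext_chosen_resolution[OF Q])
  qed
  \<comment> \<open>The coefficients are taken in the sum type of the syzygies; the ring itself has
    another type and is treated separately below.\<close>
  have Ext1: "trivial_group (Ext \<Lambda> 1 M Y) \<longleftrightarrow> hom_exact \<Lambda> F \<delta> Y 0"
    if "left_module \<Lambda> Y" for Y :: "('a, ('a \<Rightarrow> 'j) + 'p) module"
    using trivial_cohomology_iff[where P = F and d = \<delta> and i = 0, OF that rF'(1) rF'(6) rF'(9)]
    by (simp add: Ext_chosen_resolution[OF F])
  have "hom_exact \<Lambda> F \<delta> (regular \<Lambda>) 0"
    using trivial_cohomology_iff[where P = F and d = \<delta> and i = 0, OF l\<Lambda> rF'(1) rF'(6) rF'(9)] assms(8)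
    by (simp add: Ext_chosen_resolution[OF F])
  \<comment> \<open>The vanishing of Ext^1(M, \<Lambda>) spreads to the projective terms
    P_j.\<close>
  then have exP: "hom_exact \<Lambda> F \<delta> (P j) 0" for j
    using hom_exact_dual_basis[where P = F and d = \<delta> and i = 0, OF _ _ rF'(1)] rP(3)[of j] by blast

  \<comment> \<open>K_0 is only a copy of \<open>DA\<close>, so the facts about the dual have to be
    carried over along the tag and its inverse.\<close>
  let ?Inl = "Inl :: ('a \<Rightarrow> 'j) \<Rightarrow> ('a \<Rightarrow> 'j) + 'p"
  have injl: "inj_on ?Inl (carrier DA)" by (simp add: inj_on_def)
  note cl = copy_module[OF DA injl]
  have cl_inv: "?Inl (inv_into (carrier DA) ?Inl y) = y" if "y \<in> carrier (copy_module ?Inl DA)" for y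
    using that by (auto simp: cl(4) f_inv_into_f)
  have ex0: "hom_exact \<Lambda> F \<delta> (?K 0) 0"
    using hom_exact_retract[where \<phi> = ?Inl and \<psi> = "inv_into (carrier DA) ?Inl", OF hom_exact_dual[OF rF M J, folded assms(3)] DA cl(1,2,3) cl_inv]
    by simp
  have base: "cohom_exact \<Lambda> (dual_complex \<Lambda> Q) (dual_differential Q dQ) (?K 0) i"
    if "enat (Suc i) \<le> t" for i
    using cohom_exact_retract[where \<phi> = ?Inl and \<psi> = "inv_into (carrier DA) ?Inl", OF cohom_exact_dual[OF rQ qm(1) tf[OF that] J, folded assms(3)]
        DA cl(1,2,3) cl_inv]
    by simp
  note dc = dual_complex[OF rQ qm(1)]
  \<comment> \<open>Dimension shifting in the instance i = 0: vanishing of Tor_1 against K_j comes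
    from Tor_(j+1) against K_0, which requires j + 1 \<le> t.\<close>
  have exK: "cohom_exact \<Lambda> (dual_complex \<Lambda> Q) (dual_differential Q dQ) (?K j) 0"
    if j: "enat (Suc j) \<le> t" for j
  proof (rule cohom_exact_shift[where K = ?K and P = P and t = t and \<iota> = "\<lambda>j. projr" and \<pi> = "syzygy_proj d \<epsilon>"])
    show "cohom_exact \<Lambda> (dual_complex \<Lambda> Q) (dual_differential Q dQ) (P j) i" for i j
      using cohom_exact_projective[OF rQ qm(1)] rP(3)[of j] by blast
    show "enat (Suc 0 + j) \<le> t" using j by simp
  qed (rule dc(2,3,4) syz rP(1) base; assumption)+

  have "hom_exact \<Lambda> F \<delta> (?K j) 0" if "enat j \<le> t" for j
  proof (cases j)
    case 0
    then show ?thesis using ex0 by simp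
  next
    case (Suc i)
    \<comment> \<open>Lifting maps M \<rightarrow> K_i requires i + 1 \<le> t, which is exactly the
      assumption on the index of K_(i+1); nothing is lost at the upper end.\<close>
    have "hom_exact \<Lambda> F \<delta> (?K (Suc i)) 0"
    proof (rule hom_exact_kernel[OF rF M P0 pr(3,4,6) lin_map_closed[OF pr(5)] syz(1) rP(1) syz(1,4,5,2,6) _ exP])
      fix u assume u: "lin_map \<Lambda> P0 (?K i) u" "\<And>z. z \<in> carrier P1 \<Longrightarrow> u (p z) = \<zero>\<^bsub>?K i\<^esub>"
      have "enat (Suc i) \<le> t" using that Suc by simp
      from lift_of_transpose[OF P1 P0 pr(5) T rQ syz(1) rP(1) syz(2,3) exK[OF this] u]
      show "\<exists>w. lin_map \<Lambda> P0 (P i) w \<and> (\<forall>x\<in>carrier P0. syzygy_proj d \<epsilon> i (w x) = u x) \<and>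
          (\<forall>z\<in>carrier P1. w (p z) = \<zero>\<^bsub>P i\<^esub>)" by metis
    qed
    then show ?thesis by (simp only: Suc)
  qed
  then show ?thesis
    using M assms(6) Ext1[OF syz(1)] by (auto simp: perp1_def syzygies_def)
qed

end
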